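(* Connected Vertex Cover admits a strict time efficient PSAKS with ${\cal O}(k^{\lceil \frac{\alpha}{\alpha-1} \rceil} + k^2)$ vertices.
   Context: Connected Vertex Cover is the parameterized optimization (minimization) problem $CVC(G,k,S)=\infty$ if $S$ is not a connected vertex cover of $G$ (i.e. $G[S]$ is not connected or some edge has no endpoint in $S$), and $CVC(G,k,S)=\min\{|S|,k+1\}$ otherwise. An $\alpha$-approximate kernel is a pair of polynomial-time algorithms: a reduction algorithm mapping $(I,k)$ to $(I',k')$ with $|I'|+k'$ bounded by a computable function of $k$, and a solution lifting algorithm turning a solution $s'$ of $(I',k')$ into a solution $s$ of $(I,k)$ with $\frac{\Pi(I,k,s)}{OPT(I,k)}\le \alpha\cdot\frac{\Pi(I',k',s')}{OPT(I',k')}$ for minimization problems. It is strict if moreover $\frac{\Pi(I,k,s)}{OPT(I,k)}\le \max\{\frac{\Pi(I',k',s')}{OPT(I',k')},\alpha\}$. A PSAKS (polynomial size approximate kernelization scheme) is a family of $\alpha$-approximate kernels of polynomial size, one for every $\alpha>1$; it is strict if each is strict, and time efficient if the reduction and solution lifting algorithms run in time $f(\alpha)\cdot|I|^c$ for a constant $c$ independent of $\alpha$, $I$, $k$. *)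

theory Defs
  imports
    "HOL-Library.Extended_Real"
    "HOL-Computational_Algebra.Polynomial"
    "Graph_Theory.Digraph_Component"
    "Graph_Theory.Pair_Digraph"
begin

section \<open>A model of computation\<close>

text \<open>
  Algorithms are programs of a first-order functional language over binary trees (the language F
  of N. D. Jones, Computability and Complexity from a Programming Perspective, 1997). A program is
  a list of bodies of one-argument, mutually recursive functions; the function with index 0 is the
  entry point. Every elementary operation costs one time unit. Since trees are immutable, values
  can be represented by pointers to shared nodes; the model simulates, and is simulated by,
  Turing machines with polynomial overhead.
\<close>

datatype dtree = Leaf | Node dtree dtree

primrec dsize :: "dtree \<Rightarrow> nat" where
  "dsize Leaf = 1"
| "dsize (Node l r) = dsize l + dsize r + 1"

primrec dhd :: "dtree \<Rightarrow> dtree" where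
  "dhd Leaf = Leaf"
| "dhd (Node l r) = l"

primrec dtl :: "dtree \<Rightarrow> dtree" where
  "dtl Leaf = Leaf"
| "dtl (Node l r) = r"

datatype expr =
    Arg
  | LeafE
  | NodeE expr expr
  | HdE expr
  | TlE expr
  | IfE expr expr expr
  | Call nat expr

type_synonym program = "expr list"

text \<open>
  \<open>eval P x e v t\<close>: in program \<open>P\<close>, with the argument of the current function bound to \<open>x\<close>,
  expression \<open>e\<close> evaluates to \<open>v\<close> in exactly \<open>t\<close> time units. \<open>Leaf\<close> plays the role of false,
  every other tree counts as true. Diverging evaluations have no value.
\<close>

inductive eval :: "program \<Rightarrow> dtree \<Rightarrow> expr \<Rightarrow> dtree \<Rightarrow> nat \<Rightarrow> bool" for P where
  eval_Arg: "eval P x Arg x 1"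
| eval_LeafE: "eval P x LeafE Leaf 1"
| eval_NodeE: "eval P x a u s \<Longrightarrow> eval P x b v t \<Longrightarrow> eval P x (NodeE a b) (Node u v) (s + t + 1)"
| eval_HdE: "eval P x a u s \<Longrightarrow> eval P x (HdE a) (dhd u) (s + 1)"
| eval_TlE: "eval P x a u s \<Longrightarrow> eval P x (TlE a) (dtl u) (s + 1)"
| eval_IfE_true: "eval P x c w s \<Longrightarrow> w \<noteq> Leaf \<Longrightarrow> eval P x a v t \<Longrightarrow> eval P x (IfE c a b) v (s + t + 1)"
| eval_IfE_false: "eval P x c Leaf s \<Longrightarrow> eval P x b v t \<Longrightarrow> eval P x (IfE c a b) v (s + t + 1)"
| eval_Call: "eval P x a u s \<Longrightarrow> i < length P \<Longrightarrow> eval P u (P ! i) v t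
    \<Longrightarrow> eval P x (Call i a) v (s + t + 1)"

text \<open>
  The running time includes the size of the output, i.e. the time for writing the output out
  explicitly. So sharing cannot be used to output large trees quickly.
\<close>

definition runs_within :: "program \<Rightarrow> dtree \<Rightarrow> dtree \<Rightarrow> real \<Rightarrow> bool" where
  "runs_within P x y T \<longleftrightarrow>
     P \<noteq> [] \<and> (\<exists>t. eval P x (P ! 0) y t \<and> real (t + dsize y) \<le> T)"

fun enc_list :: "dtree list \<Rightarrow> dtree" where
  "enc_list [] = Leaf"
| "enc_list (x # xs) = Node x (enc_list xs)"

definition enc_nat :: "nat \<Rightarrow> dtree" where
  "enc_nat n = enc_list (replicate n Leaf)"

definition enc_bool :: "bool \<Rightarrow> dtree" where
  "enc_bool b = (if b then Node Leaf Leaf else Leaf)"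

definition computable_fun :: "(nat \<Rightarrow> nat) \<Rightarrow> bool" where
  "computable_fun g \<longleftrightarrow> (\<exists>P. \<forall>k. \<exists>T. runs_within P (enc_nat k) (enc_nat (g k)) T)"


section \<open>Parameterized minimization problems and approximate kernels\<close>

text \<open>
  Instances and solutions are mathematical objects together with their encodings as trees;
  \<open>solutions P I\<close> contains all candidates, infeasible ones have value \<open>\<infinity>\<close>.
\<close>

record ('i, 's) min_problem =
  instances :: "'i set"
  solutions :: "'i \<Rightarrow> 's set"
  objective :: "'i \<Rightarrow> nat \<Rightarrow> 's \<Rightarrow> ereal"
  enc_inst :: "'i \<Rightarrow> dtree"
  enc_sol :: "'i \<Rightarrow> 's \<Rightarrow> dtree"

definition OPT :: "('i, 's) min_problem \<Rightarrow> 'i \<Rightarrow> nat \<Rightarrow> ereal" where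
  "OPT P I k = (INF s\<in>solutions P I. objective P I k s)"

definition inst_size :: "('i, 's) min_problem \<Rightarrow> 'i \<Rightarrow> nat" where
  "inst_size P I = dsize (enc_inst P I)"

text \<open>
  The quotient of value and optimum. The first case fixes the otherwise meaningless quotients
  \<open>\<infinity> / \<infinity>\<close> and \<open>0 / 0\<close>: an optimal solution has ratio 1.
\<close>

definition approx_ratio :: "('i, 's) min_problem \<Rightarrow> 'i \<Rightarrow> nat \<Rightarrow> 's \<Rightarrow> ereal" where
  "approx_ratio P I k s =
     (if objective P I k s = OPT P I k then 1 else objective P I k s / OPT P I k)"

text \<open>
  The maps computed by the reduction and the solution lifting algorithm, and the programs
  computing them. \<open>lift K I k I' k' s'\<close> is only relevant when \<open>reduce K I k = (I', k')\<close>.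
\<close>

record ('i, 's) kernelization =
  reduce :: "'i \<Rightarrow> nat \<Rightarrow> 'i \<times> nat"
  lift :: "'i \<Rightarrow> nat \<Rightarrow> 'i \<Rightarrow> nat \<Rightarrow> 's \<Rightarrow> 's"
  reduce_prog :: program
  lift_prog :: program

definition enc_pinst :: "('i, 's) min_problem \<Rightarrow> 'i \<Rightarrow> nat \<Rightarrow> dtree" where
  "enc_pinst P I k = Node (enc_inst P I) (enc_nat k)"

definition enc_lift_input :: "('i, 's) min_problem \<Rightarrow> 'i \<Rightarrow> nat \<Rightarrow> 'i \<Rightarrow> nat \<Rightarrow> 's \<Rightarrow> dtree" where
  "enc_lift_input P I k I' k' s' =
     Node (enc_pinst P I k) (Node (enc_pinst P I' k') (enc_sol P I' s'))"

definition well_typed :: "('i, 's) min_problem \<Rightarrow> ('i, 's) kernelization \<Rightarrow> bool" where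
  "well_typed P K \<longleftrightarrow>
     (\<forall>I\<in>instances P. \<forall>k I' k'. reduce K I k = (I', k') \<longrightarrow>
        I' \<in> instances P \<and> (\<forall>s'\<in>solutions P I'. lift K I k I' k' s' \<in> solutions P I))"

text \<open>
  The two programs compute the two maps, within time bounds that may depend on the whole input of
  the respective program.
\<close>

definition implemented_within ::
  "('i, 's) min_problem \<Rightarrow> ('i, 's) kernelization \<Rightarrow>
   ('i \<Rightarrow> nat \<Rightarrow> real) \<Rightarrow> ('i \<Rightarrow> nat \<Rightarrow> 'i \<Rightarrow> nat \<Rightarrow> 's \<Rightarrow> real) \<Rightarrow> bool" where
  "implemented_within P K T_red T_lift \<longleftrightarrow>
     (\<forall>I\<in>instances P. \<forall>k I' k'. reduce K I k = (I', k') \<longrightarrow>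
        runs_within (reduce_prog K) (enc_pinst P I k) (enc_pinst P I' k') (T_red I k) \<and>
        (\<forall>s'\<in>solutions P I'.
           runs_within (lift_prog K) (enc_lift_input P I k I' k' s')
             (enc_sol P I (lift K I k I' k' s')) (T_lift I k I' k' s')))"

definition polynomial_time :: "('i, 's) min_problem \<Rightarrow> ('i, 's) kernelization \<Rightarrow> bool" where
  "polynomial_time P K \<longleftrightarrow>
     (\<exists>p :: nat poly. implemented_within P K
        (\<lambda>I k. real (poly p (dsize (enc_pinst P I k))))
        (\<lambda>I k I' k' s'. real (poly p (dsize (enc_lift_input P I k I' k' s')))))"

definition size_bounded :: "('i, 's) min_problem \<Rightarrow> ('i, 's) kernelization \<Rightarrow> (nat \<Rightarrow> nat) \<Rightarrow> bool" where
  "size_bounded P K g \<longleftrightarrow>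
     (\<forall>I\<in>instances P. \<forall>k I' k'. reduce K I k = (I', k') \<longrightarrow> inst_size P I' + k' \<le> g k)"

definition approx_kernel :: "('i, 's) min_problem \<Rightarrow> real \<Rightarrow> ('i, 's) kernelization \<Rightarrow> bool" where
  "approx_kernel P \<alpha> K \<longleftrightarrow>
     well_typed P K \<and> polynomial_time P K \<and>
     (\<exists>g. computable_fun g \<and> size_bounded P K g) \<and>
     (\<forall>I\<in>instances P. \<forall>k I' k'. reduce K I k = (I', k') \<longrightarrow>
        (\<forall>s'\<in>solutions P I'.
           approx_ratio P I k (lift K I k I' k' s') \<le> ereal \<alpha> * approx_ratio P I' k' s'))"

definition strict_approx_kernel :: "('i, 's) min_problem \<Rightarrow> real \<Rightarrow> ('i, 's) kernelization \<Rightarrow> bool" where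
  "strict_approx_kernel P \<alpha> K \<longleftrightarrow>
     approx_kernel P \<alpha> K \<and>
     (\<forall>I\<in>instances P. \<forall>k I' k'. reduce K I k = (I', k') \<longrightarrow>
        (\<forall>s'\<in>solutions P I'.
           approx_ratio P I k (lift K I k I' k' s') \<le> max (approx_ratio P I' k' s') (ereal \<alpha>)))"

definition polynomial_size :: "('i, 's) min_problem \<Rightarrow> ('i, 's) kernelization \<Rightarrow> bool" where
  "polynomial_size P K \<longleftrightarrow> (\<exists>p :: nat poly. size_bounded P K (poly p))"

text \<open>A family of kernelizations is indexed by the approximation factor.\<close>

definition PSAKS :: "('i, 's) min_problem \<Rightarrow> (real \<Rightarrow> ('i, 's) kernelization) \<Rightarrow> bool" where
  "PSAKS P K \<longleftrightarrow> (\<forall>\<alpha>>1. approx_kernel P \<alpha> (K \<alpha>) \<and> polynomial_size P (K \<alpha>))"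

definition strict_PSAKS :: "('i, 's) min_problem \<Rightarrow> (real \<Rightarrow> ('i, 's) kernelization) \<Rightarrow> bool" where
  "strict_PSAKS P K \<longleftrightarrow> PSAKS P K \<and> (\<forall>\<alpha>>1. strict_approx_kernel P \<alpha> (K \<alpha>))"

text \<open>
  The bound is in terms of the size of \<open>I\<close> alone, not of the parameter, which is encoded in unary.
\<close>

definition time_efficient :: "('i, 's) min_problem \<Rightarrow> (real \<Rightarrow> ('i, 's) kernelization) \<Rightarrow> bool" where
  "time_efficient P K \<longleftrightarrow>
     (\<exists>(f :: real \<Rightarrow> real) (c :: nat). \<forall>\<alpha>>1.
        implemented_within P (K \<alpha>)
          (\<lambda>I k. f \<alpha> * real (inst_size P I) ^ c)
          (\<lambda>I k I' k' s'. f \<alpha> * real (inst_size P I) ^ c))"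


section \<open>Connected Vertex Cover\<close>

type_synonym ugraph = "nat pair_pre_digraph"

text \<open>
  A \<open>pair_graph\<close> is a finite simple undirected graph, each edge being represented by its two
  opposite arcs. The library's \<open>connected\<close> requires a nonempty vertex set, so \<open>{}\<close> is never a
  connected vertex cover.
\<close>

definition vertex_cover :: "'a pair_pre_digraph \<Rightarrow> 'a set \<Rightarrow> bool" where
  "vertex_cover G S \<longleftrightarrow> S \<subseteq> pverts G \<and> (\<forall>(u, v)\<in>parcs G. u \<in> S \<or> v \<in> S)"

definition connected_vertex_cover :: "'a pair_pre_digraph \<Rightarrow> 'a set \<Rightarrow> bool" where
  "connected_vertex_cover G S \<longleftrightarrow> vertex_cover G S \<and> connected (with_proj G \<restriction> S)"

text \<open>
  Instances have vertex set \<open>{0, ..., n - 1}\<close>; they are encoded by their adjacency matrices, and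
  vertex sets by their characteristic vectors.
\<close>

definition enc_graph :: "ugraph \<Rightarrow> dtree" where
  "enc_graph G = (let n = card (pverts G) in
     enc_list (map (\<lambda>i. enc_list (map (\<lambda>j. enc_bool ((i, j) \<in> parcs G)) [0..<n])) [0..<n]))"

definition enc_vset :: "ugraph \<Rightarrow> nat set \<Rightarrow> dtree" where
  "enc_vset G S = enc_list (map (\<lambda>i. enc_bool (i \<in> S)) [0..<card (pverts G)])"

definition CVC_value :: "ugraph \<Rightarrow> nat \<Rightarrow> nat set \<Rightarrow> ereal" where
  "CVC_value G k S =
     (if connected_vertex_cover G S then ereal (real (min (card S) (k + 1))) else \<infinity>)"

definition CVC :: "(ugraph, nat set) min_problem" where
  "CVC = \<lparr> instances = {G. pair_graph G \<and> (\<exists>n. pverts G = {..<n})},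
           solutions = (\<lambda>G. Pow (pverts G)),
           objective = CVC_value,
           enc_inst = enc_graph,
           enc_sol = enc_vset \<rparr>"

end

(*
  Let d = ceiling (alpha / (alpha - 1)), so that d / (d - 1) <= alpha. In a connected vertex cover
  of size at most k, all vertices of degree above k are forced. If a vertex v has c >= d neighbours,
  all of them forced, contract these neighbours to a single vertex and decrease k by c - 1. The
  optimum drops by c - 1, and a solution is lifted by adding v and all its neighbours, at a cost of
  at most c. Since c / (c - 1) <= alpha, the ratio of the lifted solution is at most the maximum of
  alpha and the ratio of the given solution, and this property is preserved under iteration.
  Moreover, a vertex with more than k further twins (vertices with the same neighbourhood) can be
  deleted.

  If neither rule applies and there is a solution of size at most k, then there are at most k
  vertices of degree above k, at most k (k + 1) other vertices with a neighbour of degree at most k,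
  and the remaining ones fall into at most k^(d-1) + 1 classes of at most k + 1 twins.

  The running time is analysed by closure properties of the functions computable in polynomial time.
  For the exponent to be independent of alpha, d is a part of the input of a fixed program.
*)

theory Submission
  imports Defs
begin

section \<open>Functions computable in polynomial time\<close>

text \<open>A guarantee with the product of \<open>\<alpha>\<close> and the reduced ratio would lose
  a factor \<open>\<alpha>\<close> at every rule. The maximum of both does not deteriorate:
  composing two such bounds gives the same bound, whatever the number of steps. Instances without a
  cover of size at most \<open>k\<close> do no harm: the objective is capped at
  \<open>k + 1\<close>, so there every connected vertex cover is optimal, and the drop of the
  optimum has to be shown against small covers only. If such an instance is recognized, it is
  replaced by the graph without vertices. The twin rule is free of loss: a cover that avoids a
  neighbour of the deleted vertex contains all the other twins, hence more than \<open>k\<close>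
  vertices. Polynomial time is not closed under iteration, so every loop needs a polynomial bound on
  its intermediate values; for the main loop this is an invariant on labels and list lengths. The
  unary parameter may be longer than the graph, so it is first capped at the number of vertices. The
  real number \<open>\<alpha>\<close> enters a program only through the literal for
  \<open>d\<close>, whose cost goes into the factor depending on \<open>\<alpha>\<close>.\<close>

class enc =
  fixes enc :: "'a \<Rightarrow> dtree"

instantiation unit :: enc
begin
definition enc_unit :: "unit \<Rightarrow> dtree" where "enc_unit u = Leaf"
instance ..
end

instantiation bool :: enc
begin
definition enc_bool_inst [simp]: "enc b = enc_bool b"
instance ..
end

instantiation nat :: enc
begin
definition enc_nat_inst [simp]: "enc n = enc_nat n"
instance ..
end

instantiation prod :: (enc, enc) enc
begin
definition enc_prod :: "'a \<times> 'b \<Rightarrow> dtree" where "enc_prod p = Node (enc (fst p)) (enc (snd p))"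
instance ..
end

instantiation list :: (enc) enc
begin
definition enc_list_inst: "enc xs = enc_list (map enc xs)"
instance ..
end

abbreviation esize :: "'a::enc \<Rightarrow> nat" where
  "esize x \<equiv> dsize (enc x)"

lemma enc_Nil [simp]: "enc [] = Leaf"
  and enc_Cons [simp]: "enc (x # xs) = Node (enc x) (enc xs)"
  by (simp_all add: enc_list_inst)

lemma enc_Pair [simp]: "enc (x, y) = Node (enc x) (enc y)"
  by (simp add: enc_prod_def)

text \<open>A number is the same tree as a list of that many units. Unary arithmetic is thereby
  inherited from list operations.\<close>

lemma enc_units: "enc (replicate n ()) = enc_nat n"
  by (simp add: enc_list_inst enc_nat_def enc_unit_def)

lemma dsize_pos [simp]: "0 < dsize x" "Suc 0 \<le> dsize x"
  by (induction x) auto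

lemma esize_list: "esize xs = Suc (\<Sum>x\<leftarrow>xs. Suc (esize x))"
  by (induction xs) auto

lemma dsize_enc_nat [simp]: "dsize (enc_nat n) = 2 * n + 1"
  by (induction n) (auto simp: enc_nat_def)

lemma dsize_enc_bool: "dsize (enc_bool b) \<le> 3"
  by (simp add: enc_bool_def)

lemma esize_append: "esize (xs @ ys) + 1 = esize xs + esize ys"
  by (induction xs) auto

lemma length_le_esize: "2 * length xs < esize xs"
proof (induction xs)
  case (Cons x xs)
  then show ?case using dsize_pos(1)[of "enc x"] by (auto simp del: dsize_pos)
qed simp

lemma esize_mem_le: "x \<in> set xs \<Longrightarrow> esize x \<le> esize xs"
  by (induction xs) auto

lemma esize_list_le:
  assumes "length xs \<le> n" "\<And>x. x \<in> set xs \<Longrightarrow> esize x \<le> m"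
  shows "esize xs \<le> n * (m + 1) + 1"
proof -
  have "(\<Sum>x\<leftarrow>xs. Suc (esize x)) \<le> (\<Sum>x\<leftarrow>xs. m + 1)"
    using assms(2) by (intro sum_list_mono) auto
  also have "\<dots> \<le> n * (m + 1)"
    using assms(1) by (simp add: sum_list_triv del: mult_Suc_right)
  finally show ?thesis by (simp add: esize_list)
qed

section \<open>Relocating and linking programs\<close>

primrec shift :: "nat \<Rightarrow> expr \<Rightarrow> expr" where
  "shift m Arg = Arg"
| "shift m LeafE = LeafE"
| "shift m (NodeE a b) = NodeE (shift m a) (shift m b)"
| "shift m (HdE a) = HdE (shift m a)"
| "shift m (TlE a) = TlE (shift m a)"
| "shift m (IfE c a b) = IfE (shift m c) (shift m a) (shift m b)"
| "shift m (Call i a) = Call (m + i) (shift m a)"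

text \<open>Only \<open>Call\<close> refers to the program, and the shifted index finds the
  relocated body of the same function. So programs can be placed side by side without any
  overhead.\<close>

lemma eval_shift:
  assumes "eval P x e v t"
  shows "eval (Q @ map (shift (length Q)) P @ R) x (shift (length Q) e) v t"
  using assms
proof induction
  case (eval_Call x a u s i v t)
  then show ?case
    using eval.eval_Call[where P = "Q @ map (shift (length Q)) P @ R" and i = "length Q + i"]
    by (simp add: nth_append)
qed (simp_all only: shift.simps, (blast intro: eval.intros)+)

text \<open>Time alone does not bound the size of the result: because of sharing, the result can be
  exponentially larger than the running time. Compositions therefore need the size as well.\<close>

definition implements :: "program \<Rightarrow> nat \<Rightarrow> ('a::enc \<Rightarrow> 'b::enc) \<Rightarrow> ('a \<Rightarrow> nat) \<Rightarrow> bool" where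
  "implements P i f T \<longleftrightarrow> i < length P \<and>
     (\<forall>x. \<exists>t. eval P (enc x) (P ! i) (enc (f x)) t \<and> t + esize (f x) \<le> T x)"

lemma implements_link:
  assumes "implements P i f T"
  shows "implements (Q @ map (shift (length Q)) P @ R) (length Q + i) f T"
  unfolding implements_def
proof (intro conjI allI)
  fix x
  obtain t where "eval P (enc x) (P ! i) (enc (f x)) t" "t + esize (f x) \<le> T x" "i < length P"
    using assms unfolding implements_def by blast
  then show "\<exists>t. eval (Q @ map (shift (length Q)) P @ R) (enc x)
      ((Q @ map (shift (length Q)) P @ R) ! (length Q + i)) (enc (f x)) t \<and> t + esize (f x) \<le> T x"
    using eval_shift by (intro exI[of _ t]) (simp add: nth_append)
qed (use assms in \<open>simp add: implements_def\<close>)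

lemma implements_Call:
  assumes "implements P i f T" "eval P y a (enc x) s"
  obtains t where "eval P y (Call i a) (enc (f x)) (s + t + 1)" "t + esize (f x) \<le> T x"
  using assms unfolding implements_def by (meson eval.eval_Call)

text \<open>The base is at least two, so that powers absorb constants.\<close>

definition pbound :: "(nat \<Rightarrow> nat) \<Rightarrow> bool" where
  "pbound F \<longleftrightarrow> (\<exists>c. \<forall>n. F n \<le> (n + 2) ^ c)"

named_theorems pbound_intros

lemma pbound_id [pbound_intros]: "pbound (\<lambda>n. n)"
  unfolding pbound_def by (rule exI[of _ 1]) simp

lemma pbound_const [pbound_intros]: "pbound (\<lambda>n. c)"
  unfolding pbound_def
proof (intro exI allI)
  fix n :: nat
  have "c \<le> 2 ^ c" by (simp add: less_imp_le)
  also have "\<dots> \<le> (n + 2) ^ c" by (rule power_mono) auto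
  finally show "c \<le> (n + 2) ^ c" .
qed

lemma pbound_mult [pbound_intros]:
  assumes "pbound F" "pbound G" shows "pbound (\<lambda>n. F n * G n)"
proof -
  obtain a b where "\<forall>n. F n \<le> (n + 2) ^ a" "\<forall>n. G n \<le> (n + 2) ^ b"
    using assms unfolding pbound_def by blast
  then show ?thesis
    unfolding pbound_def by (intro exI[of _ "a + b"]) (auto simp: power_add intro: mult_mono)
qed

lemma pbound_add [pbound_intros]:
  assumes "pbound F" "pbound G" shows "pbound (\<lambda>n. F n + G n)"
proof -
  obtain a b where ab: "\<forall>n. F n \<le> (n + 2) ^ a" "\<forall>n. G n \<le> (n + 2) ^ b"
    using assms unfolding pbound_def by blast
  have "F n + G n \<le> (n + 2) ^ (a + b + 1)" for n
  proof -
    have "F n \<le> (n + 2) ^ (a + b)" "G n \<le> (n + 2) ^ (a + b)"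
      using ab by (meson order.trans power_increasing le_add1 le_add2 add_leD2 one_le_numeral trans_le_add2)+
    then have "F n + G n \<le> 2 * (n + 2) ^ (a + b)" by linarith
    also have "\<dots> \<le> (n + 2) * (n + 2) ^ (a + b)" by (rule mult_right_mono) auto
    finally show ?thesis by simp
  qed
  then show ?thesis unfolding pbound_def by blast
qed

lemma pbound_Suc [pbound_intros]: "pbound F \<Longrightarrow> pbound (\<lambda>n. Suc (F n))"
  using pbound_add[OF _ pbound_const[of 1]] by simp

lemma pbound_power [pbound_intros]: "pbound F \<Longrightarrow> pbound (\<lambda>n. F n ^ c)"
  by (induction c) (auto intro: pbound_intros)

section \<open>Polynomial time and its closure under basic combinators\<close>

definition polyt :: "('a::enc \<Rightarrow> 'b::enc) \<Rightarrow> bool" where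
  "polyt f \<longleftrightarrow> (\<exists>P c. implements P 0 f (\<lambda>x. (esize x + 2) ^ c))"

lemma polytE:
  assumes "polyt f"
  obtains P c where "implements P 0 f (\<lambda>x. (esize x + 2) ^ c)"
  using assms unfolding polyt_def by blast

lemma polytI:
  assumes "implements P 0 f T" "pbound F" "\<And>x. T x \<le> F (esize x)"
  shows "polyt f"
proof -
  obtain c where c: "\<And>n. F n \<le> (n + 2) ^ c" using assms(2) unfolding pbound_def by blast
  have "T x \<le> (esize x + 2) ^ c" for x
    using assms(3)[of x] c[of "esize x"] by linarith
  with assms(1) have "implements P 0 f (\<lambda>x. (esize x + 2) ^ c)"
    unfolding implements_def by (meson order.trans)
  then show ?thesis unfolding polyt_def by blast
qed

lemma polyt_size:
  assumes "polyt f"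
  obtains F where "pbound F" "mono F" "\<And>x. esize (f x) \<le> F (esize x)"
proof -
  obtain P c where "implements P 0 f (\<lambda>x. (esize x + 2) ^ c)" using assms by (rule polytE)
  then have "esize (f x) \<le> (esize x + 2) ^ c" for x
    unfolding implements_def by (meson add_leD2)
  moreover have "pbound (\<lambda>n. (n + 2) ^ c)" by (intro pbound_intros)
  moreover have "mono (\<lambda>n. (n + 2) ^ c :: nat)" by (intro monoI power_mono) auto
  ultimately show ?thesis using that by blast
qed

named_theorems polyt_intros

text \<open>Only the trees matter, not the types: Cons is pairing, the conditional is a case
  distinction on lists, addition is an append of unit lists.\<close>

lemma polyt_enc_cong: "polyt g \<Longrightarrow> (\<And>x. enc (f x) = enc (g x)) \<Longrightarrow> polyt f"
  unfolding polyt_def implements_def by simp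

lemma polyt_id [polyt_intros]: "polyt (\<lambda>x. x)"
proof (rule polytI)
  show "implements [Arg] 0 (\<lambda>x::'a. x) (\<lambda>x. 1 + esize x)"
    unfolding implements_def by (auto intro: eval.intros)
  show "pbound (\<lambda>n. 1 + n)" by (intro pbound_intros)
qed auto

primrec lit :: "dtree \<Rightarrow> expr" where
  "lit Leaf = LeafE"
| "lit (Node l r) = NodeE (lit l) (lit r)"

lemma eval_lit: "eval P x (lit d) d (dsize d)"
  by (induction d) (simp_all only: lit.simps dsize.simps eval.intros)

lemma polyt_const [polyt_intros]: "polyt (\<lambda>x. c)"
proof (rule polytI)
  show "implements [lit (enc c)] 0 (\<lambda>x::'a. c) (\<lambda>x. esize c + esize c)"
    unfolding implements_def by (auto intro: eval_lit)
  show "pbound (\<lambda>n. esize c + esize c)" by (intro pbound_intros)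
qed auto

text \<open>The pattern of the combinators: a small main program \<open>M\<close> at index 0,
  followed by relocated copies of the given programs. The first copy starts at index 1, the next one
  at \<open>1 + length P\<close>.\<close>

lemma polyt_comp:
  assumes "polyt f" "polyt g"
  shows "polyt (\<lambda>x. f (g x))"
proof -
  obtain P c where P: "implements P 0 f (\<lambda>x. (esize x + 2) ^ c)" using assms(1) by (rule polytE)
  obtain Q d where Q: "implements Q 0 g (\<lambda>x. (esize x + 2) ^ d)" using assms(2) by (rule polytE)
  define M where "M = [Call 1 (Call (1 + length P) Arg)]"
  define R where "R = M @ map (shift 1) P @ map (shift (1 + length P)) Q"
  have RP: "implements R 1 f (\<lambda>x. (esize x + 2) ^ c)"
    using implements_link[OF P, of M "map (shift (1 + length P)) Q"] by (simp add: R_def M_def)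
  have RQ: "implements R (1 + length P) g (\<lambda>x. (esize x + 2) ^ d)"
    using implements_link[OF Q, of "M @ map (shift 1) P" "[]"] by (simp add: R_def M_def)
  have "\<exists>t. eval R (enc x) (R ! 0) (enc (f (g x))) t \<and>
      t + esize (f (g x)) \<le> ((esize x + 2) ^ d + 2) ^ c + (esize x + 2) ^ d + 3" for x
  proof -
    obtain s where s: "eval R (enc x) (Call (1 + length P) Arg) (enc (g x)) (1 + s + 1)"
        "s + esize (g x) \<le> (esize x + 2) ^ d"
      using implements_Call[OF RQ eval_Arg] by blast
    obtain t where t: "eval R (enc x) (Call 1 (Call (1 + length P) Arg)) (enc (f (g x))) (1 + s + 1 + t + 1)"
        "t + esize (f (g x)) \<le> (esize (g x) + 2) ^ c"
      using implements_Call[OF RP s(1)] by blast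
    have "(esize (g x) + 2) ^ c \<le> ((esize x + 2) ^ d + 2) ^ c"
      using s(2) by (intro power_mono) auto
    with s(2) t show ?thesis
      by (intro exI[of _ "1 + s + 1 + t + 1"]) (auto simp: R_def M_def)
  qed
  then have "implements R 0 (\<lambda>x. f (g x)) (\<lambda>x. ((esize x + 2) ^ d + 2) ^ c + (esize x + 2) ^ d + 3)"
    unfolding implements_def by (auto simp: R_def M_def)
  moreover have "pbound (\<lambda>n. ((n + 2) ^ d + 2) ^ c + (n + 2) ^ d + 3)"
    by (intro pbound_intros)
  ultimately show ?thesis by (rule polytI) auto
qed

lemma polyt_Pair [polyt_intros]:
  assumes "polyt f" "polyt g"
  shows "polyt (\<lambda>x. (f x, g x))"
proof -
  obtain P c where P: "implements P 0 f (\<lambda>x. (esize x + 2) ^ c)" using assms(1) by (rule polytE)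
  obtain Q d where Q: "implements Q 0 g (\<lambda>x. (esize x + 2) ^ d)" using assms(2) by (rule polytE)
  define M where "M = [NodeE (Call 1 Arg) (Call (1 + length P) Arg)]"
  define R where "R = M @ map (shift 1) P @ map (shift (1 + length P)) Q"
  have RP: "implements R 1 f (\<lambda>x. (esize x + 2) ^ c)"
    using implements_link[OF P, of M "map (shift (1 + length P)) Q"] by (simp add: R_def M_def)
  have RQ: "implements R (1 + length P) g (\<lambda>x. (esize x + 2) ^ d)"
    using implements_link[OF Q, of "M @ map (shift 1) P" "[]"] by (simp add: R_def M_def)
  have "\<exists>t. eval R (enc x) (R ! 0) (enc (f x, g x)) t \<and>
      t + esize (f x, g x) \<le> (esize x + 2) ^ c + (esize x + 2) ^ d + 6" for x
  proof -
    obtain s where s: "eval R (enc x) (Call 1 Arg) (enc (f x)) (1 + s + 1)"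
        "s + esize (f x) \<le> (esize x + 2) ^ c"
      using implements_Call[OF RP eval_Arg] by blast
    obtain t where t: "eval R (enc x) (Call (1 + length P) Arg) (enc (g x)) (1 + t + 1)"
        "t + esize (g x) \<le> (esize x + 2) ^ d"
      using implements_Call[OF RQ eval_Arg] by blast
    show ?thesis
      using eval_NodeE[OF s(1) t(1)] s(2) t(2)
      by (intro exI[of _ "(1 + s + 1) + (1 + t + 1) + 1"]) (auto simp: R_def M_def)
  qed
  then have "implements R 0 (\<lambda>x. (f x, g x)) (\<lambda>x. (esize x + 2) ^ c + (esize x + 2) ^ d + 6)"
    unfolding implements_def by (auto simp: R_def M_def)
  moreover have "pbound (\<lambda>n. (n + 2) ^ c + (n + 2) ^ d + 6)"
    by (intro pbound_intros)
  ultimately show ?thesis by (rule polytI) auto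
qed

lemma polyt_fst [polyt_intros]: "polyt f \<Longrightarrow> polyt (\<lambda>x. fst (f x))"
proof (rule polyt_comp[of fst])
  show "polyt (fst :: 'b \<times> 'c \<Rightarrow> 'b)"
  proof (rule polytI)
    have "\<exists>t. eval [HdE Arg] (enc p) (HdE Arg) (enc (fst p)) t \<and> t + esize (fst p) \<le> 2 + esize p"
      for p :: "'b \<times> 'c"
      using eval_HdE[OF eval_Arg, of _ "enc p"] by (cases p) fastforce
    then show "implements [HdE Arg] 0 (fst :: 'b \<times> 'c \<Rightarrow> 'b) (\<lambda>p. 2 + esize p)"
      unfolding implements_def by simp
    show "pbound (\<lambda>n. 2 + n)" by (intro pbound_intros)
  qed auto
qed

lemma polyt_snd [polyt_intros]: "polyt f \<Longrightarrow> polyt (\<lambda>x. snd (f x))"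
proof (rule polyt_comp[of snd])
  show "polyt (snd :: 'b \<times> 'c \<Rightarrow> 'c)"
  proof (rule polytI)
    have "\<exists>t. eval [TlE Arg] (enc p) (TlE Arg) (enc (snd p)) t \<and> t + esize (snd p) \<le> 2 + esize p"
      for p :: "'b \<times> 'c"
      using eval_TlE[OF eval_Arg, of _ "enc p"] by (cases p) fastforce
    then show "implements [TlE Arg] 0 (snd :: 'b \<times> 'c \<Rightarrow> 'c) (\<lambda>p. 2 + esize p)"
      unfolding implements_def by simp
    show "pbound (\<lambda>n. 2 + n)" by (intro pbound_intros)
  qed auto
qed

text \<open>Curried functions have no encoding, so their arguments travel as a tuple. Projections of
  that tuple are a form that \<open>polyt_intros\<close> can decompose.\<close>

lemma polyt_comp2:
  assumes "polyt (\<lambda>p. f (fst p) (snd p))" "polyt g" "polyt h"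
  shows "polyt (\<lambda>x. f (g x) (h x))"
  using polyt_comp[OF assms(1) polyt_Pair[OF assms(2,3)]] by simp

lemma polyt_comp3:
  assumes "polyt (\<lambda>p. f (fst p) (fst (snd p)) (snd (snd p)))" "polyt a" "polyt b" "polyt c"
  shows "polyt (\<lambda>x. f (a x) (b x) (c x))"
  using polyt_comp[OF assms(1) polyt_Pair[OF assms(2) polyt_Pair[OF assms(3,4)]]] by simp

lemma polyt_Cons [polyt_intros]: "polyt f \<Longrightarrow> polyt g \<Longrightarrow> polyt (\<lambda>x. f x # g x)"
  by (rule polyt_enc_cong[OF polyt_Pair[of f g]]) auto

lemma polyt_case_list [polyt_intros]:
  assumes L: "polyt L" and f: "polyt f"
    and g: "polyt (\<lambda>p. g (fst p) (fst (snd p)) (snd (snd p)))"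
  shows "polyt (\<lambda>x. case L x of [] \<Rightarrow> f x | a # l \<Rightarrow> g x a l)"
proof -
  define g' where "g' = (\<lambda>p. g (fst p) (fst (snd p)) (snd (snd p)))"
  obtain A a where A: "implements A 0 L (\<lambda>x. (esize x + 2) ^ a)" using L by (rule polytE)
  obtain B b where B: "implements B 0 f (\<lambda>x. (esize x + 2) ^ b)" using f by (rule polytE)
  obtain C c where C: "implements C 0 g' (\<lambda>x. (esize x + 2) ^ c)"
    using g unfolding g'_def by (rule polytE)
  define i where "i = Suc (length A)"
  define j where "j = i + length B"
  \<comment> \<open>There is no local binding, so \<open>L\<close> is evaluated twice: for the test,
    and to hand head and tail to the branch. Hence the factor 2 in the time bound.\<close>
  define M where "M = [IfE (Call 1 Arg) (Call j (NodeE Arg (Call 1 Arg))) (Call i Arg)]"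
  define R where "R = M @ map (shift 1) A @ map (shift i) B @ map (shift j) C"
  have RA: "implements R 1 L (\<lambda>x. (esize x + 2) ^ a)"
    using implements_link[OF A, of M "map (shift i) B @ map (shift j) C"] by (simp add: R_def M_def)
  have RB: "implements R i f (\<lambda>x. (esize x + 2) ^ b)"
    using implements_link[OF B, of "M @ map (shift 1) A" "map (shift j) C"]
    by (simp add: R_def M_def i_def)
  have RC: "implements R j g' (\<lambda>x. (esize x + 2) ^ c)"
    using implements_link[OF C, of "M @ map (shift 1) A @ map (shift i) B" "[]"]
    by (simp add: R_def M_def i_def j_def)
  have R0: "R ! 0 = IfE (Call 1 Arg) (Call j (NodeE Arg (Call 1 Arg))) (Call i Arg)"
    by (simp add: R_def M_def)
  have "\<exists>t. eval R (enc x) (R ! 0) (enc (case L x of [] \<Rightarrow> f x | a # l \<Rightarrow> g x a l)) t \<and>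
      t + esize (case L x of [] \<Rightarrow> f x | a # l \<Rightarrow> g x a l) \<le> 
      2 * (esize x + 2) ^ a + (esize x + 2) ^ b + (esize x + (esize x + 2) ^ a + 3) ^ c + 10" for x
  proof -
    obtain s where s: "eval R (enc x) (Call 1 Arg) (enc (L x)) (1 + s + 1)"
        "s + esize (L x) \<le> (esize x + 2) ^ a"
      using implements_Call[OF RA eval_Arg] by blast
    show ?thesis
    proof (cases "L x")
      case Nil
      obtain t where t: "eval R (enc x) (Call i Arg) (enc (f x)) (1 + t + 1)"
          "t + esize (f x) \<le> (esize x + 2) ^ b"
        using implements_Call[OF RB eval_Arg] by blast
      have "eval R (enc x) (R ! 0) (enc (f x)) ((1 + s + 1) + (1 + t + 1) + 1)"
        unfolding R0 using s t Nil by (intro eval_IfE_false) auto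
      then show ?thesis
        using s(2) t(2) Nil by (intro exI[of _ "(1 + s + 1) + (1 + t + 1) + 1"]) auto
    next
      case (Cons y ys)
      \<comment> \<open>A nonempty list has the tree of the pair of its head and tail, so the value
        of \<open>L\<close> is passed on as it is.\<close>
      have *: "eval R (enc x) (NodeE Arg (Call 1 Arg)) (enc (x, y, ys)) (1 + (1 + s + 1) + 1)"
        using s(1) Cons eval_NodeE[OF eval_Arg s(1)] by simp
      obtain t where t: "eval R (enc x) (Call j (NodeE Arg (Call 1 Arg))) (enc (g' (x, y, ys)))
            ((1 + (1 + s + 1) + 1) + t + 1)"
          "t + esize (g' (x, y, ys)) \<le> (esize (x, y, ys) + 2) ^ c"
        using implements_Call[OF RC *] by blast
      have ev: "eval R (enc x) (R ! 0) (enc (g x y ys)) ((1 + s + 1) + ((1 + (1 + s + 1) + 1) + t + 1) + 1)"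
        unfolding R0 using s(1) t(1) Cons by (intro eval_IfE_true) (auto simp: g'_def)
      have "(esize (x, y, ys) + 2) ^ c \<le> (esize x + (esize x + 2) ^ a + 3) ^ c"
        using s(2) Cons by (intro power_mono) auto
      then show ?thesis
        using s(2) t(2) Cons
        by (intro exI[of _ "(1 + s + 1) + ((1 + (1 + s + 1) + 1) + t + 1) + 1"] conjI)
           (use ev in \<open>auto simp: g'_def\<close>)
    qed
  qed
  then have "implements R 0 (\<lambda>x. case L x of [] \<Rightarrow> f x | a # l \<Rightarrow> g x a l)
    (\<lambda>x. 2 * (esize x + 2) ^ a + (esize x + 2) ^ b + (esize x + (esize x + 2) ^ a + 3) ^ c + 10)"
    unfolding implements_def by (simp add: R_def M_def)
  moreover have "pbound (\<lambda>n. 2 * (n + 2) ^ a + (n + 2) ^ b + (n + (n + 2) ^ a + 3) ^ c + 10)"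
    by (intro pbound_intros)
  ultimately show ?thesis by (rule polytI) auto
qed

text \<open>All loops on the level of \<open>polyt\<close> reduce to this one. \<open>q\<close>
  bounds every intermediate accumulator in terms of the input; a polynomial bound on the growth in a
  single step would not do, since iterating it can become exponential.\<close>

lemma polyt_foldl:
  fixes h :: "'a::enc \<Rightarrow> 'b::enc \<Rightarrow> 'c::enc \<Rightarrow> 'b"
  assumes Z: "polyt Z" and L: "polyt L"
    and h: "polyt (\<lambda>p. h (fst p) (fst (snd p)) (snd (snd p)))"
    and q: "pbound q" "\<And>x ys zs. L x = ys @ zs \<Longrightarrow> esize (foldl (h x) (Z x) ys) \<le> q (esize x)"
  shows "polyt (\<lambda>x. foldl (h x) (Z x) (L x))"
proof -
  define h' where "h' = (\<lambda>p. h (fst p) (fst (snd p)) (snd (snd p)))"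
  obtain A a where A: "implements A 0 Z (\<lambda>x. (esize x + 2) ^ a)" using Z by (rule polytE)
  obtain B b where B: "implements B 0 L (\<lambda>x. (esize x + 2) ^ b)" using L by (rule polytE)
  obtain C c where C: "implements C 0 h' (\<lambda>x. (esize x + 2) ^ c)"
    using h unfolding h'_def by (rule polytE)
  define j where "j = 2 + length A"
  define k where "k = j + length B"
  define start where "start = Call 1 (NodeE Arg (NodeE (Call 2 Arg) (Call j Arg)))"
  \<comment> \<open>The argument is the tree of \<open>(x, acc, zs)\<close>, with \<open>zs\<close>
    the unread part of the list: \<open>TlE (TlE Arg)\<close> is \<open>zs\<close>, and
    \<open>HdE (TlE Arg)\<close> is \<open>acc\<close>.\<close>
  define loop where "loop = IfE (TlE (TlE Arg))
    (Call 1 (NodeE (HdE Arg)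
       (NodeE (Call k (NodeE (HdE Arg) (NodeE (HdE (TlE Arg)) (HdE (TlE (TlE Arg))))))
         (TlE (TlE (TlE Arg))))))
    (HdE (TlE Arg))"
  define M where "M = [start, loop]"
  define R where "R = M @ map (shift 2) A @ map (shift j) B @ map (shift k) C"
  have RA: "implements R 2 Z (\<lambda>x. (esize x + 2) ^ a)"
    using implements_link[OF A, of M "map (shift j) B @ map (shift k) C"]
    by (simp add: R_def M_def numeral_2_eq_2)
  have RB: "implements R j L (\<lambda>x. (esize x + 2) ^ b)"
    using implements_link[OF B, of "M @ map (shift 2) A" "map (shift k) C"]
    by (simp add: R_def M_def j_def)
  have RC: "implements R k h' (\<lambda>x. (esize x + 2) ^ c)"
    using implements_link[OF C, of "M @ map (shift 2) A @ map (shift j) B" "[]"]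
    by (simp add: R_def M_def j_def k_def)
  have R01: "R ! 0 = start" "R ! 1 = loop" "1 < length R" "0 < length R"
    by (simp_all add: R_def M_def)
  \<comment> \<open>Bounds one call of \<open>h'\<close>: the three summands are for
    \<open>x\<close>, \<open>acc\<close> and \<open>z\<close>; the 4 consists of two nodes of the
    triple and the 2 in the base of the power.\<close>
  define S where "S = (\<lambda>n. (n + q n + (n + 2) ^ b + 4) ^ c)"
  have run: "\<exists>t. eval R (enc (x, foldl (h x) (Z x) ys, zs)) loop (enc (foldl (h x) (Z x) (L x))) t \<and>
      t \<le> length zs * (S (esize x) + 40) + 40" if "L x = ys @ zs" for x ys zs
    using that
  proof (induction zs arbitrary: ys)
    case Nil
    let ?y = "enc (x, foldl (h x) (Z x) ys, [] :: 'c list)"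
    have "eval R ?y (TlE (TlE Arg)) Leaf 3"
      using eval_TlE[OF eval_TlE[OF eval_Arg[of R ?y]]] by (simp add: eval_nat_numeral)
    moreover have "eval R ?y (HdE (TlE Arg)) (enc (foldl (h x) (Z x) ys)) 3"
      using eval_HdE[OF eval_TlE[OF eval_Arg[of R ?y]]] by (simp add: eval_nat_numeral)
    ultimately have "eval R ?y loop (enc (foldl (h x) (Z x) ys)) (3 + 3 + 1)"
      unfolding loop_def by (rule eval_IfE_false)
    with Nil show ?case by (intro exI[of _ "3 + 3 + 1"]) auto
  next
    case (Cons z zs)
    define acc where "acc = foldl (h x) (Z x) ys"
    let ?y = "enc (x, acc, z # zs)"
    have e1: "eval R ?y (TlE (TlE Arg)) (Node (enc z) (enc zs)) 3"
      using eval_TlE[OF eval_TlE[OF eval_Arg[of R ?y]]] by (simp add: eval_nat_numeral)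
    have e2: "eval R ?y (HdE Arg) (enc x) 2"
      using eval_HdE[OF eval_Arg[of R ?y]] by (simp add: eval_nat_numeral)
    have e3: "eval R ?y (HdE (TlE Arg)) (enc acc) 3"
      using eval_HdE[OF eval_TlE[OF eval_Arg[of R ?y]]] by (simp add: eval_nat_numeral)
    have e4: "eval R ?y (HdE (TlE (TlE Arg))) (enc z) 4"
      using eval_HdE[OF e1] by (simp add: eval_nat_numeral)
    have e5: "eval R ?y (TlE (TlE (TlE Arg))) (enc zs) 4"
      using eval_TlE[OF e1] by (simp add: eval_nat_numeral)
    have e6: "eval R ?y (NodeE (HdE Arg) (NodeE (HdE (TlE Arg)) (HdE (TlE (TlE Arg))))) (enc (x, acc, z)) 11"
      using eval_NodeE[OF e2 eval_NodeE[OF e3 e4]] by (simp add: eval_nat_numeral)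
    obtain t where t: "eval R ?y (Call k (NodeE (HdE Arg) (NodeE (HdE (TlE Arg)) (HdE (TlE (TlE Arg))))))
        (enc (h' (x, acc, z))) (11 + t + 1)" "t + esize (h' (x, acc, z)) \<le> (esize (x, acc, z) + 2) ^ c"
      using implements_Call[OF RC e6] by blast
    have acc': "h' (x, acc, z) = foldl (h x) (Z x) (ys @ [z])"
      by (simp add: h'_def acc_def)
    have e7: "eval R ?y (NodeE (HdE Arg)
       (NodeE (Call k (NodeE (HdE Arg) (NodeE (HdE (TlE Arg)) (HdE (TlE (TlE Arg))))))
         (TlE (TlE (TlE Arg))))) (enc (x, foldl (h x) (Z x) (ys @ [z]), zs)) (t + 20)"
      using eval_NodeE[OF e2 eval_NodeE[OF t(1) e5]] unfolding acc' by (simp add: eval_nat_numeral algebra_simps)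
    obtain u where u: "eval R (enc (x, foldl (h x) (Z x) (ys @ [z]), zs)) loop (enc (foldl (h x) (Z x) (L x))) u"
        "u \<le> length zs * (S (esize x) + 40) + 40"
      using Cons.IH[of "ys @ [z]"] Cons.prems by auto
    have e8: "eval R ?y loop (enc (foldl (h x) (Z x) (L x))) (3 + (t + 20 + u + 1) + 1)"
      unfolding loop_def
      using eval_IfE_true[OF e1 _ eval_Call[OF e7 R01(3) u(1)[folded R01(2)]]] by (simp add: R01 eval_nat_numeral)
    obtain s where "s + esize (L x) \<le> (esize x + 2) ^ b" using RB unfolding implements_def by blast
    moreover have "esize z \<le> esize (L x)"
      using Cons.prems by (intro esize_mem_le) auto
    moreover have "esize acc \<le> q (esize x)"
      unfolding acc_def using q(2)[of x ys] Cons.prems by auto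
    ultimately have "(esize (x, acc, z) + 2) ^ c \<le> S (esize x)"
      unfolding S_def by (intro power_mono) auto
    with t(2) have "t \<le> S (esize x)" by linarith
    then show ?case
      using e8 u(2) unfolding acc_def
      by (intro exI[of _ "3 + (t + 20 + u + 1) + 1"]) (auto simp: algebra_simps)
  qed
  define T where "T = (\<lambda>n. (n + 2) ^ b * (S n + 40) + 40 + (n + 2) ^ a + (n + 2) ^ b + q n + 20)"
  have "\<exists>t. eval R (enc x) (R ! 0) (enc (foldl (h x) (Z x) (L x))) t \<and>
      t + esize (foldl (h x) (Z x) (L x)) \<le> T (esize x)" for x
  proof -
    obtain s where s: "eval R (enc x) (Call 2 Arg) (enc (Z x)) (1 + s + 1)"
        "s + esize (Z x) \<le> (esize x + 2) ^ a"
      using implements_Call[OF RA eval_Arg] by blast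
    obtain r where r: "eval R (enc x) (Call j Arg) (enc (L x)) (1 + r + 1)"
        "r + esize (L x) \<le> (esize x + 2) ^ b"
      using implements_Call[OF RB eval_Arg] by blast
    have e: "eval R (enc x) (NodeE Arg (NodeE (Call 2 Arg) (Call j Arg))) (enc (x, Z x, L x)) (s + r + 7)"
      using eval_NodeE[OF eval_Arg eval_NodeE[OF s(1) r(1)]] by (simp add: eval_nat_numeral algebra_simps)
    obtain u where u: "eval R (enc (x, Z x, L x)) (R ! 1) (enc (foldl (h x) (Z x) (L x))) u"
        "u \<le> length (L x) * (S (esize x) + 40) + 40"
      using run[of x "[]" "L x"] unfolding R01(2) by auto
    have ev: "eval R (enc x) (R ! 0) (enc (foldl (h x) (Z x) (L x))) (s + r + 7 + u + 1)"
      unfolding R01 start_def using eval_Call[OF e R01(3) u(1)] by simp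
    have "length (L x) \<le> (esize x + 2) ^ b"
      using r(2) length_le_esize[of "L x"] by linarith
    then have "length (L x) * (S (esize x) + 40) \<le> (esize x + 2) ^ b * (S (esize x) + 40)"
      by (rule mult_right_mono) simp
    moreover have "esize (foldl (h x) (Z x) (L x)) \<le> q (esize x)"
      using q(2)[of x "L x" "[]"] by simp
    ultimately show ?thesis
      using ev u(2) s(2) r(2) unfolding T_def
      by (intro exI[of _ "s + r + 7 + u + 1"]) linarith
  qed
  then have "implements R 0 (\<lambda>x. foldl (h x) (Z x) (L x)) (\<lambda>x. T (esize x))"
    unfolding implements_def using R01(4) by blast
  moreover have "pbound T"
    unfolding T_def S_def by (intro pbound_intros q(1))
  ultimately show ?thesis by (rule polytI) auto
qed

text \<open>\<open>True\<close> has the tree of the list \<open>[()]\<close>, and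
  \<open>False\<close> that of \<open>[]\<close>.\<close>

lemma polyt_If [polyt_intros]:
  fixes f :: "'a::enc \<Rightarrow> 'b::enc"
  assumes "polyt b" "polyt f" "polyt g"
  shows "polyt (\<lambda>x. if b x then f x else g x)"
proof -
  have L: "polyt (\<lambda>x. if b x then [()] else [])"
    by (rule polyt_enc_cong[OF assms(1)]) (simp add: enc_bool_def enc_unit_def)
  have f: "polyt (\<lambda>p::'a \<times> unit \<times> unit list. f (fst p))"
    by (intro polyt_comp[OF assms(2)] polyt_intros)
  show ?thesis
    by (rule polyt_enc_cong[OF polyt_case_list[OF L assms(3) f]]) auto
qed

lemma polyt_conj [polyt_intros]: "polyt f \<Longrightarrow> polyt g \<Longrightarrow> polyt (\<lambda>x. f x \<and> g x)"
  by (rule polyt_enc_cong[OF polyt_If[of f g "\<lambda>x. False"]]) (auto intro: polyt_intros)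

lemma polyt_disj [polyt_intros]: "polyt f \<Longrightarrow> polyt g \<Longrightarrow> polyt (\<lambda>x. f x \<or> g x)"
  by (rule polyt_enc_cong[OF polyt_If[of f "\<lambda>x. True" g]]) (auto intro: polyt_intros)

lemma polyt_not [polyt_intros]: "polyt f \<Longrightarrow> polyt (\<lambda>x. \<not> f x)"
  by (rule polyt_enc_cong[OF polyt_If[of f "\<lambda>x. False" "\<lambda>x. True"]]) (auto intro: polyt_intros)

lemma polyt_iff [polyt_intros]: "polyt f \<Longrightarrow> polyt g \<Longrightarrow> polyt (\<lambda>x. f x \<longleftrightarrow> g x)"
  by (rule polyt_enc_cong[OF polyt_If[of f g "\<lambda>x. \<not> g x"]]) (auto intro: polyt_intros)

section \<open>Operations on lists\<close>

lemma esize_le_append: "esize ys \<le> esize (ys @ zs)"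
  by (induction ys) auto

lemma polyt_fold_size:
  assumes "polyt L" "polyt Z"
  obtains F where "pbound F" "\<And>x. esize (L x) \<le> F (esize x)" "\<And>x. esize (Z x) \<le> F (esize x)"
proof -
  obtain F where F: "pbound F" "\<And>x. esize (L x) \<le> F (esize x)" using polyt_size[OF assms(1)] by metis
  obtain G where G: "pbound G" "\<And>x. esize (Z x) \<le> G (esize x)" using polyt_size[OF assms(2)] by metis
  show ?thesis
    using F(2) G(2) by (intro that[of "\<lambda>n. F n + G n"] pbound_add F(1) G(1)) (auto intro: trans_le_add1 trans_le_add2)
qed

lemma foldl_Cons_rev: "foldl (\<lambda>acc a. a # acc) ys xs = rev xs @ ys"
  by (induction xs arbitrary: ys) auto

lemma esize_rev [simp]: "esize (rev xs) = esize xs"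
  by (simp add: esize_list rev_map[symmetric] sum_list_rev)

lemma polyt_rev_append: "polyt L \<Longrightarrow> polyt Z \<Longrightarrow> polyt (\<lambda>x. rev (L x) @ Z x)"
proof -
  assume L: "polyt L" and Z: "polyt Z"
  obtain F where F: "pbound F" "\<And>x. esize (L x) \<le> F (esize x)" "\<And>x. esize (Z x) \<le> F (esize x)"
    using polyt_fold_size[OF L Z] by blast
  have "polyt (\<lambda>x. foldl (\<lambda>acc a. a # acc) (Z x) (L x))"
  proof (rule polyt_foldl[OF Z L])
    show "polyt (\<lambda>p::'a \<times> 'b list \<times> 'b. snd (snd p) # fst (snd p))" by (intro polyt_intros)
    show "pbound (\<lambda>n. F n + F n)" by (intro pbound_intros F)
    fix x ys zs assume "L x = ys @ zs"
    then have "esize ys \<le> F (esize x)" using F(2)[of x] esize_le_append[of ys zs] by simp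
    then show "esize (foldl (\<lambda>acc a. a # acc) (Z x) ys) \<le> F (esize x) + F (esize x)"
      using F(3)[of x] esize_append[of "rev ys" "Z x"] by (simp add: foldl_Cons_rev)
  qed
  then show ?thesis by (simp add: foldl_Cons_rev)
qed

lemma polyt_rev [polyt_intros]: "polyt L \<Longrightarrow> polyt (\<lambda>x. rev (L x))"
  using polyt_rev_append[of L "\<lambda>x. []"] by (auto intro: polyt_intros)

lemma polyt_append [polyt_intros]: "polyt L \<Longrightarrow> polyt Z \<Longrightarrow> polyt (\<lambda>x. L x @ Z x)"
  using polyt_rev_append[of "\<lambda>x. rev (L x)" Z] by (auto intro: polyt_intros)

text \<open>The fold builds the reversed result. Its accumulator stays small because each entry is
  computed from \<open>x\<close> and one list element, independently of the other entries.\<close>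

lemma polyt_map [polyt_intros]:
  assumes f: "polyt (\<lambda>p. f (fst p) (snd p))" and L: "polyt L"
  shows "polyt (\<lambda>x. map (f x) (L x))"
proof -
  have fold: "foldl (\<lambda>acc a. f x a # acc) ys xs = rev (map (f x) xs) @ ys" for x xs ys
    by (induction xs arbitrary: ys) auto
  obtain F where F: "pbound F" "\<And>x. esize (L x) \<le> F (esize x)" using polyt_size[OF L] by metis
  obtain G where G: "pbound G" "mono G" "\<And>p. esize (f (fst p) (snd p)) \<le> G (esize p)"
    using polyt_size[OF f] by metis
  obtain c where c: "\<And>n. G n \<le> (n + 2) ^ c" using G(1) unfolding pbound_def by blast
  have "polyt (\<lambda>x. foldl (\<lambda>acc a. f x a # acc) [] (L x))"
  proof (rule polyt_foldl[OF _ L])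
    have "polyt (\<lambda>p::'a \<times> 'c list \<times> 'b. f (fst p) (snd (snd p)))"
      by (rule polyt_comp2[OF f]) (intro polyt_intros)+
    then show "polyt (\<lambda>p::'a \<times> 'c list \<times> 'b. f (fst p) (snd (snd p)) # fst (snd p))"
      by (intro polyt_intros)
    show "pbound (\<lambda>n. F n * ((n + F n + 3) ^ c + 1) + 1)" by (intro pbound_intros F)
    fix x ys zs assume L: "L x = ys @ zs"
    have le: "esize ys \<le> F (esize x)" using F(2)[of x] esize_le_append[of ys zs] L by simp
    have "esize (map (f x) ys) \<le> F (esize x) * ((esize x + F (esize x) + 3) ^ c + 1) + 1"
    proof (rule esize_list_le)
      show "length (map (f x) ys) \<le> F (esize x)" using le length_le_esize[of ys] by simp
      fix y assume "y \<in> set (map (f x) ys)"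
      then obtain a where a: "a \<in> set ys" "y = f x a" by auto
      have "esize y \<le> (esize (x, a) + 2) ^ c"
        using G(3)[of "(x, a)"] c[of "esize (x, a)"] a(2) by simp
      also have "\<dots> \<le> (esize x + F (esize x) + 3) ^ c"
        using esize_mem_le[OF a(1)] le by (intro power_mono) auto
      finally show "esize y \<le> (esize x + F (esize x) + 3) ^ c" .
    qed
    then show "esize (foldl (\<lambda>acc a. f x a # acc) [] ys)
        \<le> F (esize x) * ((esize x + F (esize x) + 3) ^ c + 1) + 1"
      by (simp add: fold)
  qed (intro polyt_intros)
  from polyt_rev[OF this] show ?thesis by (simp add: fold)
qed

lemma polyt_filter [polyt_intros]:
  assumes f: "polyt (\<lambda>p. f (fst p) (snd p))" and L: "polyt L"
  shows "polyt (\<lambda>x. filter (f x) (L x))"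
proof -
  have fold: "foldl (\<lambda>acc a. if f x a then a # acc else acc) ys xs = rev (filter (f x) xs) @ ys" for x xs ys
    by (induction xs arbitrary: ys) auto
  have size: "esize (filter p xs) \<le> esize xs" for p and xs :: "'b list"
    by (induction xs) auto
  obtain F where F: "pbound F" "\<And>x. esize (L x) \<le> F (esize x)" using polyt_size[OF L] by metis
  have "polyt (\<lambda>x. foldl (\<lambda>acc a. if f x a then a # acc else acc) [] (L x))"
  proof (rule polyt_foldl[OF _ L _ F(1)])
    have "polyt (\<lambda>p::'a \<times> 'b list \<times> 'b. f (fst p) (snd (snd p)))"
      by (rule polyt_comp2[OF f]) (intro polyt_intros)+
    then show "polyt (\<lambda>p::'a \<times> 'b list \<times> 'b. if f (fst p) (snd (snd p)) then snd (snd p) # fst (snd p) else fst (snd p))"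
      by (intro polyt_intros)
    fix x ys zs assume L: "L x = ys @ zs"
    then show "esize (foldl (\<lambda>acc a. if f x a then a # acc else acc) [] ys) \<le> F (esize x)"
      using F(2)[of x] esize_le_append[of ys zs] size[of "f x" ys] by (simp add: fold)
  qed (intro polyt_intros)
  from polyt_rev[OF this] show ?thesis by (simp add: fold)
qed

lemma polyt_list_ex [polyt_intros]:
  assumes f: "polyt (\<lambda>p. f (fst p) (snd p))" and L: "polyt L"
  shows "polyt (\<lambda>x. list_ex (f x) (L x))"
  by (rule polyt_enc_cong[OF polyt_case_list[OF polyt_filter[OF f L], of "\<lambda>x. False" "\<lambda>x a l. True"]])
     (auto intro: polyt_intros split: list.splits simp: list_ex_iff filter_empty_conv filter_eq_Cons_iff)

lemma polyt_list_all [polyt_intros]: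
  assumes f: "polyt (\<lambda>p. f (fst p) (snd p))" and L: "polyt L"
  shows "polyt (\<lambda>x. list_all (f x) (L x))"
  by (rule polyt_enc_cong[OF polyt_not[OF polyt_list_ex[OF polyt_not[OF f] L]]])
     (simp add: list_all_iff list_ex_iff)

section \<open>Arithmetic on unary numbers\<close>

lemma polyt_length [polyt_intros]: "polyt L \<Longrightarrow> polyt (\<lambda>x. length (L x))"
proof (rule polyt_enc_cong)
  show "polyt (\<lambda>x. map (\<lambda>_. ()) (L x))" if "polyt L" by (intro polyt_intros that)
qed (simp add: map_replicate_const enc_units)

lemma polyt_units: "polyt N \<Longrightarrow> polyt (\<lambda>x. replicate (N x) ())"
  by (erule polyt_enc_cong) (simp add: enc_units)

lemma polyt_Suc [polyt_intros]: "polyt N \<Longrightarrow> polyt (\<lambda>x. Suc (N x))"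
  by (rule polyt_enc_cong[OF polyt_Cons[OF polyt_const[of "()"] polyt_units]])
     (simp_all flip: enc_units)

lemma polyt_add [polyt_intros]: "polyt M \<Longrightarrow> polyt N \<Longrightarrow> polyt (\<lambda>x. M x + (N x :: nat))"
  by (rule polyt_enc_cong[OF polyt_append[OF polyt_units[of M] polyt_units[of N]]])
     (simp_all flip: enc_units add: replicate_add)

lemma polyt_concat [polyt_intros]:
  assumes L: "polyt L"
  shows "polyt (\<lambda>x. concat (L x))"
proof -
  have fold: "foldl (@) ys xs = ys @ concat xs" for ys :: "'b list" and xs
    by (induction xs arbitrary: ys) auto
  have size: "esize (concat xs) \<le> esize xs" for xs :: "'b list list"
  proof (induction xs)
    case (Cons y ys)
    then show ?case using esize_append[of y "concat ys"] by simp
  qed simp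
  obtain F where F: "pbound F" "\<And>x. esize (L x) \<le> F (esize x)" using polyt_size[OF L] by metis
  have "polyt (\<lambda>x. foldl (@) [] (L x))"
  proof (rule polyt_foldl[OF _ L _ F(1)])
    fix x ys zs assume L: "L x = ys @ zs"
    then show "esize (foldl (@) [] ys) \<le> F (esize x)"
      using F(2)[of x] esize_le_append[of ys zs] size[of ys] by (simp add: fold)
  qed (intro polyt_intros)+
  then show ?thesis by (simp add: fold)
qed

lemma polyt_mult [polyt_intros]: "polyt M \<Longrightarrow> polyt N \<Longrightarrow> polyt (\<lambda>x. M x * (N x :: nat))"
proof (rule polyt_enc_cong)
  assume M: "polyt M" and N: "polyt N"
  have "polyt (\<lambda>p::'a \<times> unit. replicate (N (fst p)) ())"
    by (intro polyt_units polyt_comp[OF N] polyt_intros)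
  then show "polyt (\<lambda>x. length (concat (map (\<lambda>_. replicate (N x) ()) (replicate (M x) ()))))"
    by (intro polyt_intros polyt_units M polyt_comp[OF N])
next
  fix x
  show "enc (M x * N x) = enc (length (concat (map (\<lambda>_. replicate (N x) ()) (replicate (M x) ()))))"
    by (simp add: length_concat sum_list_replicate)
qed

lemma polyt_power [polyt_intros]: "polyt N \<Longrightarrow> polyt (\<lambda>x. N x ^ c :: nat)"
  by (induction c) (auto intro: polyt_intros)

lemma polyt_tl [polyt_intros]:
  assumes "polyt L" shows "polyt (\<lambda>x. tl (L x))"
proof -
  have "polyt (\<lambda>x. case L x of [] \<Rightarrow> [] | a # l \<Rightarrow> l)" by (intro polyt_intros assms)
  then show ?thesis by (rule polyt_enc_cong) (simp split: list.splits)
qed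

lemma polyt_funpow:
  fixes h :: "'a::enc \<Rightarrow> 'b::enc \<Rightarrow> 'b"
  assumes h: "polyt (\<lambda>p. h (fst p) (snd p))" and N: "polyt N" and Z: "polyt Z"
    and q: "pbound q" "\<And>x i. i \<le> N x \<Longrightarrow> esize ((h x ^^ i) (Z x)) \<le> q (esize x)"
  shows "polyt (\<lambda>x. (h x ^^ N x) (Z x))"
proof -
  have fold: "foldl (\<lambda>acc _. h x acc) z (us :: unit list) = (h x ^^ length us) z" for x z us
    by (induction us arbitrary: z) (simp_all add: funpow_swap1)
  have "polyt (\<lambda>x. foldl (\<lambda>acc _. h x acc) (Z x) (replicate (N x) ()))"
  proof (rule polyt_foldl[OF Z polyt_units[OF N] _ q(1)])
    show "polyt (\<lambda>p::'a \<times> 'b \<times> unit. h (fst p) (fst (snd p)))"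
      by (rule polyt_comp2[OF h]) (intro polyt_intros)+
    fix x and ys zs :: "unit list" assume "replicate (N x) () = ys @ zs"
    then have "length ys \<le> N x" by (metis length_append length_replicate le_add1)
    then show "esize (foldl (\<lambda>acc _. h x acc) (Z x) ys) \<le> q (esize x)"
      using q(2)[of "length ys" x] by (simp add: fold)
  qed
  then show ?thesis by (simp add: fold)
qed

lemma polyt_drop [polyt_intros]: "polyt N \<Longrightarrow> polyt L \<Longrightarrow> polyt (\<lambda>x. drop (N x) (L x))"
proof -
  assume N: "polyt N" and L: "polyt L"
  have drop: "(tl ^^ n) xs = drop n xs" for n and xs :: "'b list"
    by (induction n arbitrary: xs) (simp_all add: drop_Suc tl_drop)
  have size: "esize (drop n xs) \<le> esize xs" for n and xs :: "'b list"
  proof (induction n arbitrary: xs)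
    case (Suc n)
    show ?case using Suc.IH[of "tl xs"] by (cases xs) auto
  qed simp
  obtain F where F: "pbound F" "\<And>x. esize (L x) \<le> F (esize x)" using polyt_size[OF L] by metis
  have "polyt (\<lambda>x. (tl ^^ N x) (L x))"
  proof (rule polyt_funpow[OF _ N L F(1)])
    show "polyt (\<lambda>p::'a \<times> 'b list. tl (snd p))" by (intro polyt_intros)
    show "esize ((tl ^^ i) (L x)) \<le> F (esize x)" for x i
      using size[of i "L x"] F(2)[of x] by (simp add: drop)
  qed
  then show ?thesis by (simp add: drop)
qed

text \<open>Dropping \<open>N\<close> units from a list of \<open>M\<close> units also gives the
  truncation at 0.\<close>

lemma polyt_diff [polyt_intros]: "polyt M \<Longrightarrow> polyt N \<Longrightarrow> polyt (\<lambda>x. M x - (N x :: nat))"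
  by (rule polyt_enc_cong[OF polyt_drop[OF _ polyt_units[of M]]])
     (simp_all flip: enc_units)

lemma polyt_le [polyt_intros]: "polyt M \<Longrightarrow> polyt N \<Longrightarrow> polyt (\<lambda>x. M x \<le> (N x :: nat))"
proof (rule polyt_enc_cong)
  assume M: "polyt M" and N: "polyt N"
  have "polyt (\<lambda>x. replicate (M x - N x) ())" by (intro polyt_units polyt_intros M N)
  then show "polyt (\<lambda>x. case replicate (M x - N x) () of [] \<Rightarrow> True | a # l \<Rightarrow> False)"
    by (intro polyt_intros)
next
  show "enc (M x \<le> N x) = enc (case replicate (M x - N x) () of [] \<Rightarrow> True | a # l \<Rightarrow> False)" for x
    by (cases "M x - N x"; cases "M x \<le> N x") auto
qed

lemma polyt_less [polyt_intros]: "polyt M \<Longrightarrow> polyt N \<Longrightarrow> polyt (\<lambda>x. M x < (N x :: nat))"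
  by (rule polyt_enc_cong[OF polyt_le[OF polyt_Suc]]) (auto simp: Suc_le_eq)

lemma polyt_eq_nat [polyt_intros]: "polyt M \<Longrightarrow> polyt N \<Longrightarrow> polyt (\<lambda>x. M x = (N x :: nat))"
  by (rule polyt_enc_cong[OF polyt_conj[OF polyt_le[of M N] polyt_le[of N M]]]) (auto intro: arg_cong[of _ _ enc_bool])

text \<open>A total lookup: \<open>implements\<close> speaks about all inputs, whereas
  \<open>nth\<close> is unspecified beyond the end of the list.\<close>

definition nth_or :: "'a \<Rightarrow> 'a list \<Rightarrow> nat \<Rightarrow> 'a" where
  "nth_or d xs i = (case drop i xs of [] \<Rightarrow> d | x # _ \<Rightarrow> x)"

lemma nth_or_eq: "nth_or d xs i = (if i < length xs then xs ! i else d)"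
  by (auto simp: nth_or_def split: list.splits) (metis hd_drop_conv_nth list.sel(1))

lemma polyt_nth_or [polyt_intros]:
  "polyt D \<Longrightarrow> polyt L \<Longrightarrow> polyt N \<Longrightarrow> polyt (\<lambda>x. nth_or (D x) (L x) (N x))"
  unfolding nth_or_def by (intro polyt_intros)

lemma polyt_upt [polyt_intros]: "polyt N \<Longrightarrow> polyt (\<lambda>x. [0..<N x])"
proof -
  assume N: "polyt N"
  \<comment> \<open>The head of the accumulator serves as the counter; the empty list makes counting
    start with 0.\<close>
  define h where "h = (\<lambda>acc :: nat list. (case acc of [] \<Rightarrow> 0 | y # _ \<Rightarrow> Suc y) # acc)"
  have h: "(h ^^ n) [] = rev [0..<n]" for n
  proof (induction n)
    case (Suc n)
    then have "(h ^^ Suc n) [] = h (rev [0..<n])" by simp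
    also have "\<dots> = rev [0..<Suc n]" by (cases n) (auto simp: h_def)
    finally show ?case .
  qed simp
  obtain F where F: "pbound F" "\<And>x. esize (N x) \<le> F (esize x)" using polyt_size[OF N] by metis
  have "polyt (\<lambda>x. (h ^^ N x) [])"
  proof (rule polyt_funpow[OF _ N])
    show "polyt (\<lambda>p::'a \<times> nat list. h (snd p))" unfolding h_def by (intro polyt_intros)
    show "pbound (\<lambda>n. F n * (F n + 1) + 1)" by (intro pbound_intros F)
    fix x i assume "i \<le> N x"
    then have "2 * i + 1 \<le> F (esize x)" using F(2)[of x] by simp
    then have "esize [0..<i] \<le> F (esize x) * (F (esize x) + 1) + 1" by (intro esize_list_le) auto
    then show "esize ((h ^^ i) []) \<le> F (esize x) * (F (esize x) + 1) + 1" by (simp add: h)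
  qed (intro polyt_intros)
  from polyt_rev[OF this] show ?thesis by (simp add: h)
qed

section \<open>Connected vertex covers\<close>

definition conn :: "'a rel \<Rightarrow> 'a set \<Rightarrow> bool" where
  "conn E S \<longleftrightarrow> S \<noteq> {} \<and> (\<forall>x\<in>S. \<forall>y\<in>S. (x, y) \<in> rtrancl_on S E)"

lemma pair_graph_iff:
  "pair_graph G \<longleftrightarrow>
     finite (pverts G) \<and> parcs G \<subseteq> pverts G \<times> pverts G \<and> sym (parcs G) \<and> irrefl (parcs G)"
proof
  assume "pair_graph G"
  then interpret pair_graph G .
  show "finite (pverts G) \<and> parcs G \<subseteq> pverts G \<times> pverts G \<and> sym (parcs G) \<and> irrefl (parcs G)"
    using pair_sym_arcs pair_finite_verts
    by (auto simp: symmetric_def irrefl_def dest: in_arcsD1 in_arcsD2 pair_no_loops)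
next
  assume *: "finite (pverts G) \<and> parcs G \<subseteq> pverts G \<times> pverts G \<and> sym (parcs G) \<and> irrefl (parcs G)"
  then have "finite (parcs G)" by (meson finite_SigmaI finite_subset)
  with * show "pair_graph G"
    by unfold_locales (auto simp: symmetric_def irrefl_def)
qed

lemma rtrancl_on_restrict: "rtrancl_on S (E \<inter> S \<times> S) = rtrancl_on S E"
proof (intro equalityI subsetI; clarify)
  fix x y
  show "(x, y) \<in> rtrancl_on S E" if "(x, y) \<in> rtrancl_on S (E \<inter> S \<times> S)"
    using that by (induction rule: rtrancl_on_induct) (auto intro: rtrancl_on_into_rtrancl_on)
  show "(x, y) \<in> rtrancl_on S (E \<inter> S \<times> S)" if "(x, y) \<in> rtrancl_on S E"
    using that by (induction rule: rtrancl_on_induct) (auto intro: rtrancl_on_into_rtrancl_on)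
qed

text \<open>Walks inside \<open>S\<close> see only arcs within \<open>S\<close>, and since arcs come
  in opposite pairs, the symmetric closure in the library's notion changes nothing. What remains is
  a condition on the bare arc relation.\<close>

lemma cvc_iff:
  assumes "pair_graph G"
  shows "connected_vertex_cover G S \<longleftrightarrow>
    S \<subseteq> pverts G \<and> (\<forall>u v. (u, v) \<in> parcs G \<longrightarrow> u \<in> S \<or> v \<in> S) \<and> conn (parcs G) S"
proof -
  have ends: "arcs_ends (with_proj G \<restriction> S) = parcs G \<inter> S \<times> S"
    by (auto simp: arcs_ends_conv induce_subgraph_def with_proj_def)
  have "sym (parcs G \<inter> S \<times> S)"
    using assms by (auto simp: pair_graph_iff sym_def)
  then have "(parcs G \<inter> S \<times> S)\<^sup>s = parcs G \<inter> S \<times> S"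
    by (auto simp: symcl_def sym_def)
  then have "connected (with_proj G \<restriction> S) \<longleftrightarrow> conn (parcs G) S"
    unfolding connected_conv conn_def ends by (simp add: rtrancl_on_restrict)
  then show ?thesis
    by (auto simp: connected_vertex_cover_def vertex_cover_def)
qed

lemma conn_rootI:
  assumes "sym E" "r \<in> S" "\<And>x. x \<in> S \<Longrightarrow> (x, r) \<in> rtrancl_on S E"
  shows "conn E S"
proof -
  have "(r, x) \<in> rtrancl_on S E" if "x \<in> S" for x
    using rtrancl_on_sym[OF assms(1)] assms(3)[OF that] by (auto elim: symE)
  with assms show ?thesis
    unfolding conn_def by (meson empty_iff rtrancl_on_trans)
qed

text \<open>Walks are mapped step by step, and a step may collapse. Used for contraction, for
  exchanging a vertex with its twin, and for renaming.\<close>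

lemma conn_image:
  assumes "conn E S" "\<And>x y. x \<in> S \<Longrightarrow> y \<in> S \<Longrightarrow> (x, y) \<in> E \<Longrightarrow> f x = f y \<or> (f x, f y) \<in> E'"
  shows "conn E' (f ` S)"
proof -
  have "(f x, f y) \<in> rtrancl_on (f ` S) E'" if "(x, y) \<in> rtrancl_on S E" for x y
    using that
  proof (induction rule: rtrancl_on_induct)
    case (step y z)
    with assms(2)[of y z] show ?case
      by (metis imageI rtrancl_on_into_rtrancl_on)
  qed auto
  with assms(1) show ?thesis unfolding conn_def by blast
qed

lemma conn_extend:
  assumes "sym E" "conn E S" "S \<subseteq> S'" "\<And>x. x \<in> S' - S \<Longrightarrow> \<exists>y\<in>S. (x, y) \<in> E"
  shows "conn E S'"
proof -
  obtain r where r: "r \<in> S" using assms(2) unfolding conn_def by blast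
  have S: "(x, r) \<in> rtrancl_on S' E" if "x \<in> S" for x
    using assms(2,3) r that unfolding conn_def by (meson rtrancl_on_mono subset_refl subsetD)
  show ?thesis
  proof (rule conn_rootI[OF assms(1)])
    show "r \<in> S'" using r assms(3) by blast
    fix x assume x: "x \<in> S'"
    show "(x, r) \<in> rtrancl_on S' E"
    proof (cases "x \<in> S")
      case False
      with assms(4) x obtain y where "y \<in> S" "(x, y) \<in> E" by blast
      with S[of y] x show ?thesis by (meson converse_rtrancl_on_into_rtrancl_on)
    qed (rule S)
  qed
qed

lemma conn_cong:
  assumes "E \<inter> S \<times> S = E' \<inter> S \<times> S" shows "conn E S \<longleftrightarrow> conn E' S"
  unfolding conn_def by (metis assms rtrancl_on_restrict)

text \<open>A walk from \<open>v\<close> inside \<open>S\<close> is stuck at once. Applied to a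
  pendant vertex without its neighbour and to an isolated vertex.\<close>

lemma conn_no_leaving:
  assumes "conn E S" "v \<in> S" "\<And>y. (v, y) \<in> E \<Longrightarrow> y \<notin> S"
  shows "S = {v}"
proof -
  have "y = v" if "y \<in> S" for y
  proof -
    have "(v, y) \<in> rtrancl_on S E" using assms(1,2) that unfolding conn_def by blast
    then show ?thesis by (induction rule: rtrancl_on_induct) (use assms(3) in auto)
  qed
  with assms(2) show ?thesis by blast
qed

definition nbs :: "'a pair_pre_digraph \<Rightarrow> 'a \<Rightarrow> 'a set" where
  "nbs G v = {u. (v, u) \<in> parcs G}"

lemma nbs_subset: "pair_graph G \<Longrightarrow> nbs G v \<subseteq> pverts G"
  by (auto simp: nbs_def pair_graph_iff)

lemma finite_nbs: "pair_graph G \<Longrightarrow> finite (nbs G v)"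
  by (meson finite_subset nbs_subset pair_graph_iff)

lemma cvc_finite: "pair_graph G \<Longrightarrow> connected_vertex_cover G S \<Longrightarrow> finite S \<and> S \<noteq> {}"
  by (auto simp: cvc_iff pair_graph_iff conn_def intro: finite_subset)

section \<open>Capped cost, optimum and approximation ratio\<close>

lemma CVC_simps [simp]:
  "solutions CVC G = Pow (pverts G)" "objective CVC = CVC_value"
  "enc_inst CVC = enc_graph" "enc_sol CVC = enc_vset"
  "instances CVC = {G. pair_graph G \<and> (\<exists>n. pverts G = {..<n})}"
  by (simp_all add: CVC_def)

definition cost :: "nat \<Rightarrow> 'a set \<Rightarrow> nat" where
  "cost k S = min (card S) (k + 1)"

text \<open>\<open>OPT\<close> as a natural number. Meaningful only if some connected vertex cover
  exists; otherwise the optimum is \<infinity>.\<close>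

definition opt :: "'a pair_pre_digraph \<Rightarrow> nat \<Rightarrow> nat" where
  "opt G k = (LEAST m. \<exists>S. connected_vertex_cover G S \<and> m = cost k S)"

lemma opt_le: "connected_vertex_cover G S \<Longrightarrow> opt G k \<le> cost k S"
  unfolding opt_def by (rule Least_le) blast

lemma opt_attained:
  assumes "connected_vertex_cover G S"
  obtains S' where "connected_vertex_cover G S'" "opt G k = cost k S'"
  using LeastI_ex[of "\<lambda>m. \<exists>S. connected_vertex_cover G S \<and> m = cost k S"] assms
  unfolding opt_def by blast

text \<open>A connected set is nonempty, and the cap \<open>k + 1\<close> is positive. So no ratio
  divides by zero.\<close>

lemma opt_pos:
  assumes "pair_graph G" "connected_vertex_cover G S" shows "0 < opt G k"
proof -
  obtain S' where "connected_vertex_cover G S'" "opt G k = cost k S'"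
    using opt_attained[OF assms(2)] .
  then show ?thesis using cvc_finite[OF assms(1)] by (simp add: cost_def card_gt_0_iff)
qed

lemma cvc_subset: "connected_vertex_cover G S \<Longrightarrow> S \<subseteq> pverts G"
  by (simp add: connected_vertex_cover_def vertex_cover_def)

lemma OPT_CVC:
  assumes "connected_vertex_cover G S" shows "OPT CVC G k = ereal (real (opt G k))"
proof -
  obtain S' where S': "connected_vertex_cover G S'" "opt G k = cost k S'"
    using opt_attained[OF assms] .
  have "OPT CVC G k \<le> CVC_value G k S'"
    unfolding OPT_def using cvc_subset[OF S'(1)] by (auto intro: INF_lower)
  moreover have "ereal (real (opt G k)) \<le> OPT CVC G k"
    unfolding OPT_def
  proof (rule INF_greatest)
    show "ereal (real (opt G k)) \<le> objective CVC G k S" for S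
      using opt_le[of G S k] by (simp add: CVC_value_def cost_def)
  qed
  ultimately show ?thesis
    using S' by (auto simp: CVC_value_def cost_def intro: antisym)
qed

lemma OPT_CVC_infeasible: "\<nexists>S. connected_vertex_cover G S \<Longrightarrow> OPT CVC G k = \<infinity>"
  by (auto simp: OPT_def CVC_value_def top_ereal_def intro!: INF_eqI)

text \<open>Value and optimum are both infinite, so the first case of \<open>approx_ratio\<close>
  applies.\<close>

lemma ratio_infeasible_instance:
  "\<nexists>S. connected_vertex_cover G S \<Longrightarrow> approx_ratio CVC G k S = 1"
  by (auto simp: approx_ratio_def OPT_CVC_infeasible CVC_value_def)

lemma ratio_feasible:
  assumes "pair_graph G" "connected_vertex_cover G S"
  shows "approx_ratio CVC G k S = ereal (cost k S / opt G k)"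
  using assms opt_pos[OF assms, of k]
  by (auto simp: approx_ratio_def OPT_CVC CVC_value_def cost_def)

lemma ratio_infeasible:
  assumes "pair_graph G" "connected_vertex_cover G S0" "\<not> connected_vertex_cover G S"
  shows "approx_ratio CVC G k S = \<infinity>"
  using assms opt_pos[OF assms(1,2), of k]
  by (simp add: approx_ratio_def OPT_CVC[OF assms(2)] CVC_value_def)

lemma ratio_ge_1:
  assumes "pair_graph G" shows "1 \<le> approx_ratio CVC G k S"
proof (cases "\<exists>S. connected_vertex_cover G S")
  case True
  then obtain S0 where S0: "connected_vertex_cover G S0" by blast
  show ?thesis
  proof (cases "connected_vertex_cover G S")
    case True
    then have "1 \<le> cost k S / opt G k"
      using opt_le[OF True, of k] opt_pos[OF assms True, of k] by simp
    then show ?thesis by (simp add: ratio_feasible[OF assms True] one_ereal_def)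
  qed (simp add: ratio_infeasible[OF assms S0])
qed (simp add: ratio_infeasible_instance)

lemma ratio_optimal:
  assumes "pair_graph G" "connected_vertex_cover G S" "cost k S \<le> opt G k"
  shows "approx_ratio CVC G k S = 1"
  using assms opt_le[OF assms(2), of k] opt_pos[OF assms(1,2), of k]
  by (simp add: ratio_feasible one_ereal_def)

text \<open>This is where strictness comes from: the additive loss \<open>a\<close> of the lifting is paid for by the
  amount \<open>b\<close> by which the reduction decreases the optimum, so that the mediant inequality
  applies. If no cover has at most \<open>k\<close> vertices, then every cover is optimal.\<close>

lemma ratio_step:
  assumes G: "pair_graph G" and G': "pair_graph G'" and \<alpha>: "1 \<le> \<alpha>" "real a \<le> \<alpha> * real b"
    and lift: "connected_vertex_cover G' S' \<Longrightarrow> connected_vertex_cover G S \<and> cost k S \<le> cost k' S' + a"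
    and red: "\<And>T. connected_vertex_cover G T \<Longrightarrow>
      \<exists>T'. connected_vertex_cover G' T' \<and> (card T \<le> k \<longrightarrow> card T' + b \<le> card T)"
  shows "approx_ratio CVC G k S \<le> max (approx_ratio CVC G' k' S') (ereal \<alpha>)"
proof (cases "\<exists>T. connected_vertex_cover G T")
  case False
  moreover have \<alpha>1: "1 \<le> ereal \<alpha>" using \<alpha>(1) by (simp add: one_ereal_def)
  ultimately show ?thesis using \<alpha>1 by (simp add: ratio_infeasible_instance le_max_iff_disj)
next
  case True
  then obtain T where T: "connected_vertex_cover G T" "opt G k = cost k T"
    by (meson opt_attained)
  obtain T' where T': "connected_vertex_cover G' T'" "card T \<le> k \<Longrightarrow> card T' + b \<le> card T"
    using red[OF T(1)] by blast
  have \<alpha>1: "1 \<le> ereal \<alpha>" using \<alpha>(1) by (simp add: one_ereal_def)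
  show ?thesis
  proof (cases "connected_vertex_cover G' S'")
    case False
    then show ?thesis by (simp add: ratio_infeasible[OF G' T'(1)])
  next
    case S': True
    note S = lift[OF S']
    show ?thesis
    proof (cases "card T \<le> k")
      case False
      then have "cost k S \<le> opt G k" unfolding T(2) cost_def by simp
      then show ?thesis
        using ratio_optimal[OF G conjunct1[OF S], of k] \<alpha>1 by (simp add: le_max_iff_disj)
    next
      case True
      have "opt G' k' + b \<le> card T"
        using T'(2)[OF True] opt_le[OF T'(1), of k'] by (simp add: cost_def)
      also have "card T = opt G k" using True T(2) by (simp add: cost_def)
      finally have opt: "real (opt G' k') + real b \<le> real (opt G k)" by linarith
      \<comment> \<open>\<open>r\<close> dominates both parts of the mediant: the ratio in
        \<open>G'\<close>, and also \<open>a\<close> is at most \<open>r * b\<close>.\<close>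
      define r where "r = max (cost k' S' / opt G' k') \<alpha>"
      have pos: "0 < opt G' k'" "0 < opt G k"
        using opt_pos[OF G' S'] opt_pos[OF G conjunct1[OF S]] by blast+
      have "real (cost k' S') \<le> r * opt G' k'"
        using pos(1) by (simp add: r_def field_simps max_def)
      moreover have "real a \<le> r * real b"
        using \<alpha>(2) mult_right_mono[of \<alpha> r "real b"] by (simp add: r_def)
      moreover have "real (cost k S) \<le> real (cost k' S') + real a"
        using conjunct2[OF S] by linarith
      ultimately have "real (cost k S) \<le> r * (opt G' k' + real b)"
        by (simp add: algebra_simps)
      also have "\<dots> \<le> r * opt G k"
        using opt \<alpha>(1) by (intro mult_left_mono) (auto simp: r_def)
      finally have "cost k S / opt G k \<le> r" using pos(2) by (simp add: field_simps)
      then have "ereal (cost k S / opt G k) \<le> ereal r" by simp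
      then show ?thesis
        by (simp add: ratio_feasible[OF G conjunct1[OF S]] ratio_feasible[OF G' S'] r_def max_def split: if_splits)
    qed
  qed
qed

subsection \<open>Contracting the neighbourhood of a vertex\<close>

definition contract :: "'a set \<Rightarrow> 'a \<Rightarrow> 'a \<Rightarrow> 'a" where
  "contract N a x = (if x \<in> N then a else x)"

text \<open>Arcs that become loops are dropped, since a \<open>pair_graph\<close> is irreflexive;
  parallel arcs merge because the arcs form a set.\<close>

definition graph_image :: "('a \<Rightarrow> 'a) \<Rightarrow> 'a pair_pre_digraph \<Rightarrow> 'a pair_pre_digraph" where
  "graph_image f G =
     \<lparr> pverts = f ` pverts G, parcs = {(f x, f y) |x y. (x, y) \<in> parcs G \<and> f x \<noteq> f y} \<rparr>"

lemma pair_graph_image: "pair_graph G \<Longrightarrow> pair_graph (graph_image f G)"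
  unfolding pair_graph_iff
proof (intro conjI; elim conjE)
  show "finite (pverts (graph_image f G))" if "finite (pverts G)"
    using that by (simp add: graph_image_def)
  show "parcs (graph_image f G) \<subseteq> pverts (graph_image f G) \<times> pverts (graph_image f G)"
    if "parcs G \<subseteq> pverts G \<times> pverts G"
    using that by (auto simp: graph_image_def)
  show "sym (parcs (graph_image f G))" if "sym (parcs G)"
  proof (rule symI)
    fix x y assume "(x, y) \<in> parcs (graph_image f G)"
    then obtain u v where "x = f u" "y = f v" "(u, v) \<in> parcs G" "f u \<noteq> f v"
      by (auto simp: graph_image_def)
    moreover from this have "(v, u) \<in> parcs G" "f v \<noteq> f u" using symD[OF that] by auto
    ultimately show "(y, x) \<in> parcs (graph_image f G)" by (simp add: graph_image_def) blast
  qed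
  show "irrefl (parcs (graph_image f G))" by (auto simp: graph_image_def irrefl_def)
qed

lemma cvc_image:
  assumes "pair_graph G" "connected_vertex_cover G S"
  shows "connected_vertex_cover (graph_image f G) (f ` S)"
proof -
  have S: "S \<subseteq> pverts G" "\<And>u v. (u, v) \<in> parcs G \<Longrightarrow> u \<in> S \<or> v \<in> S" "conn (parcs G) S"
    using assms by (auto simp: cvc_iff)
  have "conn (parcs (graph_image f G)) (f ` S)"
    using S(3) by (rule conn_image) (auto simp: graph_image_def)
  with S(1,2) show ?thesis
    unfolding cvc_iff[OF pair_graph_image[OF assms(1)]]
    by (fastforce simp: graph_image_def)
qed

text \<open>A vertex outside a cover has all its neighbours inside, and there are too many of
  them.\<close>

lemma high_degree_in_cover:
  assumes "pair_graph G" "connected_vertex_cover G S" "card S \<le> k" "k < card (nbs G u)"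
  shows "u \<in> S"
proof (rule ccontr)
  assume "u \<notin> S"
  with assms(1,2) have "nbs G u \<subseteq> S" by (auto simp: cvc_iff nbs_def)
  with cvc_finite[OF assms(1,2)] have "card (nbs G u) \<le> card S" by (intro card_mono) auto
  with assms(3,4) show False by simp
qed

text \<open>After the contraction, \<open>v\<close> is a pendant vertex attached to \<open>a\<close>. This forces \<open>a\<close> into every
  connected vertex cover other than \<open>{v}\<close>.\<close>

lemma cvc_lift_contract:
  assumes G: "pair_graph G" and N: "nbs G v = N" and a: "a \<in> N"
    and S': "connected_vertex_cover (graph_image (contract N a) G) S'"
  shows "connected_vertex_cover G (S' \<union> N \<union> {v}) \<and> card (S' \<union> N \<union> {v}) \<le> card S' + card N"
proof -
  let ?f = "contract N a" and ?S = "S' \<union> N \<union> {v}"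
  let ?E = "parcs G" and ?E' = "parcs (graph_image (contract N a) G)"
  have sym: "sym ?E" and irrefl: "irrefl ?E" and sub: "?E \<subseteq> pverts G \<times> pverts G"
    using G by (auto simp: pair_graph_iff)
  have NE: "x \<in> N \<longleftrightarrow> (v, x) \<in> ?E" for x using N by (auto simp: nbs_def)
  have vN: "v \<notin> N" using irrefl NE by (auto simp: irrefl_def)
  have vV: "v \<in> pverts G" "N \<subseteq> pverts G" using a sub NE by auto
  have fin: "finite N" using finite_nbs[OF G, of v] N by simp
  have G': "pair_graph (graph_image ?f G)" by (rule pair_graph_image[OF G])
  have "pverts (graph_image ?f G) \<subseteq> pverts G"
    using a vV(2) by (auto simp: graph_image_def contract_def)
  then have S'V: "S' \<subseteq> pverts G" using cvc_subset[OF S'] by blast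
  have S'cov: "\<And>x y. (x, y) \<in> ?E' \<Longrightarrow> x \<in> S' \<or> y \<in> S'" and S'conn: "conn ?E' S'"
    using S' unfolding cvc_iff[OF G'] by blast+
  have finS': "finite S'" using cvc_finite[OF G' S'] by blast
  have pendant: "y = a" if vy: "(v, y) \<in> ?E'" for y
  proof -
    obtain x0 y0 where *: "(x0, y0) \<in> ?E" "v = ?f x0" "y = ?f y0"
      using vy unfolding graph_image_def by auto
    have "x0 = v" using *(2) a vN by (metis contract_def)
    then have "y0 \<in> N" using *(1) NE by blast
    then show ?thesis using *(3) by (simp add: contract_def)
  qed
  have va: "(v, a) \<in> ?E'"
  proof -
    have "?f v = v" "?f a = a" "v \<noteq> a" "(v, a) \<in> ?E" using a vN NE by (auto simp: contract_def)
    then have "\<exists>x y. v = ?f x \<and> a = ?f y \<and> (x, y) \<in> ?E \<and> ?f x \<noteq> ?f y" by metis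
    then show ?thesis unfolding graph_image_def by simp
  qed
  have cover: "\<forall>x y. (x, y) \<in> ?E \<longrightarrow> x \<in> ?S \<or> y \<in> ?S"
  proof (intro allI impI)
    fix x y assume xy: "(x, y) \<in> ?E"
    show "x \<in> ?S \<or> y \<in> ?S"
    proof (cases "x \<in> N \<or> y \<in> N")
      case False
      then have "?f x = x" "?f y = y" "x \<noteq> y" using xy irrefl by (auto simp: contract_def irrefl_def)
      with xy have "\<exists>u w. x = ?f u \<and> y = ?f w \<and> (u, w) \<in> ?E \<and> ?f u \<noteq> ?f w" by metis
      then have "(x, y) \<in> ?E'" unfolding graph_image_def by simp
      then show ?thesis using S'cov by blast
    qed auto
  qed
  \<comment> \<open>\<open>v\<close> is a hub: the vertices of \<open>N\<close> are connected
    through it without any help from \<open>S'\<close>.\<close>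
  have star: "(x, v) \<in> rtrancl_on ?S ?E" if "x \<in> N \<union> {v}" for x
  proof (cases "x = v")
    case False
    then have "(x, v) \<in> ?E" using that NE sym by (auto elim: symE)
    then show ?thesis using that by (intro converse_rtrancl_on_into_rtrancl_on[of x v]) auto
  qed simp
  have main: "conn ?E ?S \<and> card ?S \<le> card S' + card N"
  proof (cases "a \<in> S'")
    case True
    \<comment> \<open>A walk through \<open>a\<close> need not lift to a walk, because its arcs at
      \<open>a\<close> may stem from different vertices of \<open>N\<close>. The induction therefore
      carries along that the current vertex reaches the hub \<open>v\<close>.\<close>
    have "(x, v) \<in> rtrancl_on ?S ?E" if "(a, x) \<in> rtrancl_on S' ?E'" for x
      using that
    proof (induction rule: rtrancl_on_induct)
      case base
      show ?case using star a by simp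
    next
      case (step y z)
      then obtain y0 z0 where yz: "(y0, z0) \<in> ?E" "y = ?f y0" "z = ?f z0"
        by (auto simp: graph_image_def)
      show ?case
      proof (cases "z \<in> N")
        case False
        then have z0: "z0 = z" using yz a by (auto simp: contract_def split: if_splits)
        have "y0 \<in> ?S \<and> (y0, v) \<in> rtrancl_on ?S ?E"
        proof (cases "y0 \<in> N")
          case False
          then have "y0 = y" using yz by (auto simp: contract_def)
          then show ?thesis using step by simp
        qed (use star in auto)
        moreover have "(z, y0) \<in> ?E" using yz(1) z0 sym by (auto elim: symE)
        ultimately show ?thesis
          using step(4) by (intro converse_rtrancl_on_into_rtrancl_on[of z y0]) auto
      qed (use star in auto)
    qed
    then have "(x, v) \<in> rtrancl_on ?S ?E" if "x \<in> ?S" for x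
      using that star S'conn True unfolding conn_def by blast
    then have "conn ?E ?S" using sym by (intro conn_rootI[of _ v]) auto
    moreover have "card ?S \<le> card S' + card N"
    proof -
      \<comment> \<open>\<open>a\<close> lies in both \<open>S'\<close> and \<open>N\<close>;
        counting it once makes room for \<open>v\<close>.\<close>
      have "?S = insert v ((S' - {a}) \<union> N)" using a by auto
      then have "card ?S \<le> Suc (card ((S' - {a}) \<union> N))" by (simp add: card_insert_le_m1 card_insert_if finS' fin)
      also have "\<dots> \<le> Suc (card (S' - {a}) + card N)" using card_Un_le by auto
      also have "\<dots> = card S' + card N" using card_Suc_Diff1[OF finS' True] by simp
      finally show ?thesis .
    qed
    ultimately show ?thesis by blast
  next
    case False
    \<comment> \<open>The arc between \<open>v\<close> and \<open>a\<close> is covered by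
      \<open>v\<close>, whose only neighbour \<open>a\<close> is missing from
      \<open>S'\<close>.\<close>
    then have "v \<in> S'" using S'cov[OF va] by blast
    then have "S' = {v}"
      using S'conn False pendant by (intro conn_no_leaving[of ?E']) auto
    then have S: "?S = insert v N" by auto
    then have "conn ?E ?S" using sym star by (intro conn_rootI[of _ v]) auto
    moreover have "card ?S \<le> card S' + card N" using S \<open>S' = {v}\<close> vN fin by simp
    ultimately show ?thesis by blast
  qed
  have "?S \<subseteq> pverts G" using S'V vV by blast
  with cover main show ?thesis unfolding cvc_iff[OF G] by blast
qed

lemma ratio_contract:
  assumes G: "pair_graph G" and N: "nbs G v = N" and a: "a \<in> N"
    and high: "\<And>u. u \<in> N \<Longrightarrow> k < card (nbs G u)" and card: "card N \<le> k" "2 \<le> d" "d \<le> card N"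
    and \<alpha>: "1 \<le> \<alpha>" "real d \<le> \<alpha> * (real d - 1)"
  shows "approx_ratio CVC G k (S' \<union> N \<union> {v}) \<le>
    max (approx_ratio CVC (graph_image (contract N a) G) (k - (card N - 1)) S') (ereal \<alpha>)"
proof (rule ratio_step[OF G pair_graph_image[OF G] \<alpha>(1), of "card N" "card N - 1"])
  \<comment> \<open>The quotient \<open>c / (c - 1)\<close> decreases in \<open>c\<close>, so the
    inequality for \<open>d\<close> yields the one for \<open>card N\<close>.\<close>
  have "(\<alpha> - 1) * real d \<le> (\<alpha> - 1) * real (card N)"
    using \<alpha>(1) card(3) by (intro mult_left_mono) auto
  then show "real (card N) \<le> \<alpha> * real (card N - 1)"
    using \<alpha>(2) card(2,3) by (simp add: of_nat_diff algebra_simps)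
next
  assume "connected_vertex_cover (graph_image (contract N a) G) S'"
  \<comment> \<open>By \<open>card N \<le> k\<close> the new parameter is not truncated. Its cap
    plus \<open>card N\<close> is then \<open>k + 2\<close>, which is above the cap
    \<open>k + 1\<close> in \<open>G\<close>.\<close>
  from cvc_lift_contract[OF G N a this] card
  show "connected_vertex_cover G (S' \<union> N \<union> {v}) \<and>
    cost k (S' \<union> N \<union> {v}) \<le> cost (k - (card N - 1)) S' + card N"
    by (auto simp: cost_def)
next
  fix T assume T: "connected_vertex_cover G T"
  have fin: "finite T" "finite N" using cvc_finite[OF G T] finite_nbs[OF G, of v] N by auto
  have "card (contract N a ` T) + (card N - 1) \<le> card T" if "card T \<le> k"
  proof -
    \<comment> \<open>A small cover contains all of \<open>N\<close>, of which only \<open>a\<close>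
      survives in the image: \<open>card N - 1\<close> vertices are saved.\<close>
    have "N \<subseteq> T" using high_degree_in_cover[OF G T that high] by blast
    then have "contract N a ` T \<subseteq> insert a (T - N)" by (auto simp: contract_def)
    then have "card (contract N a ` T) \<le> card (insert a (T - N))" using fin by (intro card_mono) auto
    also have "\<dots> \<le> Suc (card (T - N))" by (simp add: card_insert_le_m1 card_insert_if fin)
    finally show ?thesis
      using card_Diff_subset[OF fin(2) \<open>N \<subseteq> T\<close>] card_mono[OF fin(1) \<open>N \<subseteq> T\<close>] card by linarith
  qed
  then show "\<exists>T'. connected_vertex_cover (graph_image (contract N a) G) T' \<and>
      (card T \<le> k \<longrightarrow> card T' + (card N - 1) \<le> card T)"
    using cvc_image[OF G T, of "contract N a"] by blast
qed

subsection \<open>Deleting a vertex with many twins\<close>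

definition delete :: "'a pair_pre_digraph \<Rightarrow> 'a \<Rightarrow> 'a pair_pre_digraph" where
  "delete G v = \<lparr> pverts = pverts G - {v}, parcs = {(x, y) \<in> parcs G. x \<noteq> v \<and> y \<noteq> v} \<rparr>"

definition twins :: "'a pair_pre_digraph \<Rightarrow> 'a \<Rightarrow> 'a set" where
  "twins G v = {u \<in> pverts G. nbs G u = nbs G v}"

lemma pair_graph_delete: "pair_graph G \<Longrightarrow> pair_graph (delete G v)"
  by (auto simp: pair_graph_iff delete_def sym_def irrefl_def)

text \<open>If \<open>S'\<close> misses a neighbour of \<open>v\<close>, it contains all other twins
  and its cost is already \<open>k + 1\<close>; otherwise adding the neighbours changes nothing.
  Conversely, a cover can use a twin in place of \<open>v\<close>.\<close>

lemma ratio_delete_twin: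
  assumes G: "pair_graph G" and v: "v \<in> pverts G" and many: "k + 1 < card (twins G v)"
    and \<alpha>: "1 \<le> \<alpha>"
  shows "approx_ratio CVC G k (S' \<union> nbs G v) \<le> max (approx_ratio CVC (delete G v) k S') (ereal \<alpha>)"
proof (rule ratio_step[OF G pair_graph_delete[OF G] \<alpha>, of 0 0])
  let ?N = "nbs G v" and ?E = "parcs G" and ?E' = "parcs (delete G v)" and ?S = "S' \<union> nbs G v"
  have sym: "sym ?E" and irrefl: "irrefl ?E" and sub: "?E \<subseteq> pverts G \<times> pverts G"
    using G by (auto simp: pair_graph_iff)
  have fin: "finite (twins G v)" using G by (simp add: pair_graph_iff twins_def)
  \<comment> \<open>\<open>twins G v\<close> includes \<open>v\<close> itself; more than
    \<open>k\<close> others survive the deletion.\<close>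
  have cardT: "k < card (twins G v - {v})"
    using many v by (simp add: twins_def card_Diff_singleton)
  then have "twins G v - {v} \<noteq> {}" by (metis card.empty not_less_zero)
  then obtain t where t: "t \<noteq> v" "t \<in> pverts G" "nbs G t = ?N" unfolding twins_def by auto
  have tE: "(t, x) \<in> ?E \<longleftrightarrow> (v, x) \<in> ?E" "(x, t) \<in> ?E \<longleftrightarrow> (x, v) \<in> ?E" for x
    using t(3) sym by (auto simp: nbs_def elim: symE)
  have N: "x \<in> ?N \<longleftrightarrow> (v, x) \<in> ?E" "x \<in> ?N \<longleftrightarrow> (x, v) \<in> ?E" for x
    using sym by (auto simp: nbs_def elim: symE)
  have vN: "v \<notin> ?N" using irrefl by (auto simp: nbs_def irrefl_def)
  {
    assume S': "connected_vertex_cover (delete G v) S'"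
    have S'V: "S' \<subseteq> pverts G - {v}" and S'cov: "\<And>x y. (x, y) \<in> ?E' \<Longrightarrow> x \<in> S' \<or> y \<in> S'"
      and S'conn: "conn ?E' S'"
      using S' unfolding cvc_iff[OF pair_graph_delete[OF G]] by (auto simp: delete_def)
    have finS': "finite S'" using cvc_finite[OF pair_graph_delete[OF G] S'] by blast
    have conn': "conn ?E S'"
      using S'conn S'V by (subst conn_cong[of _ _ ?E']) (auto simp: delete_def)
    have twinsS': "twins G v - {v} \<subseteq> S'" if "u \<in> ?N - S'" for u
    proof
      fix s assume s: "s \<in> twins G v - {v}"
      then have "(s, u) \<in> ?E" using that by (auto simp: twins_def nbs_def)
      then have "(s, u) \<in> ?E'" using s that vN by (auto simp: delete_def)
      then show "s \<in> S'" using S'cov that by blast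
    qed
    have "conn ?E ?S"
    proof (rule conn_extend[OF sym conn'])
      fix x assume x: "x \<in> ?S - S'"
      \<comment> \<open>A neighbour \<open>x\<close> of \<open>v\<close> outside \<open>S'\<close>
        is adjacent to the twin \<open>t\<close> too, so the cover \<open>S'\<close> contains
        \<open>t\<close>, and \<open>x\<close> is attached there.\<close>
      then have "t \<in> S'" using twinsS'[of x] t by (auto simp: twins_def)
      moreover have "(x, t) \<in> ?E" using x tE N by auto
      ultimately show "\<exists>y\<in>S'. (x, y) \<in> ?E" by blast
    qed auto
    moreover have "x \<in> ?S \<or> y \<in> ?S" if "(x, y) \<in> ?E" for x y
      using that N S'cov[of x y] by (auto simp: delete_def)
    ultimately have "connected_vertex_cover G ?S"
      unfolding cvc_iff[OF G] using S'V nbs_subset[OF G, of v] by blast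
    moreover have "cost k ?S \<le> cost k S'"
    proof (cases "?N \<subseteq> S'")
      case False
      then have "card (twins G v - {v}) \<le> card S'"
        using twinsS' finS' by (intro card_mono) auto
      then show ?thesis using cardT by (simp add: cost_def)
    qed (simp add: Un_absorb2)
    ultimately show "connected_vertex_cover G ?S \<and> cost k ?S \<le> cost k S' + 0" by simp
  }
  fix T assume T: "connected_vertex_cover G T"
  have TV: "T \<subseteq> pverts G" and Tcov: "\<And>x y. (x, y) \<in> ?E \<Longrightarrow> x \<in> T \<or> y \<in> T" and Tconn: "conn ?E T"
    using T unfolding cvc_iff[OF G] by blast+
  define f where "f x = (if x = v then t else x)" for x
  have "conn ?E' (f ` T)"
  proof (rule conn_image[OF Tconn])
    fix x y assume "(x, y) \<in> ?E"
    then show "f x = f y \<or> (f x, f y) \<in> ?E'"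
      using t(1) tE irrefl by (auto simp: f_def delete_def irrefl_def)
  qed
  moreover have "f ` T \<subseteq> pverts G - {v}" using TV t by (auto simp: f_def)
  moreover have "x \<in> f ` T \<or> y \<in> f ` T" if "(x, y) \<in> ?E'" for x y
  proof -
    have "x \<noteq> v" "y \<noteq> v" "x \<in> T \<or> y \<in> T" using that Tcov by (auto simp: delete_def)
    then show ?thesis by (auto simp: f_def image_iff)
  qed
  ultimately have "connected_vertex_cover (delete G v) (f ` T)"
    unfolding cvc_iff[OF pair_graph_delete[OF G]] by (auto simp: delete_def)
  moreover have "card (f ` T) \<le> card T" using cvc_finite[OF G T] by (simp add: card_image_le)
  ultimately show "\<exists>T'. connected_vertex_cover (delete G v) T' \<and> (card T \<le> k \<longrightarrow> card T' + 0 \<le> card T)"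
    by auto
qed simp

subsection \<open>Instances to which no rule applies\<close>

definition high :: "'a pair_pre_digraph \<Rightarrow> nat \<Rightarrow> 'a set" where
  "high G k = {u \<in> pverts G. k < card (nbs G u)}"

definition rest :: "'a pair_pre_digraph \<Rightarrow> nat \<Rightarrow> 'a set" where
  "rest G k = {v \<in> pverts G. v \<notin> high G k \<and> \<not> nbs G v \<subseteq> high G k}"

lemma high_bound:
  assumes "pair_graph G" "connected_vertex_cover G S" "card S \<le> k"
  shows "card (high G k) \<le> k"
proof -
  have "high G k \<subseteq> S"
    using high_degree_in_cover[OF assms] by (auto simp: high_def)
  then have "card (high G k) \<le> card S"
    using cvc_finite[OF assms(1,2)] by (intro card_mono) auto
  with assms(3) show ?thesis by simp
qed

text \<open>A vertex of \<open>rest G k\<close> outside \<open>S\<close> has a neighbour of degree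
  at most \<open>k\<close>, which must lie in \<open>S\<close>. So at most \<open>k * k\<close>
  vertices are added to those of \<open>S\<close>.\<close>

lemma rest_bound:
  assumes "pair_graph G" "connected_vertex_cover G S" "card S \<le> k"
  shows "card (rest G k) \<le> k * (k + 1)"
proof -
  let ?T = "{s \<in> S. s \<notin> high G k}"
  have fin: "finite S" using cvc_finite[OF assms(1,2)] by blast
  have S: "S \<subseteq> pverts G" "\<And>u v. (u, v) \<in> parcs G \<Longrightarrow> u \<in> S \<or> v \<in> S"
    using assms(2) unfolding cvc_iff[OF assms(1)] by blast+
  have sym: "sym (parcs G)" using assms(1) by (simp add: pair_graph_iff)
  have "rest G k \<subseteq> S \<union> (\<Union>s\<in>?T. nbs G s)"
  proof
    fix v assume "v \<in> rest G k"
    then obtain u where "(v, u) \<in> parcs G" "u \<notin> high G k" by (auto simp: rest_def nbs_def)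
    moreover from this have "(u, v) \<in> parcs G" using sym by (blast dest: symD)
    ultimately show "v \<in> S \<union> (\<Union>s\<in>?T. nbs G s)" using S(2)[of v u] by (auto simp: nbs_def)
  qed
  then have "card (rest G k) \<le> card (S \<union> (\<Union>s\<in>?T. nbs G s))"
    using fin finite_nbs[OF assms(1)] by (intro card_mono) auto
  also have "\<dots> \<le> card S + card (\<Union>s\<in>?T. nbs G s)" by (rule card_Un_le)
  also have "card (\<Union>s\<in>?T. nbs G s) \<le> (\<Sum>s\<in>?T. card (nbs G s))"
    using fin by (intro card_UN_le) simp
  also have "(\<Sum>s\<in>?T. card (nbs G s)) \<le> (\<Sum>s\<in>?T. k)"
    using S(1) by (intro sum_mono) (auto simp: high_def not_less)
  also have "(\<Sum>s\<in>?T. k) \<le> card S * k"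
    using card_mono[OF fin, of ?T] by auto
  also have "card S + card S * k \<le> k + k * k"
    using assms(3) by (intro add_mono mult_right_mono) auto
  finally show ?thesis by simp
qed

definition nonisolated :: "'a pair_pre_digraph \<Rightarrow> 'a set" where
  "nonisolated G = {v \<in> pverts G. nbs G v \<noteq> {}}"

text \<open>Lifted from the trivial kernel, which is put out if there is no cover of size at most \<open>k\<close>.\<close>

lemma cvc_nonisolated:
  assumes G: "pair_graph G" and S: "connected_vertex_cover G S" and ne: "parcs G \<noteq> {}"
  shows "connected_vertex_cover G (nonisolated G)"
proof -
  have S: "S \<subseteq> pverts G" "\<And>u v. (u, v) \<in> parcs G \<Longrightarrow> u \<in> S \<or> v \<in> S" "conn (parcs G) S"
    using S unfolding cvc_iff[OF G] by blast+
  have sym: "sym (parcs G)" and sub: "parcs G \<subseteq> pverts G \<times> pverts G"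
    using G by (auto simp: pair_graph_iff)
  have "S \<subseteq> nonisolated G"
  \<comment> \<open>An isolated vertex of \<open>S\<close> would be all of \<open>S\<close> by
    connectivity, and could cover no arc.\<close>
  proof (rule subsetI, rule ccontr)
    fix z assume z: "z \<in> S" "z \<notin> nonisolated G"
    then have iso: "(z, y) \<notin> parcs G" "(y, z) \<notin> parcs G" for y
      using S(1) sym by (auto simp: nonisolated_def nbs_def dest: symD)
    then have "S = {z}" using S(3) z(1) by (intro conn_no_leaving) auto
    with S(2) ne iso show False by fast
  qed
  moreover have "\<exists>y\<in>S. (x, y) \<in> parcs G" if "x \<in> nonisolated G - S" for x
    using that S(2) by (auto simp: nonisolated_def nbs_def)
  ultimately have "conn (parcs G) (nonisolated G)"
    using conn_extend[OF sym S(3)] by blast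
  moreover have "u \<in> nonisolated G" if "(u, v) \<in> parcs G" for u v
    using that sub by (auto simp: nonisolated_def nbs_def)
  ultimately show ?thesis unfolding cvc_iff[OF G] by (auto simp: nonisolated_def)
qed

text \<open>Either excess excludes covers of size at most \<open>k\<close>. Then every connected
  vertex cover has the capped value \<open>k + 1\<close>, so any of them is optimal.\<close>

lemma ratio_nonisolated:
  assumes G: "pair_graph G" and big: "k < card (high G k) \<or> k * (k + 1) < card (rest G k)"
  shows "approx_ratio CVC G k (nonisolated G) = 1"
proof (cases "\<exists>S. connected_vertex_cover G S")
  case True
  then obtain S where S: "connected_vertex_cover G S" "opt G k = cost k S"
    by (meson opt_attained)
  have "\<not> card S \<le> k"
    using high_bound[OF G S(1)] rest_bound[OF G S(1)] big by (meson not_le)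
  then have opt: "opt G k = k + 1" using S(2) by (simp add: cost_def)
  have "high G k \<noteq> {} \<or> rest G k \<noteq> {}"
    using big by (metis card.empty not_less_zero)
  then have "parcs G \<noteq> {}"
    by (auto simp: high_def rest_def nbs_def)
  from cvc_nonisolated[OF G S(1) this] show ?thesis
    by (rule ratio_optimal[OF G]) (simp add: opt cost_def)
qed (simp add: ratio_infeasible_instance)

text \<open>A nonempty set of at most \<open>m\<close> elements is the set of a list of length
  exactly \<open>m\<close>, padded by repeating an element. The empty set has nothing to repeat,
  hence the summand 1.\<close>

lemma card_small_subsets:
  assumes "finite H" shows "card {A. A \<subseteq> H \<and> card A \<le> m} \<le> card H ^ m + 1"
proof -
  let ?L = "{xs. set xs \<subseteq> H \<and> length xs = m}"
  have "A \<in> insert {} (set ` ?L)" if A: "A \<subseteq> H" "card A \<le> m" for A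
  proof (cases "A = {}")
    case False
    have "finite A" using A(1) assms by (rule finite_subset)
    then obtain xs where xs: "set xs = A" "distinct xs" using finite_distinct_list by blast
    let ?ys = "xs @ replicate (m - length xs) (hd xs)"
    have "set ?ys = A" using xs(1) False by (cases xs) auto
    moreover have "length ?ys = m" using A(2) xs distinct_card[of xs] by simp
    ultimately have "?ys \<in> ?L" "set ?ys = A" using A(1) by auto
    then show ?thesis by blast
  qed simp
  then have "{A. A \<subseteq> H \<and> card A \<le> m} \<subseteq> insert {} (set ` ?L)" by blast
  then have "card {A. A \<subseteq> H \<and> card A \<le> m} \<le> card (insert {} (set ` ?L))"
    using assms by (intro card_mono) (auto simp: finite_lists_length_eq)
  also have "\<dots> \<le> card (set ` ?L) + 1"
    using assms by (simp add: card_insert_if finite_lists_length_eq)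
  also have "card (set ` ?L) \<le> card ?L"
    using assms by (intro card_image_le finite_lists_length_eq)
  also have "card ?L = card H ^ m"
    using assms by (rule card_lists_length_eq)
  finally show ?thesis by simp
qed

lemma card_reduced:
  assumes G: "pair_graph G" and high: "card (high G k) \<le> k" and rest: "card (rest G k) \<le> k * (k + 1)"
    and low: "\<And>v. v \<in> pverts G \<Longrightarrow> nbs G v \<subseteq> high G k \<Longrightarrow> card (nbs G v) < d"
    and twins: "\<And>v. v \<in> pverts G \<Longrightarrow> card (twins G v) \<le> k + 1"
  shows "card (pverts G) \<le> k + k * (k + 1) + (k + 1) * (k ^ (d - 1) + 1)"
proof -
  have fin: "finite (pverts G)" using G by (simp add: pair_graph_iff)
  define I where "I = {v \<in> pverts G. nbs G v \<subseteq> high G k}"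
  have finI: "finite I" "finite (high G k)" "finite (rest G k)"
    using fin by (simp_all add: I_def high_def rest_def)
  have "I = (\<Union>A\<in>nbs G ` I. {v \<in> I. nbs G v = A})" by auto
  then have "card I \<le> (\<Sum>A\<in>nbs G ` I. card {v \<in> I. nbs G v = A})"
    using finI by (metis card_UN_le finite_imageI)
  also have "\<dots> \<le> (\<Sum>A\<in>nbs G ` I. k + 1)"
  proof (rule sum_mono, clarify)
    fix u assume u: "u \<in> I"
    have "card {v \<in> I. nbs G v = nbs G u} \<le> card (twins G u)"
      using fin by (intro card_mono) (auto simp: I_def twins_def)
    also have "\<dots> \<le> k + 1" using twins u by (simp add: I_def)
    finally show "card {v \<in> I. nbs G v = nbs G u} \<le> k + 1" .
  qed
  also have "\<dots> = (k + 1) * card (nbs G ` I)" by simp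
  also have "\<dots> \<le> (k + 1) * (k ^ (d - 1) + 1)"
  proof (rule mult_left_mono)
    have "nbs G ` I \<subseteq> {A. A \<subseteq> high G k \<and> card A \<le> d - 1}"
      using low by (force simp: I_def)
    then have "card (nbs G ` I) \<le> card {A. A \<subseteq> high G k \<and> card A \<le> d - 1}"
      using finI(2) by (intro card_mono) auto
    also have "\<dots> \<le> card (high G k) ^ (d - 1) + 1"
      by (rule card_small_subsets[OF finI(2)])
    also have "\<dots> \<le> k ^ (d - 1) + 1"
      using high by (intro add_mono power_mono) auto
    finally show "card (nbs G ` I) \<le> k ^ (d - 1) + 1" .
  qed simp
  finally have I: "card I \<le> (k + 1) * (k ^ (d - 1) + 1)" .
  have "pverts G \<subseteq> high G k \<union> rest G k \<union> I" by (auto simp: rest_def I_def)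
  then have "card (pverts G) \<le> card (high G k \<union> rest G k \<union> I)"
    using finI by (intro card_mono) auto
  also have "\<dots> \<le> card (high G k) + card (rest G k) + card I"
    using card_Un_le[of "high G k \<union> rest G k" I] card_Un_le[of "high G k" "rest G k"] by linarith
  finally show ?thesis using high rest I by linarith
qed

subsection \<open>Renaming the vertices\<close>

text \<open>Contraction and deletion leave gaps among the labels, whereas an instance has vertex set
  \<open>{..<n}\<close>.\<close>

definition relabel :: "nat list \<Rightarrow> ugraph \<Rightarrow> ugraph" where
  "relabel V G = \<lparr> pverts = {..<length V},
     parcs = {(i, j). i < length V \<and> j < length V \<and> (V ! i, V ! j) \<in> parcs G} \<rparr>"

lemma pair_graph_relabel: "pair_graph G \<Longrightarrow> pair_graph (relabel V G)"
  by (auto simp: pair_graph_iff relabel_def sym_def irrefl_def)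

lemma ratio_relabel:
  assumes G: "pair_graph G" and V: "distinct V" "set V = pverts G" and \<alpha>: "1 \<le> \<alpha>"
  shows "approx_ratio CVC G k ((!) V ` S') \<le> max (approx_ratio CVC (relabel V G) k S') (ereal \<alpha>)"
proof (rule ratio_step[OF G pair_graph_relabel[OF G] \<alpha>, of 0 0])
  let ?n = "length V" and ?f = "(!) V"
  have inj: "inj_on ?f {..<?n}" using V(1) by (simp add: inj_on_nth)
  have range: "?f ` {..<?n} = pverts G" using V(2) by (auto simp: set_conv_nth)
  have sub: "parcs G \<subseteq> pverts G \<times> pverts G" using G by (simp add: pair_graph_iff)
  {
    assume "connected_vertex_cover (relabel V G) S'"
    then have S': "S' \<subseteq> {..<?n}" "\<And>i j. (i, j) \<in> parcs (relabel V G) \<Longrightarrow> i \<in> S' \<or> j \<in> S'"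
        "conn (parcs (relabel V G)) S'"
      unfolding cvc_iff[OF pair_graph_relabel[OF G]] by (auto simp: relabel_def)
    have "conn (parcs G) (?f ` S')"
      using S'(3) by (rule conn_image) (auto simp: relabel_def)
    moreover have "x \<in> ?f ` S' \<or> y \<in> ?f ` S'" if "(x, y) \<in> parcs G" for x y
    proof -
      have "x \<in> ?f ` {..<?n}" "y \<in> ?f ` {..<?n}" using that sub unfolding range by auto
      then obtain i j where "i < ?n" "j < ?n" "x = V ! i" "y = V ! j" by auto
      with S'(2)[of i j] that show ?thesis by (auto simp: relabel_def)
    qed
    ultimately have "connected_vertex_cover G (?f ` S')"
      unfolding cvc_iff[OF G] using image_mono[OF S'(1), of ?f] by (simp add: range)
    moreover have "card (?f ` S') = card S'"
      using inj S'(1) by (meson card_image inj_on_subset)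
    ultimately show "connected_vertex_cover G (?f ` S') \<and> cost k (?f ` S') \<le> cost k S' + 0"
      by (simp add: cost_def)
  }
  fix T assume "connected_vertex_cover G T"
  then have T: "T \<subseteq> pverts G" "\<And>x y. (x, y) \<in> parcs G \<Longrightarrow> x \<in> T \<or> y \<in> T" "conn (parcs G) T" "finite T"
    using cvc_finite[OF G] unfolding cvc_iff[OF G] by blast+
  define g where "g = the_inv_into {..<?n} ?f"
  have g: "g x < ?n" "V ! g x = x" if "x \<in> pverts G" for x
    using the_inv_into_into[OF inj _ subset_refl] f_the_inv_into_f[OF inj] that
    unfolding g_def range by auto
  have gf: "g (V ! i) = i" if "i < ?n" for i
    unfolding g_def using that by (intro the_inv_into_f_f[OF inj]) simp
  have "conn (parcs (relabel V G)) (g ` T)"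
    using T(3)
  proof (rule conn_image)
    fix x y assume "x \<in> T" "y \<in> T" "(x, y) \<in> parcs G"
    then show "g x = g y \<or> (g x, g y) \<in> parcs (relabel V G)"
      using g[OF subsetD[OF T(1)]] by (simp add: relabel_def)
  qed
  moreover have "i \<in> g ` T \<or> j \<in> g ` T" if "(i, j) \<in> parcs (relabel V G)" for i j
  proof -
    have "i < ?n" "j < ?n" "V ! i \<in> T \<or> V ! j \<in> T"
      using that T(2)[of "V ! i" "V ! j"] by (auto simp: relabel_def)
    then show ?thesis using gf by (metis imageI)
  qed
  ultimately have "connected_vertex_cover (relabel V G) (g ` T)"
    unfolding cvc_iff[OF pair_graph_relabel[OF G]] using T(1) g by (auto simp: relabel_def)
  then show "\<exists>T'. connected_vertex_cover (relabel V G) T' \<and> (card T \<le> k \<longrightarrow> card T' + 0 \<le> card T)"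
    using card_image_le[OF T(4), of g] by auto
qed simp

text \<open>A cover has at most as many vertices as the graph, so lowering the parameter to that
  number lowers no cost.\<close>

lemma ratio_cap_parameter:
  assumes G: "pair_graph G" and \<alpha>: "1 \<le> \<alpha>"
  shows "approx_ratio CVC G k S \<le> max (approx_ratio CVC G (min k (card (pverts G))) S) (ereal \<alpha>)"
proof (rule ratio_step[OF G G \<alpha>, of 0 0])
  assume S: "connected_vertex_cover G S"
  then have "card S \<le> card (pverts G)"
    using G by (intro card_mono cvc_subset) (simp add: pair_graph_iff)
  with S show "connected_vertex_cover G S \<and> cost k S \<le> cost (min k (card (pverts G))) S + 0"
    by (auto simp: cost_def)
qed auto

section \<open>The algorithm\<close>

type_synonym lgraph = "nat list \<times> (nat \<times> nat) list"

text \<open>The last component collects the vertices that lifting adds to a solution: both rules lift a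
  solution by adding a fixed set of vertices to it.\<close>

type_synonym state = "lgraph \<times> nat \<times> nat list"

definition adj :: "lgraph \<Rightarrow> nat \<Rightarrow> nat \<Rightarrow> bool" where
  "adj g u v \<longleftrightarrow> u \<noteq> v \<and> list_ex (\<lambda>e. fst e = u \<and> snd e = v) (snd g)"

definition nbl :: "lgraph \<Rightarrow> nat \<Rightarrow> nat list" where
  "nbl g v = filter (\<lambda>u. adj g v u) (fst g)"

definition is_high :: "lgraph \<Rightarrow> nat \<Rightarrow> nat \<Rightarrow> bool" where
  "is_high g k u \<longleftrightarrow> k < length (nbl g u)"

definition highl :: "lgraph \<Rightarrow> nat \<Rightarrow> nat list" where
  "highl g k = filter (\<lambda>u. is_high g k u) (fst g)"

definition restl :: "lgraph \<Rightarrow> nat \<Rightarrow> nat list" where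
  "restl g k = filter (\<lambda>v. \<not> is_high g k v \<and> list_ex (\<lambda>u. \<not> is_high g k u) (nbl g v)) (fst g)"

definition contractible :: "nat \<Rightarrow> lgraph \<Rightarrow> nat \<Rightarrow> nat list" where
  "contractible d g k =
     filter (\<lambda>v. d \<le> length (nbl g v) \<and> list_all (\<lambda>u. is_high g k u) (nbl g v)) (fst g)"

definition twinl :: "lgraph \<Rightarrow> nat \<Rightarrow> nat list" where
  "twinl g v = filter (\<lambda>u. list_all (\<lambda>w. adj g u w = adj g v w) (fst g)) (fst g)"

definition deletable :: "lgraph \<Rightarrow> nat \<Rightarrow> nat list" where
  "deletable g k = filter (\<lambda>v. k + 1 < length (twinl g v)) (fst g)"

definition contract_to :: "nat list \<Rightarrow> nat \<Rightarrow> nat \<Rightarrow> nat" where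
  "contract_to N a x = (if list_ex (\<lambda>y. y = x) N then a else x)"

definition contractl :: "lgraph \<Rightarrow> nat list \<Rightarrow> nat \<Rightarrow> lgraph" where
  "contractl g N a =
     (filter (\<lambda>x. contract_to N a x = x) (fst g),
      map (\<lambda>e. (contract_to N a (fst e), contract_to N a (snd e))) (snd g))"

definition deletel :: "lgraph \<Rightarrow> nat \<Rightarrow> lgraph" where
  "deletel g v = (filter (\<lambda>x. x \<noteq> v) (fst g), snd g)"

text \<open>The head \<open>a\<close> represents the contracted neighbours, so the length of the
  tail \<open>N\<close> is the drop of the parameter.\<close>

definition contract_step :: "state \<Rightarrow> nat \<Rightarrow> state" where
  "contract_step s v = (case nbl (fst s) v of [] \<Rightarrow> s | a # N \<Rightarrow>
     (contractl (fst s) (a # N) a, fst (snd s) - length N, v # (a # N) @ snd (snd s)))"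

definition delete_step :: "state \<Rightarrow> nat \<Rightarrow> state" where
  "delete_step s v = (deletel (fst s) v, fst (snd s), nbl (fst s) v @ snd (snd s))"

text \<open>Under the guard, a vertex with only high neighbours has at most \<open>k\<close> of
  them, so the parameter is not truncated at 0. If the guard fails, the state stays as it is and is
  recognized by \<open>trivial\<close> at the end.\<close>

definition step :: "nat \<Rightarrow> state \<Rightarrow> state" where
  "step d s =
     (if length (highl (fst s) (fst (snd s))) \<le> fst (snd s) then
        (case contractible d (fst s) (fst (snd s)) of v # _ \<Rightarrow> contract_step s v
         | [] \<Rightarrow> (case deletable (fst s) (fst (snd s)) of v # _ \<Rightarrow> delete_step s v | [] \<Rightarrow> s))
      else s)"

definition entry :: "bool list list \<Rightarrow> nat \<Rightarrow> nat \<Rightarrow> bool" where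
  "entry M i j = nth_or False (nth_or [] M i) j"

definition edges :: "bool list list \<Rightarrow> (nat \<times> nat) list" where
  "edges M = filter (\<lambda>e. entry M (fst e) (snd e))
     (concat (map (\<lambda>i. map (\<lambda>j. (i, j)) [0..<length M]) [0..<length M]))"

definition init :: "bool list list \<Rightarrow> nat \<Rightarrow> state" where
  "init M k = (([0..<length M], edges M), k, [])"

text \<open>For a symmetric matrix and \<open>2 \<le> d\<close>, every round that changes the state
  removes a vertex, so \<open>length M\<close> rounds reach a fixpoint.\<close>

definition final :: "nat \<Rightarrow> bool list list \<Rightarrow> nat \<Rightarrow> state" where
  "final d M k = (step d ^^ length M) (init M k)"

definition trivial :: "lgraph \<Rightarrow> nat \<Rightarrow> bool" where
  "trivial g k \<longleftrightarrow> k < length (highl g k) \<or> k * (k + 1) < length (restl g k)"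

definition matrix :: "lgraph \<Rightarrow> bool list list" where
  "matrix g = map (\<lambda>u. map (\<lambda>v. adj g u v) (fst g)) (fst g)"

text \<open>The empty matrix stands for the graph without vertices. It has no connected vertex
  cover, so all its ratios are 1.\<close>

definition result :: "state \<Rightarrow> bool list list \<times> nat" where
  "result s = (if trivial (fst s) (fst (snd s)) then ([], 0) else (matrix (fst s), fst (snd s)))"

definition selected :: "state \<Rightarrow> bool list \<Rightarrow> nat \<Rightarrow> bool" where
  "selected s b i \<longleftrightarrow> list_ex (\<lambda>u. u = i) (snd (snd s)) \<or>
     (if trivial (fst s) (fst (snd s))
      then list_ex (\<lambda>u. u = i \<and> 0 < length (nbl (fst s) u)) (fst (fst s))
      else list_ex (\<lambda>j. nth_or 0 (fst (fst s)) j = i \<and> nth_or False b j) [0..<length (fst (fst s))])"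

definition reduce_fun :: "nat \<times> bool list list \<times> nat \<Rightarrow> bool list list \<times> nat" where
  "reduce_fun x = result (final (fst x) (fst (snd x)) (snd (snd x)))"

text \<open>Lifting gets no trace of the reduction, so the final state is computed again from the
  original instance.\<close>

definition lift_fun :: "nat \<times> (bool list list \<times> nat) \<times> bool list \<Rightarrow> bool list" where
  "lift_fun x = map (\<lambda>i. selected (final (fst x) (fst (fst (snd x))) (snd (fst (snd x)))) (snd (snd x)) i)
     [0..<length (fst (fst (snd x)))]"

subsection \<open>Running time\<close>

lemma polyt_adj [polyt_intros]:
  assumes "polyt g" "polyt u" "polyt v" shows "polyt (\<lambda>x. adj (g x) (u x) (v x))"
proof (rule polyt_comp3[of adj, OF _ assms])
  show "polyt (\<lambda>p. adj (fst p) (fst (snd p)) (snd (snd p)))"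
    unfolding adj_def by (intro polyt_intros)
qed

lemma polyt_nbl [polyt_intros]:
  assumes "polyt g" "polyt v" shows "polyt (\<lambda>x. nbl (g x) (v x))"
proof (rule polyt_comp2[of nbl, OF _ assms])
  show "polyt (\<lambda>p. nbl (fst p) (snd p))"
    unfolding nbl_def by (intro polyt_intros)
qed

lemma polyt_is_high [polyt_intros]:
  assumes "polyt g" "polyt k" "polyt u" shows "polyt (\<lambda>x. is_high (g x) (k x) (u x))"
  unfolding is_high_def by (intro polyt_intros assms)

lemma polyt_highl [polyt_intros]:
  assumes "polyt g" "polyt k" shows "polyt (\<lambda>x. highl (g x) (k x))"
proof (rule polyt_comp2[of highl, OF _ assms])
  show "polyt (\<lambda>p. highl (fst p) (snd p))"
    unfolding highl_def by (intro polyt_intros)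
qed

lemma polyt_restl [polyt_intros]:
  assumes "polyt g" "polyt k" shows "polyt (\<lambda>x. restl (g x) (k x))"
proof (rule polyt_comp2[of restl, OF _ assms])
  show "polyt (\<lambda>p. restl (fst p) (snd p))"
    unfolding restl_def by (intro polyt_intros)
qed

lemma polyt_contractible [polyt_intros]:
  assumes "polyt d" "polyt g" "polyt k" shows "polyt (\<lambda>x. contractible (d x) (g x) (k x))"
proof (rule polyt_comp3[of contractible, OF _ assms])
  show "polyt (\<lambda>p. contractible (fst p) (fst (snd p)) (snd (snd p)))"
    unfolding contractible_def by (intro polyt_intros)
qed

lemma polyt_twinl [polyt_intros]:
  assumes "polyt g" "polyt v" shows "polyt (\<lambda>x. twinl (g x) (v x))"
proof (rule polyt_comp2[of twinl, OF _ assms])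
  show "polyt (\<lambda>p. twinl (fst p) (snd p))"
    unfolding twinl_def by (intro polyt_intros)
qed

lemma polyt_deletable [polyt_intros]:
  assumes "polyt g" "polyt k" shows "polyt (\<lambda>x. deletable (g x) (k x))"
proof (rule polyt_comp2[of deletable, OF _ assms])
  show "polyt (\<lambda>p. deletable (fst p) (snd p))"
    unfolding deletable_def by (intro polyt_intros)
qed

lemma polyt_contract_to [polyt_intros]:
  assumes "polyt N" "polyt a" "polyt y" shows "polyt (\<lambda>x. contract_to (N x) (a x) (y x))"
proof (rule polyt_comp3[of contract_to, OF _ assms])
  show "polyt (\<lambda>p. contract_to (fst p) (fst (snd p)) (snd (snd p)))"
    unfolding contract_to_def by (intro polyt_intros)
qed

lemma polyt_contractl [polyt_intros]:
  assumes "polyt g" "polyt N" "polyt a" shows "polyt (\<lambda>x. contractl (g x) (N x) (a x))"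
proof (rule polyt_comp3[of contractl, OF _ assms])
  show "polyt (\<lambda>p. contractl (fst p) (fst (snd p)) (snd (snd p)))"
    unfolding contractl_def by (intro polyt_intros)
qed

lemma polyt_deletel [polyt_intros]:
  assumes "polyt g" "polyt v" shows "polyt (\<lambda>x. deletel (g x) (v x))"
proof (rule polyt_comp2[of deletel, OF _ assms])
  show "polyt (\<lambda>p. deletel (fst p) (snd p))"
    unfolding deletel_def by (intro polyt_intros)
qed

lemma polyt_step: "polyt (\<lambda>p. step (fst p) (snd p))"
proof -
  have c: "polyt (\<lambda>p. contract_step (fst p) (snd p))"
    unfolding contract_step_def by (intro polyt_intros)
  have d: "polyt (\<lambda>p. delete_step (fst p) (snd p))"
    unfolding delete_step_def by (intro polyt_intros)
  show ?thesis
    unfolding step_def by (intro polyt_intros polyt_comp2[OF c] polyt_comp2[OF d])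
qed

lemma polyt_init: "polyt (\<lambda>p. init (fst p) (snd p))"
  unfolding init_def edges_def entry_def by (intro polyt_intros)

text \<open>The invariant behind the size bound that \<open>polyt_funpow\<close> demands, with
  \<open>i\<close> the number of rounds done: no new labels arise, and a round records at most a
  vertex and its \<open>n\<close> neighbours. It holds for arbitrary matrices, since
  \<open>implements\<close> covers all inputs.\<close>

definition bounded_state :: "nat \<Rightarrow> nat \<Rightarrow> nat \<Rightarrow> state \<Rightarrow> bool" where
  "bounded_state n k i s \<longleftrightarrow>
     length (fst (fst s)) \<le> n \<and> set (fst (fst s)) \<subseteq> {..<n} \<and>
     length (snd (fst s)) \<le> n * n \<and> set (snd (fst s)) \<subseteq> {..<n} \<times> {..<n} \<and>
     fst (snd s) \<le> k \<and> length (snd (snd s)) \<le> i * (n + 1) \<and> set (snd (snd s)) \<subseteq> {..<n}"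

lemma nbl_bounded:
  assumes "bounded_state n k i s"
  shows "length (nbl (fst s) v) \<le> n" "set (nbl (fst s) v) \<subseteq> {..<n}"
proof -
  have "length (nbl (fst s) v) \<le> length (fst (fst s))" by (simp add: nbl_def)
  with assms show "length (nbl (fst s) v) \<le> n" by (simp add: bounded_state_def)
  show "set (nbl (fst s) v) \<subseteq> {..<n}" using assms by (auto simp: bounded_state_def nbl_def)
qed

lemma contract_step_bounded:
  assumes "bounded_state n k i s" "v \<in> set (fst (fst s))"
  shows "bounded_state n k (Suc i) (contract_step s v)"
proof (cases "nbl (fst s) v")
  case Nil
  with assms(1) show ?thesis by (simp add: contract_step_def bounded_state_def)
next
  case (Cons a N)
  have N: "length (a # N) \<le> n" "set (a # N) \<subseteq> {..<n}"
    using nbl_bounded[OF assms(1), of v] Cons by simp_all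
  have s: "length (fst (fst s)) \<le> n" "set (fst (fst s)) \<subseteq> {..<n}" "length (snd (fst s)) \<le> n * n"
      "set (snd (fst s)) \<subseteq> {..<n} \<times> {..<n}" "fst (snd s) \<le> k"
      "length (snd (snd s)) \<le> i * (n + 1)" "set (snd (snd s)) \<subseteq> {..<n}"
    using assms(1) by (simp_all add: bounded_state_def)
  have c: "contract_to (a # N) a x < n" if "x < n" for x
    using N(2) that by (simp add: contract_to_def)
  have "set (snd (contractl (fst s) (a # N) a)) \<subseteq> {..<n} \<times> {..<n}"
    using s(4) c by (fastforce simp: contractl_def)
  moreover have "length (fst (contractl (fst s) (a # N) a)) \<le> n"
    unfolding contractl_def fst_conv using s(1) length_filter_le order.trans by blast
  moreover have "set (fst (contractl (fst s) (a # N) a)) \<subseteq> {..<n}"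
    using s(2) by (auto simp: contractl_def)
  moreover have "v < n" using assms(2) s(2) by auto
  ultimately show ?thesis
    using s N by (auto simp: bounded_state_def contract_step_def Cons contractl_def)
qed

lemma delete_step_bounded:
  assumes "bounded_state n k i s"
  shows "bounded_state n k (Suc i) (delete_step s v)"
proof -
  have "length (filter (\<lambda>x. x \<noteq> v) (fst (fst s))) \<le> length (fst (fst s))" by simp
  then show ?thesis
    using assms nbl_bounded[OF assms, of v] 
    by (auto simp: bounded_state_def delete_step_def deletel_def simp del: length_filter_le)
qed

lemma step_bounded:
  assumes "bounded_state n k i s" shows "bounded_state n k (Suc i) (step d s)"
proof -
  have "bounded_state n k (Suc i) s" using assms by (simp add: bounded_state_def)
  moreover have "bounded_state n k (Suc i) (contract_step s v)"
    if "contractible d (fst s) (fst (snd s)) = v # vs" for v vs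
  proof (rule contract_step_bounded[OF assms])
    have "v \<in> set (contractible d (fst s) (fst (snd s)))" using that by simp
    then show "v \<in> set (fst (fst s))" by (simp add: contractible_def)
  qed
  ultimately show ?thesis
    using delete_step_bounded[OF assms] by (auto simp: step_def split: list.splits)
qed

lemma init_bounded: "bounded_state (length M) k 0 (init M k)"
proof -
  let ?n = "length M"
  have "length (edges M) \<le> length (concat (map (\<lambda>i. map (\<lambda>j. (i, j)) [0..<?n]) [0..<?n]))"
    unfolding edges_def by (rule length_filter_le)
  also have "\<dots> = ?n * ?n" by (simp add: length_concat o_def sum_list_triv)
  finally show ?thesis by (auto simp: bounded_state_def init_def edges_def)
qed

lemma final_bounded: "bounded_state (length M) k i ((step d ^^ i) (init M k))"
  by (induction i) (simp_all add: init_bounded step_bounded)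

lemma bounded_state_mono:
  assumes "bounded_state n k i s" "n \<le> m" "k \<le> l"
  shows "bounded_state m l i s"
proof -
  have "n * n \<le> m * m" "i * (n + 1) \<le> i * (m + 1)"
    using assms(2) by (auto intro: mult_mono)
  moreover have "{..<n} \<subseteq> {..<m}" "{..<n} \<times> {..<n} \<subseteq> {..<m} \<times> {..<m}"
    using assms(2) by auto
  ultimately show ?thesis
    using assms unfolding bounded_state_def by (meson order.trans)
qed

text \<open>In unary, a label below \<open>n\<close> has size at most \<open>2 * n + 1\<close> and
  an arc at most \<open>4 * n + 3\<close>; each list cell adds 1.\<close>

lemma bounded_state_esize:
  assumes "bounded_state n k i s" "i \<le> n"
  shows "esize s \<le> 1 + (1 + (n * (2 * n + 1 + 1) + 1) + (n * n * (4 * n + 3 + 1) + 1)) +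
    (1 + (2 * k + 1) + (n * (n + 1) * (2 * n + 1 + 1) + 1))"
proof -
  obtain V E k' U where s: "s = ((V, E), k', U)" by (metis surj_pair)
  have b: "length V \<le> n" "set V \<subseteq> {..<n}" "length E \<le> n * n" "set E \<subseteq> {..<n} \<times> {..<n}" "k' \<le> k"
      "length U \<le> i * (n + 1)" "set U \<subseteq> {..<n}"
    using assms(1) by (simp_all add: bounded_state_def s)
  have "esize V \<le> n * (2 * n + 1 + 1) + 1"
    using b(1,2) by (intro esize_list_le) auto
  moreover have "esize E \<le> n * n * (4 * n + 3 + 1) + 1"
    using b(3,4) by (intro esize_list_le) fastforce+
  moreover have "esize U \<le> n * (n + 1) * (2 * n + 1 + 1) + 1"
  proof (rule esize_list_le)
    show "length U \<le> n * (n + 1)" using b(6) assms(2) mult_right_mono[of i n "n + 1"] by linarith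
  qed (use b(7) in auto)
  ultimately show ?thesis using b(5) by (simp add: s)
qed

lemma polyt_final: "polyt (\<lambda>p. final (fst p) (fst (snd p)) (snd (snd p)))"
  unfolding final_def
proof (rule polyt_funpow)
  show "polyt (\<lambda>p::(nat \<times> bool list list \<times> nat) \<times> state. step (fst (fst p)) (snd p))"
    by (intro polyt_comp2[OF polyt_step] polyt_intros)
  show "polyt (\<lambda>x::nat \<times> bool list list \<times> nat. length (fst (snd x)))" by (intro polyt_intros)
  show "polyt (\<lambda>x::nat \<times> bool list list \<times> nat. init (fst (snd x)) (snd (snd x)))"
    by (intro polyt_comp2[OF polyt_init] polyt_intros)
  let ?q = "\<lambda>m::nat. 1 + (1 + (m * (2 * m + 1 + 1) + 1) + (m * m * (4 * m + 3 + 1) + 1)) +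
    (1 + (2 * m + 1) + (m * (m + 1) * (2 * m + 1 + 1) + 1))"
  show "pbound ?q" by (intro pbound_intros)
  fix x :: "nat \<times> bool list list \<times> nat" and i
  assume i: "i \<le> length (fst (snd x))"
  obtain d M k where x: "x = (d, M, k)" by (metis surj_pair)
  let ?m = "esize x"
  have "length M \<le> ?m" "k \<le> ?m" "i \<le> ?m"
    using length_le_esize[of M] i by (simp_all add: x)
  then have "bounded_state ?m ?m i ((step d ^^ i) (init M k))"
    using bounded_state_mono[OF final_bounded] by blast
  from bounded_state_esize[OF this \<open>i \<le> ?m\<close>]
  show "esize ((step (fst x) ^^ i) (init (fst (snd x)) (snd (snd x)))) \<le> ?q ?m"
    by (simp add: x)
qed

lemma polyt_trivial [polyt_intros]:
  assumes "polyt g" "polyt k" shows "polyt (\<lambda>x. trivial (g x) (k x))"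
  unfolding trivial_def by (intro polyt_intros assms)

lemma polyt_reduce_fun: "polyt reduce_fun"
proof -
  have "polyt result" unfolding result_def[abs_def] matrix_def by (intro polyt_intros)
  from polyt_comp[OF this polyt_final] show ?thesis
    by (simp add: reduce_fun_def[abs_def])
qed

lemma polyt_lift_fun: "polyt lift_fun"
proof -
  have s: "polyt (\<lambda>p. selected (fst p) (fst (snd p)) (snd (snd p)))"
    unfolding selected_def by (intro polyt_intros)
  show ?thesis
    unfolding lift_fun_def[abs_def] by (intro polyt_comp3[OF s] polyt_comp3[OF polyt_final] polyt_intros)
qed

subsection \<open>Correctness\<close>

definition to_graph :: "lgraph \<Rightarrow> ugraph" where
  "to_graph g = \<lparr> pverts = set (fst g),
     parcs = {(u, v). u \<in> set (fst g) \<and> v \<in> set (fst g) \<and> adj g u v} \<rparr>"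

text \<open>Weak enough to survive both rules without cleaning up. Distinctness turns lengths of
  filtered lists into cardinalities; symmetry makes the graph undirected.\<close>

definition wf_lgraph :: "lgraph \<Rightarrow> bool" where
  "wf_lgraph g \<longleftrightarrow> distinct (fst g) \<and> sym (set (snd g))"

lemma adj_iff: "adj g u v \<longleftrightarrow> u \<noteq> v \<and> (u, v) \<in> set (snd g)"
  by (force simp: adj_def list_ex_iff)

lemma card_filter_distinct: "distinct xs \<Longrightarrow> card {x \<in> set xs. P x} = length (filter P xs)"
  by (metis distinct_card distinct_filter set_filter)

lemma pverts_to_graph [simp]: "pverts (to_graph g) = set (fst g)"
  by (simp add: to_graph_def)

lemma pair_graph_to_graph: "wf_lgraph g \<Longrightarrow> pair_graph (to_graph g)"
  by (auto simp: pair_graph_iff to_graph_def wf_lgraph_def adj_iff sym_def irrefl_def)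

lemma nbl_subset: "set (nbl g v) \<subseteq> set (fst g)"
  by (auto simp: nbl_def)

lemma nbs_to_graph: "v \<in> set (fst g) \<Longrightarrow> nbs (to_graph g) v = set (nbl g v)"
  by (auto simp: nbs_def to_graph_def nbl_def)

lemma card_nbs_to_graph:
  "wf_lgraph g \<Longrightarrow> v \<in> set (fst g) \<Longrightarrow> card (nbs (to_graph g) v) = length (nbl g v)"
  by (simp add: nbs_to_graph card_filter_distinct nbl_def wf_lgraph_def)

lemma is_high_iff:
  "wf_lgraph g \<Longrightarrow> v \<in> set (fst g) \<Longrightarrow> is_high g k v \<longleftrightarrow> v \<in> high (to_graph g) k"
  by (simp add: is_high_def high_def card_nbs_to_graph)

lemma card_high_to_graph:
  assumes "wf_lgraph g" shows "card (high (to_graph g) k) = length (highl g k)"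
proof -
  have "high (to_graph g) k = set (highl g k)"
    using is_high_iff[OF assms] by (auto simp: highl_def high_def)
  then show ?thesis using assms by (simp add: card_filter_distinct highl_def wf_lgraph_def)
qed

lemma card_rest_to_graph:
  assumes "wf_lgraph g" shows "card (rest (to_graph g) k) = length (restl g k)"
proof -
  have "rest (to_graph g) k = set (restl g k)"
  proof (rule set_eqI)
    fix v
    have "nbs (to_graph g) v \<subseteq> high (to_graph g) k \<longleftrightarrow> \<not> list_ex (\<lambda>u. \<not> is_high g k u) (nbl g v)"
      if "v \<in> set (fst g)"
      using that is_high_iff[OF assms] nbl_subset[of g v]
      by (auto simp: nbs_to_graph list_ex_iff subset_iff)
    then show "v \<in> rest (to_graph g) k \<longleftrightarrow> v \<in> set (restl g k)"
      using is_high_iff[OF assms, of v k] by (auto simp: rest_def restl_def)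
  qed
  then show ?thesis using assms by (simp add: card_filter_distinct restl_def wf_lgraph_def)
qed

lemma card_twins_to_graph:
  assumes "wf_lgraph g" "v \<in> set (fst g)"
  shows "card (twins (to_graph g) v) = length (twinl g v)"
proof -
  have "nbs (to_graph g) u = nbs (to_graph g) v \<longleftrightarrow> list_all (\<lambda>w. adj g u w = adj g v w) (fst g)"
    if "u \<in> set (fst g)" for u
    using that assms(2) by (auto simp: nbs_to_graph nbl_def list_all_iff)
  then have "twins (to_graph g) v = set (twinl g v)"
    by (auto simp: twins_def twinl_def)
  then show ?thesis using assms by (simp add: card_filter_distinct twinl_def wf_lgraph_def)
qed

lemma contract_to_eq: "contract_to N a x = contract (set N) a x"
  by (auto simp: contract_to_def contract_def list_ex_iff)

lemma to_graph_contractl: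
  assumes "set N \<subseteq> set (fst g)" "a \<in> set N"
  shows "to_graph (contractl g N a) = graph_image (contract (set N) a) (to_graph g)"
proof -
  let ?c = "contract (set N) a"
  \<comment> \<open>As \<open>a\<close> is in \<open>N\<close>, the map is idempotent, so its fixed
    points are its image. As \<open>N\<close> consists of vertices, arcs with an absent end keep an
    absent end and create nothing.\<close>
  have c: "?c (?c x) = ?c x" "?c x \<in> set (fst g) \<longleftrightarrow> x \<in> set (fst g)" for x
    using assms by (auto simp: contract_def)
  have verts: "{x \<in> set (fst g). ?c x = x} = ?c ` set (fst g)"
    using c by (auto simp: image_iff) metis
  have "{(u, v). u \<in> ?c ` set (fst g) \<and> v \<in> ?c ` set (fst g) \<and> u \<noteq> v \<and>
      (u, v) \<in> (\<lambda>e. (?c (fst e), ?c (snd e))) ` set (snd g)} =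
    {(?c x, ?c y) |x y. (x, y) \<in> parcs (to_graph g) \<and> ?c x \<noteq> ?c y}" (is "?L = ?R")
  proof (intro equalityI subsetI; clarify)
    fix u v u' v' x y
    assume *: "u' \<in> set (fst g)" "v' \<in> set (fst g)" "(x, y) \<in> set (snd g)" "?c u' \<noteq> ?c v'"
      "?c u' = ?c (fst (x, y))" "?c v' = ?c (snd (x, y))"
    have eq: "?c u' = ?c x" "?c v' = ?c y" using *(5,6) by simp_all
    have "x \<in> set (fst g)" using c(2)[of x] c(2)[of u'] eq(1) *(1) by metis
    moreover have "y \<in> set (fst g)" using c(2)[of y] c(2)[of v'] eq(2) *(2) by metis
    moreover have "x \<noteq> y" "?c x \<noteq> ?c y" using *(4) unfolding eq by auto
    ultimately show "\<exists>x y. (?c u', ?c v') = (?c x, ?c y) \<and> (x, y) \<in> parcs (to_graph g) \<and> ?c x \<noteq> ?c y"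
      using *(3) eq by (intro exI[of _ x] exI[of _ y]) (simp add: to_graph_def adj_iff)
  next
    fix x y assume "(x, y) \<in> parcs (to_graph g)" "?c x \<noteq> ?c y"
    then show "?c x \<in> ?c ` set (fst g) \<and> ?c y \<in> ?c ` set (fst g) \<and> ?c x \<noteq> ?c y \<and>
      (?c x, ?c y) \<in> (\<lambda>e. (?c (fst e), ?c (snd e))) ` set (snd g)"
      by (force simp: to_graph_def adj_iff)
  qed
  then show ?thesis
    unfolding to_graph_def[of "contractl g N a"]
    by (simp add: contractl_def graph_image_def contract_to_eq adj_iff verts)
qed

lemma wf_contractl: "wf_lgraph g \<Longrightarrow> wf_lgraph (contractl g N a)"
  unfolding wf_lgraph_def
proof (elim conjE, intro conjI)
  show "distinct (fst (contractl g N a))" if "distinct (fst g)"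
    using that by (simp add: contractl_def)
  show "sym (set (snd (contractl g N a)))" if sym: "sym (set (snd g))"
  proof (rule symI)
    fix x y assume "(x, y) \<in> set (snd (contractl g N a))"
    then obtain u w where "(u, w) \<in> set (snd g)" "x = contract_to N a u" "y = contract_to N a w"
      by (auto simp: contractl_def)
    moreover from this have "(w, u) \<in> set (snd g)" using sym by (blast dest: symD)
    ultimately show "(y, x) \<in> set (snd (contractl g N a))"
      by (force simp: contractl_def)
  qed
qed

lemma to_graph_deletel: "to_graph (deletel g v) = delete (to_graph g) v"
  by (auto simp: to_graph_def deletel_def delete_def adj_iff)

lemma wf_deletel: "wf_lgraph g \<Longrightarrow> wf_lgraph (deletel g v)"
  by (simp add: wf_lgraph_def deletel_def)

text \<open>The set \<open>X\<close> of added vertices is the same for all \<open>S\<close>, so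
  liftings compose by union; the maxima with the common \<open>\<alpha>\<close> compose to a single
  one.\<close>

definition sound_step :: "real \<Rightarrow> state \<Rightarrow> state \<Rightarrow> bool" where
  "sound_step \<alpha> s s' \<longleftrightarrow> wf_lgraph (fst s') \<and> fst (snd s') \<le> fst (snd s) \<and>
     (\<exists>X. set (snd (snd s')) = X \<union> set (snd (snd s)) \<and>
       (\<forall>S. approx_ratio CVC (to_graph (fst s)) (fst (snd s)) (S \<union> X)
         \<le> max (approx_ratio CVC (to_graph (fst s')) (fst (snd s')) S) (ereal \<alpha>)))"

lemma contract_step_sound:
  assumes wf: "wf_lgraph (fst s)" and few: "length (highl (fst s) (fst (snd s))) \<le> fst (snd s)"
    and v: "v \<in> set (contractible d (fst s) (fst (snd s)))"
    and d: "2 \<le> d" and \<alpha>: "1 \<le> \<alpha>" "real d \<le> \<alpha> * (real d - 1)"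
  shows "sound_step \<alpha> s (contract_step s v) \<and>
    length (fst (fst (contract_step s v))) < length (fst (fst s))"
proof -
  obtain g k U where s: "s = (g, k, U)" by (metis surj_pair)
  have v': "v \<in> set (fst g)" "d \<le> length (nbl g v)" "\<And>u. u \<in> set (nbl g v) \<Longrightarrow> is_high g k u"
    using v by (auto simp: s contractible_def list_all_iff)
  obtain a N where N: "nbl g v = a # N" using v'(2) d by (cases "nbl g v") auto
  have wf: "wf_lgraph g" and G: "pair_graph (to_graph g)"
    using wf pair_graph_to_graph by (auto simp: s)
  have nbs: "nbs (to_graph g) v = set (a # N)" using nbs_to_graph[OF v'(1)] N by simp
  have sub: "set (a # N) \<subseteq> set (fst g)" using nbl_subset[of g v] N by simp
  have dist: "distinct (a # N)"
    using wf N by (metis distinct_filter nbl_def wf_lgraph_def)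
  have card: "card (set (a # N)) = Suc (length N)" using dist by (simp add: distinct_card)
  have high: "set (a # N) \<subseteq> high (to_graph g) k"
    using v'(3) sub is_high_iff[OF wf] N by (metis subsetD subsetI)
  have deg: "k < card (nbs (to_graph g) u)" if "u \<in> set (a # N)" for u
    using subsetD[OF high that] by (simp add: high_def)
  have "finite (high (to_graph g) k)" by (simp add: high_def)
  \<comment> \<open>Together with the guard on the number of high vertices, this bounds the number
    of contracted neighbours by \<open>k\<close>.\<close>
  then have "card (set (a # N)) \<le> card (high (to_graph g) k)" using high by (rule card_mono)
  then have le: "card (set (a # N)) \<le> k" using few card_high_to_graph[OF wf, of k] by (simp add: s)
  have step: "contract_step s v = (contractl g (a # N) a, k - length N, v # (a # N) @ U)"
    by (simp add: contract_step_def s N)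
  have "approx_ratio CVC (to_graph g) k (T \<union> set (a # N) \<union> {v})
      \<le> max (approx_ratio CVC (to_graph (contractl g (a # N) a)) (k - length N) T) (ereal \<alpha>)" for T
    using ratio_contract[OF G nbs _ deg le d _ \<alpha>, of a T] v'(2) N card
    by (simp add: to_graph_contractl[OF sub])
  then have "sound_step \<alpha> s (contract_step s v)"
    using wf_contractl[OF wf] unfolding step
    by (auto simp: sound_step_def s Un_ac intro!: exI[of _ "set (a # N) \<union> {v}"])
  moreover have "length (fst (contractl g (a # N) a)) < length (fst g)"
  proof -
    \<comment> \<open>Since \<open>d\<close> is at least 2, there is a second neighbour, which
      disappears into \<open>a\<close>.\<close>
    obtain b N' where "N = b # N'" using v'(2) d N by (cases N) auto
    then have "b \<in> set (fst g)" "contract_to (a # N) a b \<noteq> b"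
      using sub dist by (auto simp: contract_to_def)
    then show ?thesis unfolding contractl_def fst_conv by (rule length_filter_less)
  qed
  ultimately show ?thesis unfolding step by (simp add: s)
qed

lemma delete_step_sound:
  assumes wf: "wf_lgraph (fst s)" and v: "v \<in> set (deletable (fst s) (fst (snd s)))"
    and \<alpha>: "1 \<le> \<alpha>"
  shows "sound_step \<alpha> s (delete_step s v) \<and>
    length (fst (fst (delete_step s v))) < length (fst (fst s))"
proof -
  obtain g k U where s: "s = (g, k, U)" by (metis surj_pair)
  have v': "v \<in> set (fst g)" "k + 1 < length (twinl g v)"
    using v by (auto simp: s deletable_def)
  have wf: "wf_lgraph g" and G: "pair_graph (to_graph g)"
    using wf pair_graph_to_graph by (auto simp: s)
  have "approx_ratio CVC (to_graph g) k (T \<union> set (nbl g v))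
      \<le> max (approx_ratio CVC (to_graph (deletel g v)) k T) (ereal \<alpha>)" for T
    using ratio_delete_twin[OF G _ _ \<alpha>, of v k T] v'
    by (simp add: to_graph_deletel card_twins_to_graph[OF wf] nbs_to_graph)
  then have "sound_step \<alpha> s (delete_step s v)"
    using wf_deletel[OF wf]
    by (auto simp: sound_step_def s delete_step_def intro!: exI[of _ "set (nbl g v)"])
  moreover have "length (fst (deletel g v)) < length (fst g)"
    unfolding deletel_def fst_conv using v'(1) by (rule length_filter_less) simp
  ultimately show ?thesis by (simp add: delete_step_def s)
qed

lemma step_sound:
  assumes "wf_lgraph (fst s)" "2 \<le> d" "1 \<le> \<alpha>" "real d \<le> \<alpha> * (real d - 1)"
  shows "sound_step \<alpha> s (step d s)"
proof -
  have "sound_step \<alpha> s s"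
    using assms(1) by (auto simp: sound_step_def intro!: exI[of _ "{}"])
  then show ?thesis
    using contract_step_sound[OF assms(1) _ _ assms(2-4)] delete_step_sound[OF assms(1) _ assms(3)]
    by (auto simp: step_def split: list.splits)
qed

text \<open>Termination is read off the soundness lemmas, for which some admissible
  \<open>\<alpha>\<close> is needed: 2 serves for every \<open>d\<close> from 2 on.\<close>

lemma step_decreases:
  assumes "wf_lgraph (fst s)" "2 \<le> d"
  shows "step d s = s \<or> length (fst (fst (step d s))) < length (fst (fst s))"
proof -
  have "real d \<le> 2 * (real d - 1)" using assms(2) by simp
  then show ?thesis
    using contract_step_sound[OF assms(1) _ _ assms(2), where \<alpha> = 2]
      delete_step_sound[OF assms(1), where \<alpha> = 2]
    by (auto simp: step_def split: list.splits)
qed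

text \<open>An applied rule would have shortened the vertex list.\<close>

lemma step_fixpointD:
  assumes wf: "wf_lgraph (fst s)" and d: "2 \<le> d" and fixed: "step d s = s"
    and few: "length (highl (fst s) (fst (snd s))) \<le> fst (snd s)"
  shows "contractible d (fst s) (fst (snd s)) = []" "deletable (fst s) (fst (snd s)) = []"
proof -
  have \<alpha>: "1 \<le> (2::real)" "real d \<le> 2 * (real d - 1)" using d by simp_all
  show c: "contractible d (fst s) (fst (snd s)) = []"
  proof (cases "contractible d (fst s) (fst (snd s))")
    case (Cons v vs)
    then show ?thesis
      using contract_step_sound[OF wf few _ d \<alpha>, of v] fixed few by (simp add: step_def)
  qed
  show "deletable (fst s) (fst (snd s)) = []"
  proof (cases "deletable (fst s) (fst (snd s))")
    case (Cons v vs)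
    then show ?thesis
      using delete_step_sound[OF wf _ \<alpha>(1), of v] fixed few c by (simp add: step_def)
  qed
qed

text \<open>A round is either idle, and then so are all later ones, or it shortens the vertex list.
  With no vertices left, no round can shorten it.\<close>

lemma funpow_step_fixpoint:
  assumes "wf_lgraph (fst s)" "2 \<le> d" "length (fst (fst s)) \<le> n"
  shows "step d ((step d ^^ n) s) = (step d ^^ n) s"
  using assms(1,3)
proof (induction n arbitrary: s)
  case 0
  then show ?case using step_decreases[OF _ assms(2), of s] by auto
next
  case (Suc n)
  have fixed: "(step d ^^ m) s = s" if "step d s = s" for m
    using that by (induction m) auto
  have "wf_lgraph (fst (step d s))"
  proof -
    have "real d \<le> 2 * (real d - 1)" using assms(2) by simp
    then show ?thesis
      using step_sound[OF Suc.prems(1) assms(2), of 2] by (simp add: sound_step_def)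
  qed
  then show ?case
    using Suc.IH[of "step d s"] Suc.prems step_decreases[OF Suc.prems(1) assms(2)] fixed
    by (auto simp: funpow_swap1 simp del: funpow.simps(2)
        simp add: funpow_Suc_right)
qed

section \<open>From adjacency matrices to the reduced instance and back\<close>

definition graph_of :: "bool list list \<Rightarrow> ugraph" where
  "graph_of M = \<lparr> pverts = {..<length M},
     parcs = {(i, j). i < length M \<and> j < length M \<and> entry M i j} \<rparr>"

lemma entry_eq:
  "i < length M \<Longrightarrow> j < length (M ! i) \<Longrightarrow> entry M i j = M ! i ! j"
  by (simp add: entry_def nth_or_eq)

lemma graph_of_matrix: "graph_of (matrix g) = relabel (fst g) (to_graph g)"
  by (auto simp: graph_of_def relabel_def matrix_def to_graph_def entry_eq)

lemma set_edges: "set (edges M) = {(i, j). i < length M \<and> j < length M \<and> entry M i j}"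
  by (force simp: edges_def)

lemma init_graph:
  assumes "pair_graph (graph_of M)"
  shows "wf_lgraph (fst (init M k))" "to_graph (fst (init M k)) = graph_of M"
proof -
  have "sym (parcs (graph_of M))" "irrefl (parcs (graph_of M))"
    using assms by (simp_all add: pair_graph_iff)
  then show "wf_lgraph (fst (init M k))" "to_graph (fst (init M k)) = graph_of M"
    by (auto simp: wf_lgraph_def init_def set_edges graph_of_def to_graph_def adj_iff irrefl_def)
qed

lemma final_sound:
  fixes M :: "bool list list" and k :: nat
  assumes G: "pair_graph (graph_of M)" and d: "2 \<le> d" and \<alpha>: "1 \<le> \<alpha>" "real d \<le> \<alpha> * (real d - 1)"
  defines "s \<equiv> final d M k"
  shows "wf_lgraph (fst s)" "fst (snd s) \<le> k"
    "approx_ratio CVC (graph_of M) k (S \<union> set (snd (snd s))) \<le>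
       max (approx_ratio CVC (to_graph (fst s)) (fst (snd s)) S) (ereal \<alpha>)"
    "step d s = s"
proof -
  have *: "wf_lgraph (fst s) \<and> fst (snd s) \<le> k \<and>
      (\<forall>S. approx_ratio CVC (graph_of M) k (S \<union> set (snd (snd s))) \<le>
       max (approx_ratio CVC (to_graph (fst s)) (fst (snd s)) S) (ereal \<alpha>))"
    if "s = (step d ^^ i) (init M k)" for s i
    using that
  proof (induction i arbitrary: s)
    case 0
    then show ?case using init_graph[OF G, of k] by (simp add: init_def)
  next
    case (Suc i)
    let ?s = "(step d ^^ i) (init M k)"
    note IH = Suc.IH[OF refl]
    have "sound_step \<alpha> ?s s"
      using step_sound[OF conjunct1[OF IH] d \<alpha>] Suc.prems by simp
    then obtain X where X: "set (snd (snd s)) = X \<union> set (snd (snd ?s))"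
        "\<And>S. approx_ratio CVC (to_graph (fst ?s)) (fst (snd ?s)) (S \<union> X)
         \<le> max (approx_ratio CVC (to_graph (fst s)) (fst (snd s)) S) (ereal \<alpha>)"
        "wf_lgraph (fst s)" "fst (snd s) \<le> fst (snd ?s)"
      unfolding sound_step_def by blast
    have "approx_ratio CVC (graph_of M) k (S \<union> set (snd (snd s))) \<le>
        max (approx_ratio CVC (to_graph (fst s)) (fst (snd s)) S) (ereal \<alpha>)" for S
    proof -
      have "approx_ratio CVC (graph_of M) k (S \<union> X \<union> set (snd (snd ?s))) \<le>
          max (approx_ratio CVC (to_graph (fst ?s)) (fst (snd ?s)) (S \<union> X)) (ereal \<alpha>)"
        using IH by blast
      also have "\<dots> \<le> max (approx_ratio CVC (to_graph (fst s)) (fst (snd s)) S) (ereal \<alpha>)"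
        using X(2)[of S] by simp
      finally show ?thesis by (simp add: X(1) Un_assoc)
    qed
    with X(3,4) IH show ?case by (meson order.trans)
  qed
  show "wf_lgraph (fst s)" "fst (snd s) \<le> k"
    "approx_ratio CVC (graph_of M) k (S \<union> set (snd (snd s))) \<le>
       max (approx_ratio CVC (to_graph (fst s)) (fst (snd s)) S) (ereal \<alpha>)"
    using *[of s "length M"] by (simp_all add: s_def final_def)
  show "step d s = s"
    unfolding s_def final_def using init_graph[OF G] d
    by (intro funpow_step_fixpoint) (simp_all add: init_def)
qed

definition vertex_bound :: "nat \<Rightarrow> nat \<Rightarrow> nat" where
  "vertex_bound d k = k + k * (k + 1) + (k + 1) * (k ^ (d - 1) + 1)"

lemma vertex_bound_mono: "k \<le> k' \<Longrightarrow> vertex_bound d k \<le> vertex_bound d k'"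
  unfolding vertex_bound_def by (intro add_mono mult_mono power_mono) auto

lemma reduce_fun_graph:
  assumes G: "pair_graph (graph_of M)" and d: "2 \<le> d" and red: "reduce_fun (d, M, k) = (M', k')"
  shows "pair_graph (graph_of M')" "length M' \<le> vertex_bound d k" "length M' \<le> length M" "k' \<le> k"
    "list_all (\<lambda>r. length r = length M') M'"
proof -
  define s where "s = final d M k"
  \<comment> \<open>Shape and size of the result do not mention \<open>\<alpha>\<close>, so the
    value 2 is used for it.\<close>
  have "real d \<le> 2 * (real d - 1)" using d by simp
  note fin = final_sound[OF G d, of 2 k, folded s_def, OF _ this]
  have wf: "wf_lgraph (fst s)" and k: "fst (snd s) \<le> k" and fixed: "step d s = s" using fin by simp_all
  note pg = pair_graph_to_graph[OF wf]
  show "k' \<le> k" "list_all (\<lambda>r. length r = length M') M'"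
    using red k by (auto simp: reduce_fun_def result_def s_def[symmetric] matrix_def list_all_iff split: if_splits)
  show "pair_graph (graph_of M')"
  proof (cases "trivial (fst s) (fst (snd s))")
    case True
    then have "M' = []" using red by (simp add: reduce_fun_def result_def s_def[symmetric])
    then show ?thesis by (simp add: graph_of_def pair_graph_iff sym_def irrefl_def)
  next
    case False
    then have "M' = matrix (fst s)" using red by (simp add: reduce_fun_def result_def s_def[symmetric])
    then show ?thesis using pair_graph_relabel[OF pg] by (simp add: graph_of_matrix)
  qed
  have "bounded_state (length M) k (length M) s"
    unfolding s_def final_def by (rule final_bounded)
  then show "length M' \<le> length M"
    using red by (auto simp: reduce_fun_def result_def s_def[symmetric] matrix_def bounded_state_def split: if_splits)
  show "length M' \<le> vertex_bound d k"
  proof (cases "trivial (fst s) (fst (snd s))")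
    case True
    then show ?thesis using red by (auto simp: reduce_fun_def result_def s_def[symmetric])
  next
    case False
    let ?g = "fst s" and ?k = "fst (snd s)"
    have M': "M' = matrix ?g" using False red by (simp add: reduce_fun_def result_def s_def[symmetric])
    have few: "length (highl ?g ?k) \<le> ?k" "length (restl ?g ?k) \<le> ?k * (?k + 1)"
      using False by (simp_all add: trivial_def)
    note empty = step_fixpointD[OF wf d fixed few(1)]
    have "card (pverts (to_graph ?g)) \<le> vertex_bound d ?k"
      unfolding vertex_bound_def
    proof (rule card_reduced[OF pg])
      show "card (high (to_graph ?g) ?k) \<le> ?k" using few(1) by (simp add: card_high_to_graph[OF wf])
      show "card (rest (to_graph ?g) ?k) \<le> ?k * (?k + 1)" using few(2) by (simp add: card_rest_to_graph[OF wf])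
      fix v assume v: "v \<in> pverts (to_graph ?g)"
      show "card (twins (to_graph ?g) v) \<le> ?k + 1"
        using empty(2) v by (auto simp: deletable_def filter_empty_conv card_twins_to_graph[OF wf])
      show "card (nbs (to_graph ?g) v) < d" if "nbs (to_graph ?g) v \<subseteq> high (to_graph ?g) ?k"
      proof -
        have "list_all (\<lambda>u. is_high ?g ?k u) (nbl ?g v)"
          using that v nbl_subset[of ?g v] is_high_iff[OF wf] by (auto simp: nbs_to_graph list_all_iff)
        then show ?thesis
          using empty(1) v by (auto simp: contractible_def filter_empty_conv card_nbs_to_graph[OF wf])
      qed
    qed
    moreover have "card (pverts (to_graph ?g)) = length M'"
      using wf by (simp add: wf_lgraph_def distinct_card M' matrix_def)
    \<comment> \<open>The bound was obtained for \<open>?k\<close>, which contractions may have made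
      smaller than \<open>k\<close>.\<close>
    ultimately show ?thesis using vertex_bound_mono[OF k] order.trans by metis
  qed
qed

lemma lift_fun_ratio:
  assumes G: "pair_graph (graph_of M)" and d: "2 \<le> d" and \<alpha>: "1 \<le> \<alpha>" "real d \<le> \<alpha> * (real d - 1)"
    and red: "reduce_fun (d, M, k) = (M', k')" and S': "S' \<subseteq> {..<length M'}"
  defines "S \<equiv> {i. i < length M \<and> lift_fun (d, (M, k), map (\<lambda>i. i \<in> S') [0..<length M']) ! i}"
  shows "approx_ratio CVC (graph_of M) k S \<le> max (approx_ratio CVC (graph_of M') k' S') (ereal \<alpha>)"
proof -
  let ?b = "map (\<lambda>i. i \<in> S') [0..<length M']"
  define s where "s = final d M k"
  let ?g = "fst s" and ?k = "fst (snd s)" and ?U = "set (snd (snd s))"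
  note fin = final_sound[OF G d \<alpha>, of k, folded s_def]
  note pg = pair_graph_to_graph[OF fin(1)]
  have "bounded_state (length M) k (length M) s"
    unfolding s_def final_def by (rule final_bounded)
  then have sub: "set (fst ?g) \<subseteq> {..<length M}" "?U \<subseteq> {..<length M}"
    by (simp_all add: bounded_state_def)
  have S: "S = {i. i < length M \<and> selected s ?b i}"
    by (auto simp: S_def lift_fun_def s_def)
  have \<alpha>1: "1 \<le> ereal \<alpha>" using \<alpha>(1) by (simp add: one_ereal_def)
  show ?thesis
  proof (cases "trivial ?g ?k")
    case True
    \<comment> \<open>The nonisolated vertices are optimal for the last graph, so the bound \<alpha>
      holds whatever the ratio of \<open>S'\<close> is.\<close>
    have "S = nonisolated (to_graph ?g) \<union> ?U"
      using sub True nbs_to_graph[of _ ?g]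
      by (auto simp: S selected_def list_ex_iff nonisolated_def)
    moreover have "approx_ratio CVC (to_graph ?g) ?k (nonisolated (to_graph ?g)) = 1"
      using True by (intro ratio_nonisolated[OF pg])
        (simp add: trivial_def card_high_to_graph[OF fin(1)] card_rest_to_graph[OF fin(1)])
    ultimately have "approx_ratio CVC (graph_of M) k S \<le> ereal \<alpha>"
      using fin(3)[of "nonisolated (to_graph ?g)"] \<alpha>1 by (simp add: max_def)
    then show ?thesis by (simp add: le_max_iff_disj)
  next
    case False
    then have M': "M' = matrix ?g" "k' = ?k"
      using red by (simp_all add: reduce_fun_def result_def s_def[symmetric])
    then have len: "length M' = length (fst ?g)" by (simp add: matrix_def)
    have "selected s ?b i \<longleftrightarrow> i \<in> (!) (fst ?g) ` S' \<union> ?U" for i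
      using False S' by (auto simp: selected_def list_ex_iff nth_or_eq len)
    moreover have "(!) (fst ?g) ` S' \<subseteq> {..<length M}"
      using sub(1) S' nth_mem[of _ "fst ?g"] by (auto simp: len subset_iff)
    ultimately have "S = (!) (fst ?g) ` S' \<union> ?U"
      using sub(2) unfolding S by blast
    then have "approx_ratio CVC (graph_of M) k S \<le>
        max (approx_ratio CVC (to_graph ?g) ?k ((!) (fst ?g) ` S')) (ereal \<alpha>)"
      using fin(3) by simp
    moreover have "approx_ratio CVC (to_graph ?g) ?k ((!) (fst ?g) ` S') \<le>
        max (approx_ratio CVC (graph_of M') k' S') (ereal \<alpha>)"
      using ratio_relabel[OF pg _ _ \<alpha>(1), of "fst ?g" ?k S'] fin(1)
      by (simp add: M' graph_of_matrix wf_lgraph_def)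
    ultimately show ?thesis by (meson max.boundedI max.cobounded2 order.trans)
  qed
qed

section \<open>The kernelization\<close>

definition mat :: "ugraph \<Rightarrow> bool list list" where
  "mat G = (let n = card (pverts G) in map (\<lambda>i. map (\<lambda>j. (i, j) \<in> parcs G) [0..<n]) [0..<n])"

definition vec :: "ugraph \<Rightarrow> nat set \<Rightarrow> bool list" where
  "vec G S = map (\<lambda>i. i \<in> S) [0..<card (pverts G)]"

lemma length_mat [simp]: "length (mat G) = card (pverts G)"
  by (simp add: mat_def Let_def)

lemma enc_graph_mat: "enc_graph G = enc (mat G)"
  by (simp add: enc_graph_def mat_def enc_list_inst Let_def o_def)

lemma enc_vset_vec: "enc_vset G S = enc (vec G S)"
  by (simp add: enc_vset_def vec_def enc_list_inst o_def)

lemma card_graph_of [simp]: "card (pverts (graph_of M)) = length M"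
  by (simp add: graph_of_def)

lemma graph_of_mat:
  assumes "G \<in> instances CVC" shows "graph_of (mat G) = G"
proof -
  obtain n where n: "pverts G = {..<n}" and G: "pair_graph G" using assms by auto
  have "(i, j) \<in> parcs G \<Longrightarrow> i < n \<and> j < n" for i j
    using G n by (auto simp: pair_graph_iff)
  moreover have "entry (mat G) i j \<longleftrightarrow> (i, j) \<in> parcs G" if "i < n" "j < n" for i j
    using that by (simp add: entry_eq mat_def n Let_def)
  ultimately have "parcs (graph_of (mat G)) = parcs G"
    by (auto simp: graph_of_def n)
  moreover have "pverts (graph_of (mat G)) = pverts G" by (simp add: graph_of_def n)
  ultimately show ?thesis by (simp add: pair_pre_digraph.equality)
qed

lemma mat_graph_of:
  assumes "list_all (\<lambda>r. length r = length M) M" shows "mat (graph_of M) = M"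
proof (rule nth_equalityI)
  fix i assume "i < length (mat (graph_of M))"
  then have i: "i < length M" by simp
  then have "length (M ! i) = length M" using assms by (simp add: list_all_length)
  then show "mat (graph_of M) ! i = M ! i"
    using i by (intro nth_equalityI) (simp_all add: mat_def Let_def graph_of_def entry_eq)
qed simp

definition threshold :: "real \<Rightarrow> nat" where
  "threshold \<alpha> = nat \<lceil>\<alpha> / (\<alpha> - 1)\<rceil>"

text \<open>The inequality \<open>\<alpha> / (\<alpha> - 1) \<le> d\<close> rearranges to
  \<open>d \<le> \<alpha> * (d - 1)\<close>. The quotient is strictly above 1, so rounding up gives
  at least 2.\<close>

lemma threshold:
  assumes "1 < \<alpha>"
  shows "2 \<le> threshold \<alpha>" "real (threshold \<alpha>) \<le> \<alpha> * (real (threshold \<alpha>) - 1)"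
proof -
  have "1 < \<alpha> / (\<alpha> - 1)" using assms by simp
  then have "1 < \<lceil>\<alpha> / (\<alpha> - 1)\<rceil>" by linarith
  then show "2 \<le> threshold \<alpha>" unfolding threshold_def by linarith
  have "\<alpha> / (\<alpha> - 1) \<le> real (threshold \<alpha>)"
    unfolding threshold_def by linarith
  then show "real (threshold \<alpha>) \<le> \<alpha> * (real (threshold \<alpha>) - 1)"
    using assms by (simp add: field_simps)
qed

subsection \<open>Programs\<close>

text \<open>Truncates the unary parameter at the number of vertices, so that the running time does not
  depend on the parameter: \<^term>\<open>min k n\<close> and \<open>k\<close> give the same objective.\<close>

definition truncate_body :: expr where
  "truncate_body = IfE (HdE Arg)
     (IfE (TlE Arg) (NodeE LeafE (Call 1 (NodeE (TlE (HdE Arg)) (TlE (TlE Arg))))) LeafE) LeafE"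

lemma enc_nat_simps [simp]: "enc_nat 0 = Leaf" "enc_nat (Suc k) = Node Leaf (enc_nat k)"
  by (simp_all add: enc_nat_def)

text \<open>The recursion descends through the rows and the unary number in parallel, so its cost is
  linear in the number of rows, however large \<open>k\<close> is.\<close>

lemma eval_truncate:
  assumes "1 < length P" "P ! 1 = truncate_body"
  shows "\<exists>t \<le> 20 * length xs + 20.
    eval P (Node (enc_list xs) (enc_nat k)) truncate_body (enc_nat (min (length xs) k)) t"
proof (induction xs arbitrary: k)
  case Nil
  have "eval P (Node Leaf (enc_nat k)) (HdE Arg) Leaf (1 + 1)"
    using eval_HdE[OF eval_Arg[of P "Node Leaf (enc_nat k)"]] by simp
  from eval_IfE_false[OF this eval_LeafE]
  show ?case unfolding truncate_body_def by (intro exI[of _ "1 + 1 + 1 + 1"]) simp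
next
  case (Cons x xs)
  let ?y = "Node (enc_list (x # xs)) (enc_nat k)"
  have hd: "eval P ?y (HdE Arg) (Node x (enc_list xs)) (1 + 1)"
    using eval_HdE[OF eval_Arg[of P ?y]] by simp
  have tl: "eval P ?y (TlE Arg) (enc_nat k) (1 + 1)"
    using eval_TlE[OF eval_Arg[of P ?y]] by simp
  show ?case
  proof (cases k)
    case 0
    have "eval P ?y (TlE Arg) Leaf (1 + 1)" using tl 0 by simp
    from eval_IfE_true[OF hd _ eval_IfE_false[OF this eval_LeafE]]
    have "eval P ?y truncate_body Leaf (1 + 1 + (1 + 1 + 1 + 1) + 1)"
      unfolding truncate_body_def by simp
    then show ?thesis using 0 by (intro exI[of _ "1 + 1 + (1 + 1 + 1 + 1) + 1"]) simp
  next
    case (Suc m)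
    obtain t where t: "t \<le> 20 * length xs + 20"
        "eval P (Node (enc_list xs) (enc_nat m)) (P ! 1) (enc_nat (min (length xs) m)) t"
      using Cons.IH[of m] assms(2) by auto
    have "eval P ?y (NodeE (TlE (HdE Arg)) (TlE (TlE Arg))) (Node (enc_list xs) (enc_nat m))
        (1 + 1 + 1 + (1 + 1 + 1) + 1)"
      using eval_NodeE[OF eval_TlE[OF hd] eval_TlE[OF tl]] Suc by simp
    from eval_NodeE[OF eval_LeafE eval_Call[OF this assms(1) t(2)]]
    have rec: "eval P ?y (NodeE LeafE (Call 1 (NodeE (TlE (HdE Arg)) (TlE (TlE Arg)))))
        (enc_nat (min (length (x # xs)) k)) (1 + (1 + 1 + 1 + (1 + 1 + 1) + 1 + t + 1) + 1)"
      using Suc by simp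
    have ne: "enc_nat k \<noteq> Leaf" using Suc by simp
    have "eval P ?y truncate_body (enc_nat (min (length (x # xs)) k))
        (1 + 1 + (1 + 1 + (1 + (1 + 1 + 1 + (1 + 1 + 1) + 1 + t + 1) + 1) + 1) + 1)"
      using eval_IfE_true[OF hd _ eval_IfE_true[OF tl ne rec]] unfolding truncate_body_def by blast
    then show ?thesis
      using t(1) by (intro exI[of _ "1 + 1 + (1 + 1 + (1 + (1 + 1 + 1 + (1 + 1 + 1) + 1 + t + 1) + 1) + 1) + 1"]) auto
  qed
qed

text \<open>Index 0 is the entry point, index 1 the truncation, and the fixed program
  \<open>Q\<close> starts at index 2. Only the literal for \<open>d\<close> depends on the
  approximation factor.\<close>

definition wrap :: "nat \<Rightarrow> expr \<Rightarrow> program \<Rightarrow> program" where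
  "wrap d e Q = [Call 2 (NodeE (lit (enc_nat d)) e), truncate_body] @ map (shift 2) Q"

text \<open>Here \<open>m\<close> is the size of the instance. The numeric constants are generous.
  The exponent \<open>c'\<close> allows a common one for the two programs.\<close>

lemma wrap_runs:
  fixes F :: "nat \<times> 'a::enc \<Rightarrow> 'b::enc"
  assumes Q: "implements Q 0 F (\<lambda>x. (esize x + 2) ^ c)"
    and e: "eval (wrap d e Q) y e (enc z) s" "s \<le> 20 * m + 40"
    and m: "1 \<le> m" "esize z \<le> 14 * m" and c: "c \<le> c'"
  shows "runs_within (wrap d e Q) y (enc (F (d, z)))
    (real ((2 * d + 70) + (2 * d + 20) ^ c') * real m ^ (c' + 1))"
proof -
  let ?P = "wrap d e Q"
  have P: "implements ?P 2 F (\<lambda>x. (esize x + 2) ^ c)"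
    using implements_link[OF Q, of "[Call 2 (NodeE (lit (enc_nat d)) e), truncate_body]" "[]"]
    by (simp add: wrap_def numeral_2_eq_2)
  have "eval ?P y (NodeE (lit (enc_nat d)) e) (enc (d, z)) (dsize (enc_nat d) + s + 1)"
    using eval_NodeE[OF eval_lit[of ?P y "enc_nat d"] e(1)] by simp
  from implements_Call[OF P this]
  obtain t where t: "eval ?P y (?P ! 0) (enc (F (d, z))) (dsize (enc_nat d) + s + 1 + t + 1)"
      "t + esize (F (d, z)) \<le> (esize (d, z) + 2) ^ c"
    by (auto simp: wrap_def)
  \<comment> \<open>Since \<open>m\<close> is at least 1, the size is at most
    \<open>(2 * d + 20) * m\<close>. The power of this product splits, so \<open>d\<close> ends up
    in the coefficient and not in the exponent of \<open>m\<close>.\<close>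
  have "esize (d, z) + 2 \<le> 2 * d * m + 20 * m"
  proof -
    have "2 * d \<le> 2 * d * m" using m(1) by simp
    moreover have "esize (d, z) + 2 = 2 * d + esize z + 4" by simp
    ultimately show ?thesis using m by linarith
  qed
  then have "(esize (d, z) + 2) ^ c \<le> ((2 * d + 20) * m) ^ c"
    by (intro power_mono) (simp_all add: algebra_simps)
  also have "\<dots> \<le> ((2 * d + 20) * m) ^ c'"
    using c m(1) by (intro power_increasing) auto
  also have "\<dots> = (2 * d + 20) ^ c' * m ^ c'" by (rule power_mult_distrib)
  also have "\<dots> \<le> (2 * d + 20) ^ c' * m ^ (c' + 1)"
    using m(1) by (intro mult_left_mono power_increasing) auto
  finally have 1: "t + esize (F (d, z)) \<le> (2 * d + 20) ^ c' * m ^ (c' + 1)" using t(2) by linarith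
  have "dsize (enc_nat d) + s + 2 \<le> (2 * d + 70) * m"
  proof -
    have "2 * d \<le> 2 * d * m" using m(1) by simp
    moreover have "(2 * d + 70) * m = 2 * d * m + 70 * m" by (simp add: algebra_simps)
    moreover have "dsize (enc_nat d) = 2 * d + 1" by simp
    ultimately show ?thesis using m e(2) by linarith
  qed
  also have "\<dots> \<le> (2 * d + 70) * m ^ (c' + 1)"
    using m(1) by (intro mult_left_mono) auto
  finally have "dsize (enc_nat d) + s + 1 + t + 1 + esize (F (d, z))
      \<le> ((2 * d + 70) + (2 * d + 20) ^ c') * m ^ (c' + 1)"
    using 1 by (simp only: distrib_right)
  then have "real (dsize (enc_nat d) + s + 1 + t + 1 + esize (F (d, z)))
      \<le> real ((2 * d + 70) + (2 * d + 20) ^ c') * real m ^ (c' + 1)"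
    by (metis of_nat_le_iff of_nat_mult of_nat_power)
  then show ?thesis
    using t(1) unfolding runs_within_def by (auto simp: wrap_def)
qed

definition reduce_arg :: expr where
  "reduce_arg = NodeE (HdE Arg) (Call 1 Arg)"

text \<open>Keeps the original matrix, its truncated parameter and the solution, which is the format
  of \<open>lift_fun\<close>.\<close>

definition lift_arg :: expr where
  "lift_arg = NodeE (NodeE (HdE (HdE Arg)) (Call 1 (HdE Arg))) (TlE (TlE Arg))"

lemma eval_reduce_arg:
  "\<exists>s \<le> 20 * length M + 40. eval (wrap d e Q) (Node (enc M) (enc_nat k)) reduce_arg
     (enc (M, min (length M) k)) s"
proof -
  let ?P = "wrap d e Q" and ?y = "Node (enc M) (enc_nat k)"
  have P: "1 < length ?P" "?P ! 1 = truncate_body" by (simp_all add: wrap_def)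
  obtain t where t: "t \<le> 20 * length M + 20" "eval ?P ?y (?P ! 1) (enc_nat (min (length M) k)) t"
    using eval_truncate[OF P, of "map enc M" k] unfolding P(2) enc_list_inst by auto
  from eval_NodeE[OF eval_HdE[OF eval_Arg] eval_Call[OF eval_Arg P(1) t(2)]]
  have "eval ?P ?y reduce_arg (enc (M, min (length M) k)) (1 + 1 + (1 + t + 1) + 1)"
    unfolding reduce_arg_def by simp
  then show ?thesis using t(1) by (intro exI[of _ "1 + 1 + (1 + t + 1) + 1"]) auto
qed

lemma eval_lift_arg:
  "\<exists>s \<le> 20 * length M + 40. eval (wrap d e Q) (Node (Node (enc M) (enc_nat k)) (Node i (enc b))) lift_arg
     (enc ((M, min (length M) k), b)) s"
proof -
  let ?P = "wrap d e Q" and ?z = "Node (enc M) (enc_nat k)"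
  let ?y = "Node ?z (Node i (enc b))"
  have P: "1 < length ?P" "?P ! 1 = truncate_body" by (simp_all add: wrap_def)
  obtain t where t: "t \<le> 20 * length M + 20" "eval ?P ?z (?P ! 1) (enc_nat (min (length M) k)) t"
    using eval_truncate[OF P, of "map enc M" k] unfolding P(2) enc_list_inst by auto
  have hd: "eval ?P ?y (HdE Arg) ?z (1 + 1)"
    using eval_HdE[OF eval_Arg[of ?P ?y]] by simp
  have tl: "eval ?P ?y (TlE (TlE Arg)) (enc b) (1 + 1 + 1)"
    using eval_TlE[OF eval_TlE[OF eval_Arg[of ?P ?y]]] by simp
  from eval_NodeE[OF eval_NodeE[OF eval_HdE[OF hd] eval_Call[OF hd P(1) t(2)]] tl]
  have "eval ?P ?y lift_arg (enc ((M, min (length M) k), b))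
      (1 + 1 + 1 + (1 + 1 + t + 1) + 1 + (1 + 1 + 1) + 1)"
    unfolding lift_arg_def by simp
  then show ?thesis
    using t(1) by (intro exI[of _ "1 + 1 + 1 + (1 + 1 + t + 1) + 1 + (1 + 1 + 1) + 1"]) auto
qed

section \<open>The reduction and lifting maps on graphs\<close>

definition kernel_reduce :: "real \<Rightarrow> ugraph \<Rightarrow> nat \<Rightarrow> ugraph \<times> nat" where
  "kernel_reduce \<alpha> G k =
     (let (M, k') = reduce_fun (threshold \<alpha>, mat G, min (card (pverts G)) k) in (graph_of M, k'))"

definition kernel_lift :: "real \<Rightarrow> ugraph \<Rightarrow> nat \<Rightarrow> ugraph \<Rightarrow> nat \<Rightarrow> nat set \<Rightarrow> nat set" where
  "kernel_lift \<alpha> G k G' k' S' =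
     {i. i < card (pverts G) \<and>
         lift_fun (threshold \<alpha>, (mat G, min (card (pverts G)) k), vec G' S') ! i}"

lemma kernel_reduceD:
  assumes G: "G \<in> instances CVC" and \<alpha>: "1 < \<alpha>" and red: "kernel_reduce \<alpha> G k = (G', k')"
  shows "G' \<in> instances CVC" "card (pverts G') \<le> vertex_bound (threshold \<alpha>) k"
    "card (pverts G') \<le> card (pverts G)" "k' \<le> min (card (pverts G)) k"
    "reduce_fun (threshold \<alpha>, mat G, min (card (pverts G)) k) = (mat G', k')"
    "pverts G' = {..<card (pverts G')}"
proof -
  let ?k = "min (card (pverts G)) k"
  obtain M where M: "reduce_fun (threshold \<alpha>, mat G, ?k) = (M, k')" "G' = graph_of M"
    using red by (auto simp: kernel_reduce_def split: prod.splits)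
  have pg: "pair_graph (graph_of (mat G))" using graph_of_mat[OF G] G by simp
  note * = reduce_fun_graph[OF pg threshold(1)[OF \<alpha>] M(1)]
  show "G' \<in> instances CVC" using *(1) by (auto simp: M(2) graph_of_def)
  show "card (pverts G') \<le> vertex_bound (threshold \<alpha>) k"
    using *(2) vertex_bound_mono[of ?k k "threshold \<alpha>"] by (simp add: M(2))
  show "card (pverts G') \<le> card (pverts G)" "k' \<le> ?k"
    using *(3,4) by (simp_all add: M(2))
  show "reduce_fun (threshold \<alpha>, mat G, ?k) = (mat G', k')"
    using M mat_graph_of[OF *(5)] by simp
  show "pverts G' = {..<card (pverts G')}" by (simp add: M(2) graph_of_def)
qed

lemma kernel_ratio:
  assumes G: "G \<in> instances CVC" and \<alpha>: "1 < \<alpha>" and red: "kernel_reduce \<alpha> G k = (G', k')"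
    and S': "S' \<subseteq> pverts G'"
  shows "approx_ratio CVC G k (kernel_lift \<alpha> G k G' k' S') \<le> max (approx_ratio CVC G' k' S') (ereal \<alpha>)"
proof -
  let ?k = "min (card (pverts G)) k"
  note * = kernel_reduceD[OF G \<alpha> red]
  have pg: "pair_graph (graph_of (mat G))" using graph_of_mat[OF G] G by simp
  have "S' \<subseteq> {..<length (mat G')}" using S' *(6) by simp
  from lift_fun_ratio[OF pg threshold(1)[OF \<alpha>] _ threshold(2)[OF \<alpha>] *(5) this] \<alpha>
  have "approx_ratio CVC G ?k (kernel_lift \<alpha> G k G' k' S') \<le> max (approx_ratio CVC G' k' S') (ereal \<alpha>)"
    by (simp add: kernel_lift_def vec_def graph_of_mat[OF G] graph_of_mat[OF *(1)])
  moreover have "approx_ratio CVC G k (kernel_lift \<alpha> G k G' k' S') \<le>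
      max (approx_ratio CVC G ?k (kernel_lift \<alpha> G k G' k' S')) (ereal \<alpha>)"
    using ratio_cap_parameter[of G \<alpha> k] G \<alpha> by (simp add: min.commute)
  ultimately show ?thesis by (meson max.boundedI max.cobounded2 order.trans)
qed

definition kernel :: "program \<Rightarrow> program \<Rightarrow> real \<Rightarrow> (ugraph, nat set) kernelization" where
  "kernel Q1 Q2 \<alpha> = \<lparr> reduce = kernel_reduce \<alpha>, lift = kernel_lift \<alpha>,
     reduce_prog = wrap (threshold \<alpha>) reduce_arg Q1, lift_prog = wrap (threshold \<alpha>) lift_arg Q2 \<rparr>"

lemma esize_mat_ge: "2 * card (pverts G) < esize (mat G)"
  using length_le_esize[of "mat G"] by simp

lemma kernel_implemented:
  assumes Q1: "implements Q1 0 reduce_fun (\<lambda>x. (esize x + 2) ^ c1)"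
    and Q2: "implements Q2 0 lift_fun (\<lambda>x. (esize x + 2) ^ c2)" and \<alpha>: "1 < \<alpha>"
  defines "d \<equiv> threshold \<alpha>"
  defines "T \<equiv> \<lambda>m::nat. real ((2 * d + 70) + (2 * d + 20) ^ (c1 + c2)) * real m ^ (c1 + c2 + 1)"
  shows "implemented_within CVC (kernel Q1 Q2 \<alpha>)
    (\<lambda>G k. T (inst_size CVC G)) (\<lambda>G k G' k' S'. T (inst_size CVC G))"
  unfolding implemented_within_def
proof (intro ballI allI impI conjI)
  fix G k G' k'
  assume G: "G \<in> instances CVC" and "reduce (kernel Q1 Q2 \<alpha>) G k = (G', k')"
  then have red: "kernel_reduce \<alpha> G k = (G', k')" by (simp add: kernel_def)
  note * = kernel_reduceD[OF G \<alpha> red]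
  let ?n = "card (pverts G)" and ?m = "inst_size CVC G"
  have m: "?m = esize (mat G)" by (simp add: inst_size_def enc_graph_mat)
  have nm: "2 * ?n < ?m" unfolding m by (rule esize_mat_ge)
  obtain s where s: "s \<le> 20 * ?n + 40"
      "eval (wrap d reduce_arg Q1) (Node (enc (mat G)) (enc_nat k)) reduce_arg (enc (mat G, min ?n k)) s"
    using eval_reduce_arg[of "mat G" d reduce_arg Q1 k] unfolding length_mat by blast
  have "runs_within (wrap d reduce_arg Q1) (Node (enc (mat G)) (enc_nat k))
      (enc (reduce_fun (d, mat G, min ?n k))) (T ?m)"
    unfolding T_def
  proof (rule wrap_runs[OF Q1 s(2)])
    show "esize (mat G, min ?n k) \<le> 14 * ?m" using nm m by simp
  qed (use s(1) nm in auto)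
  then show "runs_within (reduce_prog (kernel Q1 Q2 \<alpha>)) (enc_pinst CVC G k) (enc_pinst CVC G' k') (T ?m)"
    using *(5) by (simp add: kernel_def enc_pinst_def enc_graph_mat d_def)
  fix S' assume S': "S' \<in> solutions CVC G'"
  obtain s where s: "s \<le> 20 * ?n + 40"
      "eval (wrap d lift_arg Q2) (Node (Node (enc (mat G)) (enc_nat k)) (Node (enc_pinst CVC G' k') (enc (vec G' S'))))
        lift_arg (enc ((mat G, min ?n k), vec G' S')) s"
    using eval_lift_arg[of "mat G" d lift_arg Q2 k "enc_pinst CVC G' k'" "vec G' S'"]
    unfolding length_mat by blast
  \<comment> \<open>The reduced graph has no more vertices than \<open>G\<close>, so even the given
    solution is bounded in terms of the original instance.\<close>
  have vec: "esize (vec G' S') \<le> ?n * (3 + 1) + 1"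
    using *(3) by (intro esize_list_le) (auto simp: vec_def dsize_enc_bool)
  have "runs_within (wrap d lift_arg Q2)
      (Node (Node (enc (mat G)) (enc_nat k)) (Node (enc_pinst CVC G' k') (enc (vec G' S'))))
      (enc (lift_fun (d, (mat G, min ?n k), vec G' S'))) (T ?m)"
    unfolding T_def
  proof (rule wrap_runs[OF Q2 s(2)])
    show "esize ((mat G, min ?n k), vec G' S') \<le> 14 * ?m" using nm m vec by simp
  qed (use s(1) nm in auto)
  moreover have "vec G (kernel_lift \<alpha> G k G' k' S') = lift_fun (d, (mat G, min ?n k), vec G' S')"
    by (rule nth_equalityI) (simp_all add: vec_def kernel_lift_def d_def lift_fun_def)
  ultimately show "runs_within (lift_prog (kernel Q1 Q2 \<alpha>)) (enc_lift_input CVC G k G' k' S')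
      (enc_sol CVC G (lift (kernel Q1 Q2 \<alpha>) G k G' k' S')) (T ?m)"
    by (simp add: kernel_def enc_lift_input_def enc_vset_vec enc_pinst_def enc_graph_mat d_def)
qed

section \<open>Size bounds, strictness and the final estimate\<close>

lemma implemented_within_mono:
  assumes "implemented_within P K T1 T2"
    "\<And>I k. T1 I k \<le> T1' I k" "\<And>I k I' k' s. T2 I k I' k' s \<le> T2' I k I' k' s"
  shows "implemented_within P K T1' T2'"
  using assms unfolding implemented_within_def runs_within_def by (meson order.trans)

text \<open>With \<open>B\<close> vertices, a row of the matrix has size at most
  \<open>4 * B + 1\<close>, and its list cell makes this \<open>4 * B + 2\<close>.\<close>

definition size_bound :: "nat \<Rightarrow> nat \<Rightarrow> nat" where
  "size_bound d k = 1 + vertex_bound d k * (vertex_bound d k * 4 + 2) + k"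

lemma kernel_size:
  assumes "1 < \<alpha>" shows "size_bounded CVC (kernel Q1 Q2 \<alpha>) (size_bound (threshold \<alpha>))"
  unfolding size_bounded_def
proof (intro ballI allI impI)
  fix G k G' k'
  assume G: "G \<in> instances CVC" and "reduce (kernel Q1 Q2 \<alpha>) G k = (G', k')"
  then have "kernel_reduce \<alpha> G k = (G', k')" by (simp add: kernel_def)
  note * = kernel_reduceD[OF G assms this]
  let ?B = "vertex_bound (threshold \<alpha>) k"
  have "esize (mat G') \<le> ?B * ((?B * (3 + 1) + 1) + 1) + 1"
  proof (rule esize_list_le)
    fix r assume r: "r \<in> set (mat G')"
    show "esize r \<le> ?B * (3 + 1) + 1"
      using r *(2) by (intro esize_list_le) (auto simp: mat_def Let_def dsize_enc_bool)
  qed (use *(2) in simp)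
  then show "inst_size CVC G' + k' \<le> size_bound (threshold \<alpha>) k"
    using *(4) by (simp add: inst_size_def enc_graph_mat size_bound_def algebra_simps)
qed

text \<open>For fixed \<open>d\<close> this is a polynomial expression, so the closure properties
  for running times also deliver computability.\<close>

lemma computable_size_bound: "computable_fun (size_bound d)"
proof -
  have "polyt (size_bound d)"
    unfolding size_bound_def[abs_def] vertex_bound_def by (intro polyt_intros)
  then obtain P c where P: "implements P 0 (size_bound d) (\<lambda>x. (esize x + 2) ^ c)" by (rule polytE)
  have "runs_within P (enc_nat k) (enc_nat (size_bound d k)) (real ((esize k + 2) ^ c))" for k
  proof -
    obtain t where "eval P (enc k) (P ! 0) (enc (size_bound d k)) t"
        "t + esize (size_bound d k) \<le> (esize k + 2) ^ c" "P \<noteq> []"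
      using P unfolding implements_def by blast
    then show ?thesis
      unfolding runs_within_def enc_nat_inst of_nat_le_iff by blast
  qed
  then show ?thesis unfolding computable_fun_def by blast
qed

lemma polynomial_size_bound: "\<exists>p. size_bound d = poly p"
proof -
  let ?x = "[:0, 1:] :: nat poly"
  have x: "poly ?x k = k" for k by simp
  obtain v :: "nat poly" where v: "\<And>k. poly v k = vertex_bound d k"
  proof
    show "poly (?x + ?x * (?x + 1) + (?x + 1) * (?x ^ (d - 1) + 1)) k = vertex_bound d k" for k
      by (simp only: x poly_add poly_mult poly_power poly_1 vertex_bound_def)
  qed
  have "poly (1 + v * (v * 4 + 2) + ?x) k = size_bound d k" for k
    by (simp only: x v poly_add poly_mult poly_numeral poly_1 size_bound_def)
  then have "size_bound d = poly (1 + v * (v * 4 + 2) + ?x)" by presburger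
  then show ?thesis by blast
qed

text \<open>Ratios are at least 1, so the strict guarantee implies the multiplicative one.\<close>

lemma ereal_max_le_mult:
  fixes r :: ereal assumes "1 \<le> r" "1 \<le> \<alpha>" shows "max r (ereal \<alpha>) \<le> ereal \<alpha> * r"
proof (rule max.boundedI)
  show "r \<le> ereal \<alpha> * r"
    using ereal_mult_right_mono[of 1 "ereal \<alpha>" r] assms by (simp add: one_ereal_def order.trans[of 0 1 r])
  show "ereal \<alpha> \<le> ereal \<alpha> * r"
    using ereal_mult_left_mono[of 1 r "ereal \<alpha>"] assms by simp
qed

lemma kernel_strict:
  assumes Q: "implements Q1 0 reduce_fun (\<lambda>x. (esize x + 2) ^ c1)"
    "implements Q2 0 lift_fun (\<lambda>x. (esize x + 2) ^ c2)" and \<alpha>: "1 < \<alpha>"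
  shows "strict_approx_kernel CVC \<alpha> (kernel Q1 Q2 \<alpha>)"
  unfolding strict_approx_kernel_def approx_kernel_def
proof (intro conjI)
  let ?K = "kernel Q1 Q2 \<alpha>"
  show "well_typed CVC ?K"
    unfolding well_typed_def
  proof (intro ballI allI impI conjI)
    fix G k G' k'
    assume G: "G \<in> instances CVC" and "reduce ?K G k = (G', k')"
    then have red: "kernel_reduce \<alpha> G k = (G', k')" by (simp add: kernel_def)
    show "G' \<in> instances CVC" by (rule kernel_reduceD(1)[OF G \<alpha> red])
    obtain n where "pverts G = {..<n}" using G by auto
    then show "lift ?K G k G' k' S' \<in> solutions CVC G" for S'
      by (auto simp: kernel_def kernel_lift_def)
  qed
  show "\<exists>g. computable_fun g \<and> size_bounded CVC ?K g"
    using computable_size_bound kernel_size[OF \<alpha>] by blast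
  have strict: "approx_ratio CVC G k (lift ?K G k G' k' S') \<le> max (approx_ratio CVC G' k' S') (ereal \<alpha>)"
    if "G \<in> instances CVC" "reduce ?K G k = (G', k')" "S' \<in> solutions CVC G'" for G k G' k' S'
    using kernel_ratio[OF that(1) \<alpha>, of k G' k' S'] that(2,3) by (simp add: kernel_def)
  show "\<forall>G\<in>instances CVC. \<forall>k G' k'. reduce ?K G k = (G', k') \<longrightarrow> (\<forall>S'\<in>solutions CVC G'.
      approx_ratio CVC G k (lift ?K G k G' k' S') \<le> max (approx_ratio CVC G' k' S') (ereal \<alpha>))"
  proof (intro ballI allI impI)
    fix G k G' k' S'
    assume "G \<in> instances CVC" "reduce ?K G k = (G', k')" "S' \<in> solutions CVC G'"
    then show "approx_ratio CVC G k (lift ?K G k G' k' S') \<le> max (approx_ratio CVC G' k' S') (ereal \<alpha>)"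
      by (rule strict)
  qed
  show "\<forall>G\<in>instances CVC. \<forall>k G' k'. reduce ?K G k = (G', k') \<longrightarrow> (\<forall>S'\<in>solutions CVC G'.
      approx_ratio CVC G k (lift ?K G k G' k' S') \<le> ereal \<alpha> * approx_ratio CVC G' k' S')"
  proof (intro ballI allI impI)
    fix G k G' k' S'
    assume *: "G \<in> instances CVC" "reduce ?K G k = (G', k')" "S' \<in> solutions CVC G'"
    then have "kernel_reduce \<alpha> G k = (G', k')" by (simp add: kernel_def)
    then have "G' \<in> instances CVC" by (rule kernel_reduceD(1)[OF *(1) \<alpha>])
    then have "1 \<le> approx_ratio CVC G' k' S'" by (intro ratio_ge_1) simp
    then show "approx_ratio CVC G k (lift ?K G k G' k' S') \<le> ereal \<alpha> * approx_ratio CVC G' k' S'"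
      using \<alpha> by (intro order.trans[OF strict[OF *] ereal_max_le_mult]) simp_all
  qed
  let ?d = "threshold \<alpha>"
  let ?f = "(2 * ?d + 70) + (2 * ?d + 20) ^ (c1 + c2)"
  let ?p = "monom ?f (c1 + c2 + 1)"
  \<comment> \<open>Polynomial time is measured in the whole input of a program, which is at least
    as large as the instance.\<close>
  have poly: "real ?f * real m ^ (c1 + c2 + 1) \<le> real (poly ?p n)" if "m \<le> n" for m n
  proof -
    have "?f * m ^ (c1 + c2 + 1) \<le> ?f * n ^ (c1 + c2 + 1)"
      using that by (intro mult_left_mono power_mono) auto
    then have "real (?f * m ^ (c1 + c2 + 1)) \<le> real (?f * n ^ (c1 + c2 + 1))"
      by (simp only: of_nat_le_iff)
    then show ?thesis by (simp only: poly_monom of_nat_mult of_nat_power)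
  qed
  show "polynomial_time CVC ?K"
    unfolding polynomial_time_def
    by (rule exI[of _ ?p], rule implemented_within_mono[OF kernel_implemented[OF Q \<alpha>]]; rule poly)
       (simp_all add: inst_size_def enc_pinst_def enc_lift_input_def)
qed

text \<open>At most \<open>k ^ (d - 1) + 1\<close> neighbourhoods with \<open>k + 1\<close> twins
  each give the \<open>4 * k ^ d\<close>, and the other terms are at most \<open>3 * k ^ 2\<close>.
  At \<open>k = 0\<close> the left side is positive while the right side vanishes.\<close>

lemma vertex_bound_le:
  assumes "1 \<le> k" "1 \<le> d"
  shows "real (vertex_bound d k) \<le> 4 * (real k ^ d + real k ^ 2)"
proof -
  have "k \<le> k ^ 2" "1 \<le> k ^ (d - 1)" using assms(1) by (simp_all add: power2_eq_square)
  have "k * (k + 1) \<le> 2 * k ^ 2"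
    using \<open>k \<le> k ^ 2\<close> by (simp add: power2_eq_square)
  moreover have "(k + 1) * (k ^ (d - 1) + 1) \<le> (2 * k) * (2 * k ^ (d - 1))"
    using assms(1) \<open>1 \<le> k ^ (d - 1)\<close> by (intro mult_mono) auto
  moreover have "(2 * k) * (2 * k ^ (d - 1)) = 4 * k ^ d"
    using assms(2) by (cases d) auto
  ultimately have "vertex_bound d k \<le> k ^ 2 + 2 * k ^ 2 + 4 * k ^ d"
    unfolding vertex_bound_def using \<open>k \<le> k ^ 2\<close> by (intro add_mono) simp_all
  also have "\<dots> \<le> 4 * (k ^ d + k ^ 2)" by simp
  finally have "vertex_bound d k \<le> 4 * (k ^ d + k ^ 2)" .
  then have "real (vertex_bound d k) \<le> real (4 * (k ^ d + k ^ 2))" by (simp only: of_nat_le_iff)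
  then show ?thesis by simp
qed

theorem theorem4p4:
  "\<exists>(K :: real \<Rightarrow> (ugraph, nat set) kernelization) (C :: real).
     strict_PSAKS CVC K \<and> time_efficient CVC K \<and>
     (\<forall>\<alpha>>1. \<forall>G\<in>instances CVC. \<forall>k\<ge>1. \<forall>G' k'. reduce (K \<alpha>) G k = (G', k') \<longrightarrow>
        real (card (pverts G')) \<le> C * (real k ^ nat \<lceil>\<alpha> / (\<alpha> - 1)\<rceil> + real k ^ 2))"
proof -
  obtain Q1 c1 where Q1: "implements Q1 0 reduce_fun (\<lambda>x. (esize x + 2) ^ c1)"
    using polyt_reduce_fun by (rule polytE)
  obtain Q2 c2 where Q2: "implements Q2 0 lift_fun (\<lambda>x. (esize x + 2) ^ c2)"
    using polyt_lift_fun by (rule polytE)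
  let ?K = "kernel Q1 Q2"
  have "polynomial_size CVC (?K \<alpha>)" if "1 < \<alpha>" for \<alpha>
    using kernel_size[OF that, of Q1 Q2] polynomial_size_bound[of "threshold \<alpha>"]
    unfolding polynomial_size_def by auto
  then have "strict_PSAKS CVC ?K"
    using kernel_strict[OF Q1 Q2]
    by (simp add: strict_PSAKS_def PSAKS_def strict_approx_kernel_def)
  moreover have "time_efficient CVC ?K"
    unfolding time_efficient_def
    by (rule exI[of _ "\<lambda>\<alpha>. real ((2 * threshold \<alpha> + 70) + (2 * threshold \<alpha> + 20) ^ (c1 + c2))"],
        rule exI[of _ "c1 + c2 + 1"]) (blast intro: kernel_implemented[OF Q1 Q2])
  moreover have "real (card (pverts G')) \<le> 4 * (real k ^ nat \<lceil>\<alpha> / (\<alpha> - 1)\<rceil> + real k ^ 2)"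
    if "1 < \<alpha>" "G \<in> instances CVC" "1 \<le> k" "reduce (?K \<alpha>) G k = (G', k')" for \<alpha> G k G' k'
  proof -
    have "card (pverts G') \<le> vertex_bound (threshold \<alpha>) k"
      using kernel_reduceD(2)[OF that(2,1)] that(4) by (simp add: kernel_def)
    moreover have "1 \<le> threshold \<alpha>" using threshold(1)[OF that(1)] by simp
    ultimately show ?thesis
      using vertex_bound_le[OF that(3), of "threshold \<alpha>"] unfolding threshold_def[symmetric] by linarith
  qed
  ultimately show ?thesis by blast
qed

end
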